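(* Let $V,Q\in L_\infty(0,1)$ be complex-valued and $\alpha,\beta\in[0,1]$. The system of eigenfunctions and generalized eigenfunctions of the operator $\mathcal{H}(\alpha,\beta)$ forms a Bari basis in the space $L^2(0,1)$.
   Context: $\mathcal{E}:L^2(0,1)\to L^2(\mathbb{R})$ is the operator of continuation by zero outside $(0,1)$, $\mathcal{R}:L^2(\mathbb{R})\to L^2(0,1)$ is the operator of restriction to $(0,1)$, and for $\alpha\in[-1,1]$ the translation operator in $L^2(\mathbb{R})$ is $(\mathcal{T}(\alpha)y)(x)=y(x+\alpha)$. For $V,Q\in L_\infty(0,1)$ complex-valued and $\alpha,\beta\in[0,1]$, put $\mathcal{B}(\alpha,\beta)=V\mathcal{R}\mathcal{T}(\alpha)\mathcal{E}+Q\mathcal{R}\mathcal{T}(-\beta)\mathcal{E}$. The operator $\mathcal{A}y=-y''$ in $L^2(0,1)$ has domain $\mathfrak{D}(\mathcal{A})=\{y\in W_2^2(0,1):y'(0)=y'(1)=0\}$. The operator $\mathcal{H}(\alpha,\beta)=\mathcal{A}+\mathcal{B}(\alpha,\beta)$ in $L^2(0,1)$ has domain $\mathfrak{D}(\mathcal{A})$; that is, $(\mathcal{H}(\alpha,\beta)y)(x)=-y''(x)+V(x)y(x+\alpha)+Q(x)y(x-\beta)$, where $y$ is continued by zero outside $[0,1]$. It has compact resolvent and its spectrum consists of countably many eigenvalues accumulating only at infinity. A Bari basis is a basis generated by a system of projections which is quadratically close to a complete and minimal system of orthogonal projections. Explicitly: there is a complete and minimal system of finite-rank projections $P_k$ with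 $P_kP_m=\delta_{km}P_k$, whose ranges are spanned by the eigenfunctions and generalized eigenfunctions in question, and a complete system of mutually orthogonal orthogonal projections $P_k^0$ such that $\sum_k\|P_k-P_k^0\|^2<\infty$ (the sum being over all but finitely many $k$). *)

theory Defs
  imports "HOL-Analysis.Analysis"
begin

section \<open>The complex Hilbert space of square-integrable functions on the unit interval\<close>

abbreviation leb01 :: "real measure" where
  "leb01 \<equiv> lebesgue_on {0<..<1}"

text \<open>Representatives are total functions on the reals; only their values on (0,1) matter.\<close>

definition sq_int :: "(real \<Rightarrow> complex) \<Rightarrow> bool" where
  "sq_int f \<longleftrightarrow> f \<in> borel_measurable leb01 \<and> integrable leb01 (\<lambda>x. (cmod (f x))\<^sup>2)"

definition l2_eq :: "(real \<Rightarrow> complex) \<Rightarrow> (real \<Rightarrow> complex) \<Rightarrow> bool" where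
  "l2_eq f g \<longleftrightarrow> sq_int f \<and> sq_int g \<and> (AE x in leb01. f x = g x)"

lemma sq_int_zero: "sq_int (\<lambda>_. 0)"
  by (simp add: sq_int_def)

lemma sq_int_mult_integrable:
  assumes "sq_int f" "sq_int g"
  shows "integrable leb01 (\<lambda>x. f x * cnj (g x))"
proof (rule Bochner_Integration.integrable_bound)
  show "integrable leb01 (\<lambda>x. (cmod (f x))\<^sup>2 + (cmod (g x))\<^sup>2)"
    using assms by (simp add: sq_int_def)
  have [measurable]: "f \<in> borel_measurable leb01" "g \<in> borel_measurable leb01"
    using assms by (auto simp: sq_int_def)
  have "(\<lambda>x. cnj (g x)) \<in> borel_measurable leb01"
    by (rule borel_measurable_continuous_on[where f = cnj])
      (simp_all add: continuous_on_cnj)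
  then show "(\<lambda>x. f x * cnj (g x)) \<in> borel_measurable leb01"
    by measurable
  have "a * b \<le> a\<^sup>2 + b\<^sup>2" if "a \<ge> 0" "b \<ge> 0" for a b :: real
  proof -
    have "0 \<le> a * b" using that by simp
    then show ?thesis using sum_squares_bound[of a b] by linarith
  qed
  then show "AE x in leb01. norm (f x * cnj (g x)) \<le> norm ((cmod (f x))\<^sup>2 + (cmod (g x))\<^sup>2)"
    by (simp add: norm_mult)
qed

lemma sq_int_add:
  assumes "sq_int f" "sq_int g"
  shows "sq_int (\<lambda>x. f x + g x)"
proof -
  have [measurable]: "f \<in> borel_measurable leb01" "g \<in> borel_measurable leb01"
    using assms by (auto simp: sq_int_def)
  have "integrable leb01 (\<lambda>x. (cmod (f x + g x))\<^sup>2)"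
  proof (rule Bochner_Integration.integrable_bound)
    show "integrable leb01 (\<lambda>x. 2 * (cmod (f x))\<^sup>2 + 2 * (cmod (g x))\<^sup>2)"
      using assms by (simp add: sq_int_def)
    have "(cmod (a + b))\<^sup>2 \<le> 2 * (cmod a)\<^sup>2 + 2 * (cmod b)\<^sup>2" for a b
    proof -
      have "(cmod (a + b))\<^sup>2 \<le> (cmod a + cmod b)\<^sup>2"
        by (simp add: norm_triangle_ineq power_mono)
      also have "\<dots> \<le> 2 * (cmod a)\<^sup>2 + 2 * (cmod b)\<^sup>2"
        using sum_squares_bound[of "cmod a" "cmod b"] by (simp add: power2_sum)
      finally show ?thesis .
    qed
    then show "AE x in leb01. norm ((cmod (f x + g x))\<^sup>2)
        \<le> norm (2 * (cmod (f x))\<^sup>2 + 2 * (cmod (g x))\<^sup>2)"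
      by simp
  qed measurable
  then show ?thesis
    by (simp add: sq_int_def)
qed

lemma sq_int_cmult: "sq_int f \<Longrightarrow> sq_int (\<lambda>x. c * f x)"
  by (auto simp: sq_int_def norm_mult power_mult_distrib)

lemma l2_eq_lift:
  assumes "l2_eq f g" "sq_int (\<lambda>x. h x (f x))" "sq_int (\<lambda>x. h x (g x))"
  shows "l2_eq (\<lambda>x. h x (f x)) (\<lambda>x. h x (g x))"
proof -
  have "AE x in leb01. f x = g x"
    using assms by (simp add: l2_eq_def)
  then have "AE x in leb01. h x (f x) = h x (g x)"
    by eventually_elim simp
  then show ?thesis
    using assms by (simp add: l2_eq_def)
qed

quotient_type l2 = "real \<Rightarrow> complex" / partial: l2_eq
proof (rule part_equivpI)
  show "\<exists>x. l2_eq x x"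
    by (rule exI[of _ "\<lambda>_. 0"]) (simp add: l2_eq_def sq_int_zero)
  show "symp l2_eq"
    by (rule sympI) (simp add: l2_eq_def eq_commute)
  show "transp l2_eq"
  proof (rule transpI)
    fix f g h assume *: "l2_eq f g" "l2_eq g h"
    then have "AE x in leb01. f x = g x" "AE x in leb01. g x = h x"
      by (simp_all add: l2_eq_def)
    then have "AE x in leb01. f x = h x"
      by eventually_elim simp
    with * show "l2_eq f h"
      by (simp add: l2_eq_def)
  qed
qed

lift_definition cscale :: "complex \<Rightarrow> l2 \<Rightarrow> l2" (infixr "*\<^sub>C" 75) is "\<lambda>c f x. c * f x"
  by (rule l2_eq_lift) (simp_all add: l2_eq_def sq_int_cmult)

lift_definition cinner :: "l2 \<Rightarrow> l2 \<Rightarrow> complex" is "\<lambda>f g. LINT x|leb01. f x * cnj (g x)"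
proof -
  fix f f' g g' assume *: "l2_eq f f'" "l2_eq g g'"
  have "AE x in leb01. f x = f' x" "AE x in leb01. g x = g' x"
    using * by (auto simp: l2_eq_def)
  then have "AE x in leb01. f x * cnj (g x) = f' x * cnj (g' x)"
    by eventually_elim simp
  moreover have "integrable leb01 (\<lambda>x. f x * cnj (g x))" "integrable leb01 (\<lambda>x. f' x * cnj (g' x))"
    using * by (auto simp: l2_eq_def intro: sq_int_mult_integrable)
  ultimately show "(LINT x|leb01. f x * cnj (g x)) = (LINT x|leb01. f' x * cnj (g' x))"
    by (intro integral_cong_AE) auto
qed

instantiation l2 :: real_inner
begin

lift_definition zero_l2 :: l2 is "\<lambda>_. 0"
  by (simp add: l2_eq_def sq_int_zero)

lift_definition plus_l2 :: "l2 \<Rightarrow> l2 \<Rightarrow> l2" is "\<lambda>f g x. f x + g x"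
proof -
  fix f f' g g' assume *: "l2_eq f f'" "l2_eq g g'"
  have "AE x in leb01. f x = f' x" "AE x in leb01. g x = g' x"
    using * by (auto simp: l2_eq_def)
  then have "AE x in leb01. f x + g x = f' x + g' x"
    by eventually_elim simp
  then show "l2_eq (\<lambda>x. f x + g x) (\<lambda>x. f' x + g' x)"
    using * by (auto simp: l2_eq_def sq_int_add)
qed

definition uminus_l2 :: "l2 \<Rightarrow> l2" where "- f = (-1) *\<^sub>C f"
definition minus_l2 :: "l2 \<Rightarrow> l2 \<Rightarrow> l2" where "f - g = f + - (g :: l2)"
definition scaleR_l2 :: "real \<Rightarrow> l2 \<Rightarrow> l2" where "r *\<^sub>R f = complex_of_real r *\<^sub>C f"
definition inner_l2 :: "l2 \<Rightarrow> l2 \<Rightarrow> real" where "f \<bullet> g = Re (cinner f g)"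
definition norm_l2 :: "l2 \<Rightarrow> real" where "norm f = sqrt (f \<bullet> (f :: l2))"
definition dist_l2 :: "l2 \<Rightarrow> l2 \<Rightarrow> real" where "dist f g = norm (f - (g :: l2))"
definition sgn_l2 :: "l2 \<Rightarrow> l2" where "sgn f = inverse (norm f) *\<^sub>R (f :: l2)"
definition uniformity_l2 :: "(l2 \<times> l2) filter" where
  "uniformity = (INF e\<in>{0 <..}. principal {(x, y). dist x (y :: l2) < e})"
definition open_l2 :: "l2 set \<Rightarrow> bool" where
  "open U \<longleftrightarrow> (\<forall>x\<in>U. eventually (\<lambda>(x', y). x' = x \<longrightarrow> y \<in> U) (uniformity :: (l2 \<times> l2) filter))"

instance
proof
  fix f g h :: l2 and r s :: real
  show "f + g + h = f + (g + h)"
    by transfer (auto simp: l2_eq_def add.assoc intro: sq_int_add)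
  show "f + g = g + f"
    by transfer (auto simp: l2_eq_def add.commute intro: sq_int_add)
  show "0 + f = f"
    by transfer (auto simp: l2_eq_def)
  show "- f + f = 0"
    unfolding uminus_l2_def by transfer (auto simp: l2_eq_def intro: sq_int_zero)
  show "f - g = f + - g"
    by (simp add: minus_l2_def)
  show "r *\<^sub>R (f + g) = r *\<^sub>R f + r *\<^sub>R g"
    unfolding scaleR_l2_def
    by transfer (auto simp: l2_eq_def distrib_left intro!: sq_int_add sq_int_cmult)
  show "(r + s) *\<^sub>R f = r *\<^sub>R f + s *\<^sub>R f"
    unfolding scaleR_l2_def of_real_add
    by transfer (auto simp: l2_eq_def distrib_right intro!: sq_int_add sq_int_cmult)
  show "r *\<^sub>R s *\<^sub>R f = (r * s) *\<^sub>R f"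
    unfolding scaleR_l2_def of_real_mult
    by transfer (auto simp: l2_eq_def mult.assoc intro!: sq_int_cmult)
  show "1 *\<^sub>R f = f"
    unfolding scaleR_l2_def of_real_1
    by transfer (auto simp: l2_eq_def)
  show "dist f g = norm (f - g)"
    by (simp add: dist_l2_def)
  show "sgn f = inverse (norm f) *\<^sub>R f"
    by (simp add: sgn_l2_def)
  show "uniformity = (INF e\<in>{0 <..}. principal {(x, y). dist x (y :: l2) < e})"
    by (simp add: uniformity_l2_def)
  show "open U \<longleftrightarrow> (\<forall>x\<in>U. \<forall>\<^sub>F (x', y) in uniformity. x' = x \<longrightarrow> y \<in> U)" for U :: "l2 set"
    by (simp add: open_l2_def)
  have "cinner f g = cnj (cinner g f)"
    by transfer (simp add: mult.commute flip: Bochner_Integration.integral_cnj)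
  then show "f \<bullet> g = g \<bullet> f"
    by (simp add: inner_l2_def)
  have "cinner (f + g) h = cinner f h + cinner g h"
    by transfer (simp add: l2_eq_def distrib_right sq_int_mult_integrable)
  then show "(f + g) \<bullet> h = f \<bullet> h + g \<bullet> h"
    by (simp add: inner_l2_def)
  have "cinner (complex_of_real r *\<^sub>C f) g = complex_of_real r * cinner f g"
    by transfer (simp add: mult.assoc)
  then show "r *\<^sub>R f \<bullet> g = r * (f \<bullet> g)"
    by (simp add: inner_l2_def scaleR_l2_def)
  have sq: "Re (LINT x|leb01. u x * cnj (u x)) = (LINT x|leb01. (cmod (u x))\<^sup>2)" for u
    unfolding complex_norm_square[symmetric] of_real_power[symmetric] integral_complex_of_real
    by simp
  show "0 \<le> f \<bullet> f"
    unfolding inner_l2_def by transfer (simp only: sq, simp)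
  show "f \<bullet> f = 0 \<longleftrightarrow> f = 0"
    unfolding inner_l2_def
  proof transfer
    fix u assume "l2_eq u u"
    then have "sq_int u" by (simp add: l2_eq_def)
    then have "(LINT x|leb01. (cmod (u x))\<^sup>2) = 0 \<longleftrightarrow> (AE x in leb01. (cmod (u x))\<^sup>2 = 0)"
      by (intro integral_nonneg_eq_0_iff_AE) (auto simp: sq_int_def)
    with \<open>sq_int u\<close> show "Re (LINT x|leb01. u x * cnj (u x)) = 0 \<longleftrightarrow> l2_eq u (\<lambda>_. 0)"
      unfolding sq by (simp add: l2_eq_def sq_int_zero)
  qed
  show "norm f = sqrt (f \<bullet> f)"
    by (simp add: norm_l2_def)
qed

end

global_interpretation cvec: vector_space cscale
proof
  fix a b :: complex and f g :: l2
  show "a *\<^sub>C (f + g) = a *\<^sub>C f + a *\<^sub>C g"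
    by transfer (auto simp: l2_eq_def distrib_left intro!: sq_int_add sq_int_cmult)
  show "(a + b) *\<^sub>C f = a *\<^sub>C f + b *\<^sub>C f"
    by transfer (auto simp: l2_eq_def distrib_right intro!: sq_int_add sq_int_cmult)
  show "a *\<^sub>C b *\<^sub>C f = (a * b) *\<^sub>C f"
    by transfer (auto simp: l2_eq_def mult.assoc intro!: sq_int_cmult)
  show "1 *\<^sub>C f = f"
    by transfer (auto simp: l2_eq_def)
qed

section \<open>The functional-differential operator\<close>

definition linf :: "(real \<Rightarrow> complex) set" where
  "linf = {V \<in> borel_measurable leb01. \<exists>C. AE x in leb01. cmod (V x) \<le> C}"

text \<open>Multiplication is meaningful for essentially bounded \<open>V\<close> only; it is 0 otherwise.\<close>

lift_definition mult_op :: "(real \<Rightarrow> complex) \<Rightarrow> l2 \<Rightarrow> l2" is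
  "\<lambda>V f. if V \<in> linf then (\<lambda>x. V x * f x) else (\<lambda>_. 0)"
proof -
  fix V f g assume fg: "l2_eq f g"
  have sq: "sq_int (\<lambda>x. V x * u x)" if V: "V \<in> linf" and u: "sq_int u" for u
  proof -
    have [measurable]: "V \<in> borel_measurable leb01" "u \<in> borel_measurable leb01"
      using u V by (auto simp: sq_int_def linf_def)
    obtain C where C: "AE x in leb01. cmod (V x) \<le> C"
      using V by (auto simp: linf_def)
    have "integrable leb01 (\<lambda>x. (cmod (V x * u x))\<^sup>2)"
    proof (rule Bochner_Integration.integrable_bound)
      show "integrable leb01 (\<lambda>x. C\<^sup>2 * (cmod (u x))\<^sup>2)"
        using u by (simp add: sq_int_def)
      show "AE x in leb01. norm ((cmod (V x * u x))\<^sup>2) \<le> norm (C\<^sup>2 * (cmod (u x))\<^sup>2)"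
        using C by eventually_elim
          (simp add: norm_mult power_mult_distrib mult_right_mono power_mono)
    qed measurable
    then show ?thesis
      by (simp add: sq_int_def)
  qed
  have "AE x in leb01. f x = g x"
    using fg by (simp add: l2_eq_def)
  then have "AE x in leb01. V x * f x = V x * g x"
    by eventually_elim simp
  then show "l2_eq (if V \<in> linf then (\<lambda>x. V x * f x) else (\<lambda>_. 0))
       (if V \<in> linf then (\<lambda>x. V x * g x) else (\<lambda>_. 0))"
    using fg by (auto simp: l2_eq_def sq sq_int_zero)
qed

definition zero_ext :: "(real \<Rightarrow> complex) \<Rightarrow> real \<Rightarrow> complex" where
  "zero_ext f x = (if x \<in> {0<..<1} then f x else 0)"

definition translate :: "real \<Rightarrow> (real \<Rightarrow> complex) \<Rightarrow> real \<Rightarrow> complex" where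
  "translate a f x = f (x + a)"

lemma sq_int_translate:
  assumes "sq_int f"
  shows "sq_int (translate a (zero_ext f))"
proof -
  have "zero_ext f = (\<lambda>x. if x \<in> {0<..<1} then f x else 0)"
    by (simp add: fun_eq_iff zero_ext_def)
  then have m: "zero_ext f \<in> borel_measurable lebesgue"
    using assms by (simp only:) (rule borel_measurable_if_I, auto simp: sq_int_def)
  have "integrable lebesgue (\<lambda>x. (cmod (zero_ext f x))\<^sup>2)"
  proof -
    have eq: "(\<lambda>x. (cmod (zero_ext f x))\<^sup>2) = (\<lambda>x. indicator {0<..<1} x *\<^sub>R (cmod (f x))\<^sup>2)"
      by (auto simp: fun_eq_iff zero_ext_def)
    show ?thesis
      unfolding eq using assms by (subst integrable_restrict_space [symmetric]) (auto simp: sq_int_def)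
  qed
  then have i: "integrable lebesgue (\<lambda>x. (cmod (translate a (zero_ext f) x))\<^sup>2)"
    using lebesgue_integrable_real_affine[of "\<lambda>x. (cmod (zero_ext f x))\<^sup>2" 1 a]
    by (simp add: translate_def add.commute)
  have "translate a (zero_ext f) \<in> borel_measurable lebesgue"
    using borel_measurable_affine[OF m, of 1 a] by (simp add: translate_def[abs_def] add.commute)
  then have "translate a (zero_ext f) \<in> borel_measurable leb01"
    by (rule measurable_restrict_space1)
  moreover have "integrable leb01 (\<lambda>x. (cmod (translate a (zero_ext f) x))\<^sup>2)"
  proof (subst integrable_restrict_space)
    show "integrable lebesgue
        (\<lambda>x. indicator {0<..<1} x *\<^sub>R (cmod (translate a (zero_ext f) x))\<^sup>2)"
      using i by (intro integrable_mult_indicator) auto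
  qed simp
  ultimately show ?thesis
    by (simp add: sq_int_def)
qed

text \<open>Continuation by zero to the real line, translation by \<open>a\<close>, restriction to (0,1); the last
  step is implicit in passing to the class modulo equality almost everywhere on (0,1).\<close>

lift_definition shift_op :: "real \<Rightarrow> l2 \<Rightarrow> l2" is "\<lambda>a f. translate a (zero_ext f)"
proof -
  fix a f g assume fg: "l2_eq f g"
  then have "AE x in lebesgue. x \<in> {0<..<1} \<longrightarrow> f x = g x"
    by (subst (asm) l2_eq_def) (simp add: AE_restrict_space_iff)
  then have "AE x in lebesgue. zero_ext f x = zero_ext g x"
    by eventually_elim (simp add: zero_ext_def)
  then obtain N where N: "negligible N" "{x. zero_ext f x \<noteq> zero_ext g x} \<subseteq> N"
    unfolding eventually_ae_filter_negligible by blast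
  have "AE x in lebesgue. translate a (zero_ext f) x = translate a (zero_ext g) x"
    unfolding eventually_ae_filter_negligible
  proof (intro exI conjI subsetI)
    show "negligible ((+) (-a) ` N)"
      by (rule negligible_translation[OF N(1)])
    fix x assume "x \<in> {x. translate a (zero_ext f) x \<noteq> translate a (zero_ext g) x}"
    then have "x + a \<in> N"
      using N(2) by (auto simp: translate_def)
    then show "x \<in> (+) (-a) ` N"
      by (intro image_eqI[of _ _ "x + a"]) auto
  qed
  then have "AE x in leb01. translate a (zero_ext f) x = translate a (zero_ext g) x"
    by (subst AE_restrict_space_iff) (simp_all add: eventually_mono)
  then show "l2_eq (translate a (zero_ext f)) (translate a (zero_ext g))"
    using fg by (auto simp: l2_eq_def sq_int_translate)
qed

definition op_B :: "(real \<Rightarrow> complex) \<Rightarrow> (real \<Rightarrow> complex) \<Rightarrow> real \<Rightarrow> real \<Rightarrow> l2 \<Rightarrow> l2" where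
  "op_B V Q \<alpha> \<beta> y = mult_op V (shift_op \<alpha> y) + mult_op Q (shift_op (- \<beta>) y)"

text \<open>Test functions are the continuously differentiable functions with compact support in (0,1),
  given together with their derivative.\<close>

definition test_fun :: "(real \<Rightarrow> complex) \<Rightarrow> (real \<Rightarrow> complex) \<Rightarrow> bool" where
  "test_fun \<phi> \<phi>' \<longleftrightarrow>
     (\<forall>x. (\<phi> has_vector_derivative \<phi>' x) (at x)) \<and> continuous_on UNIV \<phi>' \<and>
     (\<exists>K. compact K \<and> K \<subseteq> {0<..<1} \<and> (\<forall>x. x \<notin> K \<longrightarrow> \<phi> x = 0))"

lemma test_fun_measurable:
  assumes "test_fun \<phi> \<phi>'"
  shows "\<phi> \<in> borel_measurable leb01" "\<phi>' \<in> borel_measurable leb01"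
proof -
  have "continuous_on UNIV \<phi>"
    using assms unfolding test_fun_def
    by (meson continuous_at_imp_continuous_on has_vector_derivative_continuous)
  moreover have "continuous_on UNIV \<phi>'"
    using assms by (simp add: test_fun_def)
  ultimately show "\<phi> \<in> borel_measurable leb01" "\<phi>' \<in> borel_measurable leb01"
    by (auto intro!: continuous_imp_measurable_on_sets_lebesgue intro: continuous_on_subset)
qed

lift_definition has_weak_deriv :: "l2 \<Rightarrow> l2 \<Rightarrow> bool" is
  "\<lambda>f g. \<forall>\<phi> \<phi>'. test_fun \<phi> \<phi>' \<longrightarrow>
     (LINT x|leb01. f x * \<phi>' x) = - (LINT x|leb01. g x * \<phi> x)"
proof -
  fix f f' g g' assume *: "l2_eq f f'" "l2_eq g g'"
  have cong: "(LINT x|leb01. u x * \<psi> x) = (LINT x|leb01. v x * \<psi> x)"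
    if uv: "l2_eq u v" and [measurable]: "\<psi> \<in> borel_measurable leb01" for u v \<psi>
  proof (rule integral_cong_AE)
    have [measurable]: "u \<in> borel_measurable leb01" "v \<in> borel_measurable leb01"
      using uv by (auto simp: l2_eq_def sq_int_def)
    show "(\<lambda>x. u x * \<psi> x) \<in> borel_measurable leb01" "(\<lambda>x. v x * \<psi> x) \<in> borel_measurable leb01"
      by measurable
    have "AE x in leb01. u x = v x"
      using uv by (simp add: l2_eq_def)
    then show "AE x in leb01. u x * \<psi> x = v x * \<psi> x"
      by eventually_elim simp
  qed
  show "(\<forall>\<phi> \<phi>'. test_fun \<phi> \<phi>' \<longrightarrow> (LINT x|leb01. f x * \<phi>' x) = - (LINT x|leb01. g x * \<phi> x)) \<longleftrightarrow>
     (\<forall>\<phi> \<phi>'. test_fun \<phi> \<phi>' \<longrightarrow> (LINT x|leb01. f' x * \<phi>' x) = - (LINT x|leb01. g' x * \<phi> x))"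
    using cong[OF *(1)] cong[OF *(2)] test_fun_measurable by (metis (no_types, lifting))
qed

text \<open>The weak derivative is unique where it exists.\<close>

definition weak_deriv :: "l2 \<Rightarrow> l2" where
  "weak_deriv f = (THE g. has_weak_deriv f g)"

definition sobolev2 :: "l2 set" where
  "sobolev2 = {y. \<exists>y1 y2. has_weak_deriv y y1 \<and> has_weak_deriv y1 y2}"

lift_definition has_version :: "l2 \<Rightarrow> (real \<Rightarrow> complex) \<Rightarrow> bool" is
  "\<lambda>f p. AE x in leb01. f x = p x"
proof -
  fix f g assume "l2_eq f g"
  then have "AE x in leb01. f x = g x"
    by (simp add: l2_eq_def)
  then have "\<forall>p. (AE x in leb01. f x = p x) \<longleftrightarrow> (AE x in leb01. g x = p x)"
    by (auto intro!: eventually_subst elim: eventually_mono)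
  then show "(\<lambda>p. AE x in leb01. f x = p x) = (\<lambda>p. AE x in leb01. g x = p x)"
    by (simp add: fun_eq_iff)
qed

text \<open>Boundary values of the derivative are those of its representative continuous on [0,1].\<close>

definition dom_A :: "l2 set" where
  "dom_A = {y \<in> sobolev2. \<exists>p. continuous_on {0..1} p \<and> has_version (weak_deriv y) p \<and>
     p 0 = 0 \<and> p 1 = 0}"

definition op_A :: "l2 \<Rightarrow> l2" where
  "op_A y = - weak_deriv (weak_deriv y)"

definition op_H :: "(real \<Rightarrow> complex) \<Rightarrow> (real \<Rightarrow> complex) \<Rightarrow> real \<Rightarrow> real \<Rightarrow> l2 \<Rightarrow> l2" where
  "op_H V Q \<alpha> \<beta> y = op_A y + op_B V Q \<alpha> \<beta> y"

section \<open>Root vectors and Bari bases\<close>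

text \<open>The kernel of the \<open>n\<close>-th power of \<open>H - z\<close>, where \<open>H\<close> has domain \<open>D\<close>.\<close>

primrec ker_pow :: "l2 set \<Rightarrow> (l2 \<Rightarrow> l2) \<Rightarrow> complex \<Rightarrow> nat \<Rightarrow> l2 set" where
  "ker_pow D H z 0 = {0}"
| "ker_pow D H z (Suc n) = {y \<in> D. H y - z *\<^sub>C y \<in> ker_pow D H z n}"

definition root_vectors :: "l2 set \<Rightarrow> (l2 \<Rightarrow> l2) \<Rightarrow> l2 set" where
  "root_vectors D H = {y. y \<noteq> 0 \<and> (\<exists>z n. y \<in> ker_pow D H z n)}"

text \<open>Bounded complex-linear projections; the norm of \<open>l2 \<Rightarrow>\<^sub>L l2\<close> is the operator norm.\<close>

definition projection :: "(l2 \<Rightarrow>\<^sub>L l2) \<Rightarrow> bool" where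
  "projection P \<longleftrightarrow> (\<forall>c f. P (c *\<^sub>C f) = c *\<^sub>C P f) \<and> P o\<^sub>L P = P"

definition orth_projection :: "(l2 \<Rightarrow>\<^sub>L l2) \<Rightarrow> bool" where
  "orth_projection P \<longleftrightarrow> projection P \<and> (\<forall>f g. cinner (P f) g = cinner f (P g))"

definition finite_rank :: "(l2 \<Rightarrow>\<^sub>L l2) \<Rightarrow> bool" where
  "finite_rank P \<longleftrightarrow> (\<exists>F. finite F \<and> range P = cvec.span F)"

definition complete_system :: "(nat \<Rightarrow> l2 \<Rightarrow>\<^sub>L l2) \<Rightarrow> bool" where
  "complete_system P \<longleftrightarrow> closure (cvec.span (\<Union>k. range (P k))) = UNIV"

definition minimal_system :: "(nat \<Rightarrow> l2 \<Rightarrow>\<^sub>L l2) \<Rightarrow> bool" where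
  "minimal_system P \<longleftrightarrow> (\<forall>k. P k \<noteq> 0 \<and>
     range (P k) \<inter> closure (cvec.span (\<Union>m\<in>-{k}. range (P m))) = {0})"

definition bari_basis :: "l2 set \<Rightarrow> bool" where
  "bari_basis S \<longleftrightarrow> (\<exists>P P0 :: nat \<Rightarrow> l2 \<Rightarrow>\<^sub>L l2.
     (\<forall>k. projection (P k) \<and> finite_rank (P k)) \<and>
     (\<forall>k m. k \<noteq> m \<longrightarrow> P k o\<^sub>L P m = 0) \<and>
     (\<forall>k. range (P k) = cvec.span (S \<inter> range (P k))) \<and>
     S \<subseteq> (\<Union>k. range (P k)) \<and>
     complete_system P \<and> minimal_system P \<and>
     (\<forall>k. orth_projection (P0 k)) \<and>
     (\<forall>k m. k \<noteq> m \<longrightarrow> P0 k o\<^sub>L P0 m = 0) \<and>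
     complete_system P0 \<and> minimal_system P0 \<and>
     (\<exists>N. summable (\<lambda>k. (norm (P (k + N) - P0 (k + N)))\<^sup>2)))"

end

theory Submission
  imports Defs "HOL-Computational_Algebra.Fundamental_Theorem_Algebra"
begin

text \<open>
  In the orthonormal basis of cosines \<open>e\<^sub>k\<close> the Neumann operator \<open>A\<close> is diagonal with eigenvalues
  \<open>a\<^sub>k = (\<pi> k)\<^sup>2\<close>, in the strong sense that \<open>y\<close> lies in its domain and \<open>A y = h\<close> if and only if the
  Fourier coefficients satisfy \<open>h\<^sub>k = a\<^sub>k y\<^sub>k\<close> (\<open>op_A_iff\<close>). The perturbation \<open>B\<close> is bounded, and the
  distance \<open>d\<^sub>k\<close> from \<open>a\<^sub>k\<close> to the other eigenvalues grows so fast that \<open>\<Sum> 1 / d\<^sub>k\<^sup>2\<close> converges.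
  These facts alone imply the Bari property of \<open>H = A + B\<close> (\<open>bari_basis_perturbed\<close>).

  For large \<open>k\<close>, a Lyapunov--Schmidt reduction (\<open>eigenvector_near_basis\<close>) gives an eigenvector
  \<open>f\<^sub>k\<close> of \<open>H\<close> at distance \<open>O(1 / d\<^sub>k)\<close> from \<open>e\<^sub>k\<close>, with an eigenvalue at bounded distance from
  \<open>a\<^sub>k\<close>. The adjoint operator has such an eigenvector \<open>g\<^sub>k\<close> too, and after normalisation the two
  families are biorthogonal. Hence \<open>\<langle>\<cdot>, g\<^sub>k\<rangle> f\<^sub>k\<close> are mutually disjoint projections of rank one
  whose distances \<open>O(1 / d\<^sub>k)\<close> from \<open>\<langle>\<cdot>, e\<^sub>k\<rangle> e\<^sub>k\<close> are square summable.

  The finitely many eigenvalues that this does not reach are collected in one projection. Let \<open>N\<close>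
  be so large that the squared distances of \<open>f\<^sub>k\<close> and \<open>g\<^sub>k\<close> from \<open>e\<^sub>k\<close>, summed over \<open>k \<ge> N\<close>, stay below
  1. The subspace \<open>M\<close> of the vectors annihilated
  by all \<open>g\<^sub>k\<close> with \<open>k \<ge> N\<close> is finite-dimensional, because its elements are determined by their
  first \<open>N\<close> Fourier coefficients (\<open>M_finite_dim\<close>). It is contained in the domain
  (\<open>M_subset_D\<close>) and invariant under \<open>H\<close>, so it is spanned by root vectors by linear algebra
  (\<open>span_roots\<close>). The identity minus the sum of all \<open>\<langle>\<cdot>, g\<^sub>k\<rangle> f\<^sub>k\<close> with \<open>k \<ge> N\<close> is a bounded
  projection onto \<open>M\<close>, which makes the system complete, and disjointness makes it minimal. It is
  compared with the orthogonal projection onto the first \<open>N\<close> cosines.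

  No root vector is lost: \<open>g\<^sub>k\<close> annihilates every root vector whose eigenvalue is not that of
  \<open>f\<^sub>k\<close>, and the eigenvalue of \<open>f\<^sub>k\<close> with \<open>k \<ge> N\<close> is simple, since an eigenvector for it is close to a
  multiple of \<open>e\<^sub>k\<close> and so is not annihilated by \<open>g\<^sub>k\<close> (\<open>eigenvector_detected\<close>). Thus each root
  vector lies in \<open>M\<close> or is a multiple of one \<open>f\<^sub>k\<close>.
\<close>

section \<open>The Hilbert space of square integrable functions\<close>

text \<open>Functions that are not square integrable are sent to 0.\<close>

lift_definition l2_class :: "(real \<Rightarrow> complex) \<Rightarrow> l2" is "\<lambda>f. if sq_int f then f else (\<lambda>_. 0)"
  by (simp add: l2_eq_def sq_int_zero)

lemma l2_cases:
  obtains f where "sq_int f" "x = l2_class f"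
proof -
  have "\<exists>f. sq_int f \<and> x = l2_class f"
  proof transfer
    fix x assume "l2_eq x x"
    then have "sq_int x" by (simp add: l2_eq_def)
    then show "\<exists>f. sq_int f \<and> l2_eq x (if sq_int f then f else (\<lambda>_. 0))"
      by (intro exI[of _ x]) (simp add: l2_eq_def)
  qed
  with that show ?thesis by blast
qed

lemma l2_class_eq_iff:
  assumes "sq_int f" "sq_int g"
  shows "l2_class f = l2_class g \<longleftrightarrow> (AE x in leb01. f x = g x)"
  using assms by transfer (simp add: l2_eq_def)

lemma has_version_l2_class: "sq_int f \<Longrightarrow> has_version (l2_class f) p \<longleftrightarrow> (AE x in leb01. f x = p x)"
  by transfer simp

lemma sq_int_uminus: "sq_int f \<Longrightarrow> sq_int (\<lambda>x. - f x)"
  using sq_int_cmult[of f "-1"] by simp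

lemma sq_int_diff: "sq_int f \<Longrightarrow> sq_int g \<Longrightarrow> sq_int (\<lambda>x. f x - g x)"
  using sq_int_add[OF _ sq_int_uminus, of f g] by simp

lemma l2_class_add: "sq_int f \<Longrightarrow> sq_int g \<Longrightarrow> l2_class f + l2_class g = l2_class (\<lambda>x. f x + g x)"
  by transfer (simp add: l2_eq_def sq_int_add)

lemma l2_class_cscale: "sq_int f \<Longrightarrow> c *\<^sub>C l2_class f = l2_class (\<lambda>x. c * f x)"
  by transfer (simp add: l2_eq_def sq_int_cmult)

lemma l2_class_uminus: "sq_int f \<Longrightarrow> - l2_class f = l2_class (\<lambda>x. - f x)"
  unfolding uminus_l2_def by (simp only: l2_class_cscale, simp)

lemma l2_class_diff: "sq_int f \<Longrightarrow> sq_int g \<Longrightarrow> l2_class f - l2_class g = l2_class (\<lambda>x. f x - g x)"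
  using l2_class_add[OF _ sq_int_uminus, of f g] by (simp add: l2_class_uminus[symmetric])

lemma cinner_l2_class:
  "sq_int f \<Longrightarrow> sq_int g \<Longrightarrow> cinner (l2_class f) (l2_class g) = (LINT x|leb01. f x * cnj (g x))"
  by transfer simp

lemma has_weak_deriv_l2_class:
  "sq_int f \<Longrightarrow> sq_int g \<Longrightarrow> has_weak_deriv (l2_class f) (l2_class g) \<longleftrightarrow>
     (\<forall>\<phi> \<phi>'. test_fun \<phi> \<phi>' \<longrightarrow> (LINT x|leb01. f x * \<phi>' x) = - (LINT x|leb01. g x * \<phi> x))"
  by transfer simp

lemma cinner_commute: "cinner f g = cnj (cinner g f)"
  by transfer (simp add: mult.commute flip: Bochner_Integration.integral_cnj)

lemma cinner_add_left: "cinner (f + g) h = cinner f h + cinner g h"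
  by transfer (simp add: l2_eq_def distrib_right sq_int_mult_integrable)

lemma cinner_cscale_left: "cinner (c *\<^sub>C f) g = c * cinner f g"
  by transfer (simp add: mult.assoc)

lemma cinner_add_right: "cinner h (f + g) = cinner h f + cinner h g"
  by (metis cinner_add_left cinner_commute complex_cnj_add)

lemma cinner_cscale_right: "cinner f (c *\<^sub>C g) = cnj c * cinner f g"
  by (metis cinner_commute cinner_cscale_left complex_cnj_mult)

lemma uminus_cscale: "- x = (-1) *\<^sub>C x"
  by (rule uminus_l2_def)

lemma cinner_minus_left: "cinner (- f) g = - cinner f g"
  unfolding uminus_cscale by (simp only: cinner_cscale_left, simp)

lemma cinner_minus_right: "cinner f (- g) = - cinner f g"
  unfolding uminus_cscale by (simp only: cinner_cscale_right, simp)

lemma cinner_diff_left: "cinner (f - g) h = cinner f h - cinner g h"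
  using cinner_add_left[of f "- g" h] by (simp add: cinner_minus_left)

lemma cinner_diff_right: "cinner h (f - g) = cinner h f - cinner h g"
  using cinner_add_right[of h f "- g"] by (simp add: cinner_minus_right)

lemma cinner_zero_left [simp]: "cinner 0 g = 0"
  using cinner_diff_left[of 0 0 g] by simp

lemma cinner_zero_right [simp]: "cinner g 0 = 0"
  using cinner_diff_right[of g 0 0] by simp

lemma cinner_sum_left: "cinner (sum f A) g = (\<Sum>i\<in>A. cinner (f i) g)"
  by (induction A rule: infinite_finite_induct) (auto simp: cinner_add_left)

lemma cinner_sum_right: "cinner g (sum f A) = (\<Sum>i\<in>A. cinner g (f i))"
  by (induction A rule: infinite_finite_induct) (auto simp: cinner_add_right)

lemmas cinner_simps = cinner_add_left cinner_add_right cinner_cscale_left cinner_cscale_right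
  cinner_diff_left cinner_diff_right cinner_minus_left cinner_minus_right

lemma cinner_self: "cinner x x = of_real ((norm x)\<^sup>2)"
proof -
  have "Im (cinner x x) = 0"
    using arg_cong[OF cinner_commute[of x x], of Im] by simp
  moreover have "Re (cinner x x) = (norm x)\<^sup>2"
    by (simp add: power2_norm_eq_inner inner_l2_def)
  ultimately show ?thesis
    by (simp add: complex_eq_iff)
qed

lemma scaleR_cscale: "r *\<^sub>R (x::l2) = of_real r *\<^sub>C x"
  by (rule scaleR_l2_def)

lemma norm_cscale: "norm (c *\<^sub>C x) = cmod c * norm x"
proof -
  have "cinner (c *\<^sub>C x) (c *\<^sub>C x) = (c * cnj c) * cinner x x"
    by (simp add: cinner_cscale_left cinner_cscale_right)
  then have "complex_of_real ((norm (c *\<^sub>C x))\<^sup>2) = of_real ((cmod c)\<^sup>2 * (norm x)\<^sup>2)"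
    by (simp only: cinner_self complex_norm_square[symmetric] of_real_mult)
  then have "(norm (c *\<^sub>C x))\<^sup>2 = (cmod c * norm x)\<^sup>2"
    unfolding of_real_eq_iff by (simp add: power_mult_distrib)
  then show ?thesis
    by (simp add: power2_eq_iff_nonneg)
qed

text \<open>Rotating \<open>x\<close> by the phase of the inner product reduces this to the real inequality.\<close>

lemma cinner_bound: "cmod (cinner x y) \<le> norm x * norm y"
proof (cases "cinner x y = 0")
  case False
  define c where "c = cnj (sgn (cinner x y))"
  have c: "cmod c = 1"
    using False by (simp add: c_def norm_sgn)
  have "cinner (c *\<^sub>C x) y = of_real (cmod (cinner x y))"
    using complex_norm_square[of "cinner x y"] False
    by (simp add: cinner_cscale_left c_def sgn_div_norm scaleR_conv_of_real field_simps power2_eq_square)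
  then have "cmod (cinner x y) = (c *\<^sub>C x) \<bullet> y"
    by (simp add: inner_l2_def)
  also have "\<dots> \<le> norm (c *\<^sub>C x) * norm y"
    by (rule norm_cauchy_schwarz)
  finally show ?thesis
    using c by (simp add: norm_cscale)
qed simp

lemma norm_l2_class: "sq_int f \<Longrightarrow> (norm (l2_class f))\<^sup>2 = (LINT x|leb01. (cmod (f x))\<^sup>2)"
proof -
  assume f: "sq_int f"
  have "complex_of_real ((norm (l2_class f))\<^sup>2) = (LINT x|leb01. of_real ((cmod (f x))\<^sup>2))"
    unfolding cinner_self[symmetric] cinner_l2_class[OF f f] by (simp only: complex_norm_square)
  then show ?thesis
    by (simp only: integral_complex_of_real of_real_eq_iff)
qed

lemma bounded_linear_cinner_left: "bounded_linear (\<lambda>x. cinner x y)"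
  by (rule bounded_linear_intro[where K = "norm y"])
    (auto simp: cinner_simps scaleR_cscale cinner_bound scaleR_conv_of_real)

lemma bounded_linear_cscale: "bounded_linear (\<lambda>x. c *\<^sub>C x)"
  by (rule bounded_linear_intro[where K = "cmod c"])
    (auto simp: scaleR_cscale norm_cscale cvec.scale_right_distrib mult.commute)

lemma leb01_const [simp]: "integrable leb01 (\<lambda>x. c :: 'a :: {banach, second_countable_topology})"
  by (rule finite_measure.integrable_const) (simp add: finite_measure_lebesgue_on)

lemma sq_int_of_real_cmod:
  assumes "sq_int f" shows "sq_int (\<lambda>x. of_real (cmod (f x)))"
proof -
  have [measurable]: "f \<in> borel_measurable leb01"
    using assms by (simp add: sq_int_def)
  show ?thesis
    using assms unfolding sq_int_def by simp
qed

lemma sq_int_const: "sq_int (\<lambda>x. c)"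
  by (simp add: sq_int_def)

lemma sq_int_integrable:
  assumes "sq_int f" shows "integrable leb01 f"
  using sq_int_mult_integrable[OF assms sq_int_const[of 1]] by simp

text \<open>This is the Cauchy--Schwarz inequality against the constant 1, as the interval has length 1.\<close>

lemma L1_le_norm:
  assumes "sq_int f" shows "(LINT x|leb01. cmod (f x)) \<le> norm (l2_class f)"
proof -
  let ?g = "\<lambda>x. complex_of_real (cmod (f x))"
  have g: "sq_int ?g" by (rule sq_int_of_real_cmod[OF assms])
  have "(norm (l2_class ?g))\<^sup>2 = (norm (l2_class f))\<^sup>2"
    by (simp add: norm_l2_class g assms)
  then have ng: "norm (l2_class ?g) = norm (l2_class f)"
    by (simp add: power2_eq_iff_nonneg)
  have "(norm (l2_class (\<lambda>_. 1)))\<^sup>2 = 1"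
    by (simp add: norm_l2_class sq_int_const measure_restrict_space)
  then have n1: "norm (l2_class (\<lambda>_. 1)) = 1"
    using norm_ge_zero[of "l2_class (\<lambda>_. 1)"] by (auto simp: power2_eq_1_iff)
  have "cinner (l2_class ?g) (l2_class (\<lambda>_. 1)) = of_real (LINT x|leb01. cmod (f x))"
    by (simp add: cinner_l2_class g sq_int_const flip: integral_complex_of_real)
  then have "cmod (of_real (LINT x|leb01. cmod (f x))) \<le> norm (l2_class f)"
    using cinner_bound[of "l2_class ?g" "l2_class (\<lambda>_. 1)"] ng n1 by simp
  then show ?thesis
    by (simp only: norm_of_real)
qed

text \<open>The integral of the sum of the norms is the sum of the integrals, so the sum is finite almost
  everywhere.\<close>

lemma AE_summable_norm:
  fixes f :: "nat \<Rightarrow> 'a \<Rightarrow> 'b :: {banach, second_countable_topology}"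
  assumes int: "\<And>i. integrable M (f i)" and s: "summable (\<lambda>i. LINT x|M. norm (f i x))"
  shows "AE x in M. summable (\<lambda>i. norm (f i x))"
proof -
  have [measurable]: "f i \<in> borel_measurable M" for i
    using int by auto
  have "(\<integral>\<^sup>+ x. (\<Sum>i. ennreal (norm (f i x))) \<partial>M) = (\<Sum>i. \<integral>\<^sup>+ x. ennreal (norm (f i x)) \<partial>M)"
    by (intro nn_integral_suminf) auto
  also have "\<dots> = (\<Sum>i. ennreal (LINT x|M. norm (f i x)))"
    by (intro arg_cong[where f=suminf] ext nn_integral_eq_integral integrable_norm int) auto
  also have "\<dots> < \<infinity>"
    by (simp add: s ennreal_suminf_neq_top less_top[symmetric] integral_nonneg_AE)
  finally have "AE x in M. (\<Sum>i. ennreal (norm (f i x))) \<noteq> \<infinity>"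
    by (intro nn_integral_PInf_AE) auto
  then show ?thesis
    by eventually_elim (auto intro: summable_suminf_not_top)
qed

text \<open>Riesz--Fischer: along a subsequence with geometrically decreasing steps the representatives
  converge almost everywhere, and Fatou's lemma upgrades this to convergence in the norm.\<close>

instance l2 :: banach
proof
  fix X :: "nat \<Rightarrow> l2" assume X: "Cauchy X"
  have "\<exists>N. \<forall>m\<ge>N. \<forall>n\<ge>N. norm (X m - X n) < (1/2)^k" for k
    using X unfolding Cauchy_iff by (meson zero_less_divide_1_iff zero_less_numeral zero_less_power)
  then obtain N where N: "\<And>k m n. m \<ge> N k \<Longrightarrow> n \<ge> N k \<Longrightarrow> norm (X m - X n) < (1/2)^k"
    by metis
  define r where "r k = Max (N ` {..k})" for k
  have rN: "N k \<le> r k" for k by (simp add: r_def)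
  have rm: "r k \<le> r l" if "k \<le> l" for k l
    unfolding r_def using that by (intro Max_mono) auto
  have "\<forall>k. \<exists>f. sq_int f \<and> X (r k) = l2_class f"
    by (metis l2_cases)
  then obtain F where F: "\<And>k. sq_int (F k)" "\<And>k. X (r k) = l2_class (F k)"
    by metis
  have [measurable]: "F k \<in> borel_measurable leb01" for k
    using F by (simp add: sq_int_def)
  define D where "D k x = F (Suc k) x - F k x" for k x
  have D: "sq_int (D k)" for k
    unfolding D_def[abs_def] by (intro sq_int_diff F)
  have Dn: "norm (l2_class (D k)) \<le> (1/2)^k" for k
  proof -
    have "l2_class (D k) = X (r (Suc k)) - X (r k)"
      unfolding D_def[abs_def] by (simp add: F l2_class_diff)
    then show ?thesis
      using N[of k "r (Suc k)" "r k"] rN[of k] rm[of k "Suc k"] by (simp add: less_imp_le)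
  qed
  have "summable (\<lambda>k. LINT x|leb01. cmod (D k x))"
  proof (rule summable_comparison_test'[where N = 0])
    show "summable (\<lambda>k. (1/2::real)^k)" by (simp add: summable_geometric)
    show "norm (LINT x|leb01. cmod (D k x)) \<le> (1/2)^k" for k
      using order_trans[OF L1_le_norm[OF D] Dn] by (simp add: integral_nonneg_AE)
  qed
  then have "AE x in leb01. summable (\<lambda>k. norm (D k x))"
    by (intro AE_summable_norm sq_int_integrable D)
  then have lim: "AE x in leb01. convergent (\<lambda>k. F k x)"
  proof eventually_elim
    case (elim x)
    then have "summable (\<lambda>k. D k x)"
      by (rule summable_norm_cancel)
    then have "convergent (\<lambda>n. \<Sum>k<n. D k x)"
      by (simp add: summable_iff_convergent)
    moreover have "(\<Sum>k<n. D k x) = F n x - F 0 x" for n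
      unfolding D_def by (rule sum_lessThan_telescope)
    ultimately show ?case
      using convergent_diff_const_right_iff[of "\<lambda>n. F n x" "F 0 x"] by simp
  qed
  define L where "L x = lim (\<lambda>k. F k x)" for x
  have limL: "AE x in leb01. (\<lambda>k. F k x) \<longlonglongrightarrow> L x"
    using lim by eventually_elim (simp add: L_def convergent_LIMSEQ_iff)
  have [measurable]: "L \<in> borel_measurable leb01"
    unfolding L_def[abs_def] by measurable
  have fatou: "(\<integral>\<^sup>+ x. ennreal ((cmod (L x - F k x))\<^sup>2) \<partial>leb01) \<le> ennreal (((1/2)^k)\<^sup>2)" for k
  proof -
    have "(\<integral>\<^sup>+ x. ennreal ((cmod (L x - F k x))\<^sup>2) \<partial>leb01)
        = (\<integral>\<^sup>+ x. liminf (\<lambda>n. ennreal ((cmod (F n x - F k x))\<^sup>2)) \<partial>leb01)"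
    proof (rule nn_integral_cong_AE)
      show "AE x in leb01. ennreal ((cmod (L x - F k x))\<^sup>2)
          = liminf (\<lambda>n. ennreal ((cmod (F n x - F k x))\<^sup>2))"
        using limL
      proof eventually_elim
        case (elim x)
        have "(\<lambda>n. ennreal ((cmod (F n x - F k x))\<^sup>2)) \<longlonglongrightarrow> ennreal ((cmod (L x - F k x))\<^sup>2)"
          by (intro tendsto_ennrealI tendsto_intros elim)
        then show ?case
          by (intro lim_imp_Liminf[symmetric]) auto
      qed
    qed
    also have "\<dots> \<le> liminf (\<lambda>n. \<integral>\<^sup>+ x. ennreal ((cmod (F n x - F k x))\<^sup>2) \<partial>leb01)"
      by (intro nn_integral_liminf) measurable
    also have "\<dots> \<le> ennreal (((1/2)^k)\<^sup>2)"
    proof (rule order_trans[OF Liminf_le_Limsup Limsup_bounded])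
      show "\<forall>\<^sub>F n in sequentially. (\<integral>\<^sup>+ x. ennreal ((cmod (F n x - F k x))\<^sup>2) \<partial>leb01) \<le> ennreal (((1/2)^k)\<^sup>2)"
      proof (rule eventually_sequentiallyI[of k])
        fix n assume "k \<le> n"
        have d: "sq_int (\<lambda>x. F n x - F k x)" by (intro sq_int_diff F)
        have "(\<integral>\<^sup>+ x. ennreal ((cmod (F n x - F k x))\<^sup>2) \<partial>leb01) = ennreal ((norm (l2_class (\<lambda>x. F n x - F k x)))\<^sup>2)"
          unfolding norm_l2_class[OF d] using d by (intro nn_integral_eq_integral) (auto simp: sq_int_def)
        also have "norm (l2_class (\<lambda>x. F n x - F k x)) \<le> (1/2)^k"
          using N[of k "r n" "r k"] rN[of k] rm[OF \<open>k \<le> n\<close>] l2_class_diff[OF F(1) F(1), of n k]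
          by (simp add: less_imp_le F(2))
        then have "ennreal ((norm (l2_class (\<lambda>x. F n x - F k x)))\<^sup>2) \<le> ennreal (((1/2)^k)\<^sup>2)"
          by (intro ennreal_leI power_mono) auto
        finally show "(\<integral>\<^sup>+ x. ennreal ((cmod (F n x - F k x))\<^sup>2) \<partial>leb01) \<le> ennreal (((1/2)^k)\<^sup>2)" .
      qed
    qed auto
    finally show ?thesis .
  qed
  have LF: "sq_int (\<lambda>x. L x - F k x)" for k
    unfolding sq_int_def
  proof
    show "integrable leb01 (\<lambda>x. (cmod (L x - F k x))\<^sup>2)"
      by (rule integrableI_nonneg) (auto intro: le_less_trans[OF fatou])
  qed measurable
  have LFn: "norm (l2_class (\<lambda>x. L x - F k x)) \<le> (1/2)^k" for k
  proof -
    have "ennreal ((norm (l2_class (\<lambda>x. L x - F k x)))\<^sup>2) \<le> ennreal (((1/2)^k)\<^sup>2)"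
      unfolding norm_l2_class[OF LF]
      using fatou[of k] LF[of k] by (subst nn_integral_eq_integral[symmetric]) (auto simp: sq_int_def)
    then show ?thesis
      by (subst (asm) ennreal_le_iff) (auto simp: power2_le_iff_abs_le)
  qed
  have sL: "sq_int L"
    using sq_int_add[OF LF[of 0] F(1)[of 0]] by simp
  have "X \<longlonglongrightarrow> l2_class L"
  proof (rule metric_LIMSEQ_I)
    fix e :: real assume e: "0 < e"
    then obtain k0 where k0: "(1/2)^k0 < e/2"
      using real_arch_pow_inv[of "e/2" "1/2"] by auto
    have "dist (X n) (l2_class L) < e" if n: "n \<ge> r k0" for n
    proof -
      have "dist (X n) (l2_class L) \<le> norm (X n - X (r k0)) + norm (l2_class (\<lambda>x. L x - F k0 x))"
        using dist_triangle[of "X n" "l2_class L" "X (r k0)"]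
        by (simp add: F l2_class_diff[symmetric] sL dist_norm norm_minus_commute)
      then show ?thesis
        using LFn[of k0] N[of k0 n "r k0"] n rN[of k0] k0 by auto
    qed
    then show "\<exists>n0. \<forall>n\<ge>n0. dist (X n) (l2_class L) < e" by blast
  qed
  then show "convergent X" by (auto simp: convergent_def)
qed

section \<open>Orthonormal bases\<close>

lemma bounded_linear_sums_cinner:
  "f sums s \<Longrightarrow> (\<lambda>k. cinner (f k) y) sums cinner s y"
  by (rule bounded_linear.sums[OF bounded_linear_cinner_left])

locale orthonormal_basis =
  fixes e :: "nat \<Rightarrow> l2"
  assumes orthonormal: "cinner (e j) (e k) = (if j = k then 1 else 0)"
    and complete: "(\<And>k. cinner x (e k) = 0) \<Longrightarrow> x = 0"
begin

lemma norm_e [simp]: "norm (e k) = 1"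
proof -
  have "complex_of_real ((norm (e k))\<^sup>2) = of_real 1"
    unfolding cinner_self[symmetric] by (simp add: orthonormal)
  then show ?thesis
    unfolding of_real_eq_iff by (simp add: power2_eq_1_iff) (use norm_ge_zero[of "e k"] in linarith)
qed

text \<open>Operators that are given by their action on coefficients are compared by this rule.\<close>

lemma eq_by_coeffs: "(\<And>k. cinner x (e k) = cinner y (e k)) \<Longrightarrow> x = y"
  using complete[of "x - y"] by (simp add: cinner_diff_left)

lemma cinner_finite_sum:
  assumes "finite F"
  shows "cinner (\<Sum>k\<in>F. c k *\<^sub>C e k) (e j) = (if j \<in> F then c j else 0)"
  using assms
  by (simp add: cinner_sum_left cinner_cscale_left orthonormal if_distrib[of "\<lambda>t. _ * t"] cong: if_cong)

lemma norm_finite_sum: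
  assumes "finite F"
  shows "(norm (\<Sum>k\<in>F. c k *\<^sub>C e k))\<^sup>2 = (\<Sum>k\<in>F. (cmod (c k))\<^sup>2)"
proof -
  have "complex_of_real ((norm (\<Sum>k\<in>F. c k *\<^sub>C e k))\<^sup>2)
      = (\<Sum>j\<in>F. cnj (c j) * cinner (\<Sum>k\<in>F. c k *\<^sub>C e k) (e j))"
    unfolding cinner_self[symmetric]
    by (subst cinner_sum_right) (simp add: cinner_cscale_right)
  also have "\<dots> = (\<Sum>j\<in>F. of_real ((cmod (c j))\<^sup>2))"
    by (intro sum.cong refl) (simp add: cinner_finite_sum[OF assms] complex_norm_square del: of_real_power)
  finally show ?thesis
    unfolding of_real_sum[symmetric] of_real_eq_iff .
qed

text \<open>By Pythagoras, \<open>x\<close> minus its partial expansion is orthogonal to the latter.\<close>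

lemma bessel_finite:
  assumes "finite F" shows "(\<Sum>k\<in>F. (cmod (cinner x (e k)))\<^sup>2) \<le> (norm x)\<^sup>2"
proof -
  define s where "s = (\<Sum>k\<in>F. cinner x (e k) *\<^sub>C e k)"
  have "cinner (x - s) s = 0"
    unfolding s_def by (subst cinner_sum_right)
      (simp add: cinner_cscale_right cinner_diff_left cinner_finite_sum[OF assms])
  then have "(x - s) \<bullet> s = 0"
    by (simp add: inner_l2_def)
  then have "(norm x)\<^sup>2 = (norm (x - s))\<^sup>2 + (norm s)\<^sup>2"
    using norm_add_Pythagorean[of "x - s" s] by (simp add: orthogonal_def)
  then have "(norm s)\<^sup>2 \<le> (norm x)\<^sup>2" by simp
  then show ?thesis
    unfolding s_def norm_finite_sum[OF assms] .
qed

lemma summable_coeffs: "summable (\<lambda>k. (cmod (cinner x (e k)))\<^sup>2)"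
  by (rule summableI_nonneg_bounded[where x = "(norm x)\<^sup>2"]) (auto intro: bessel_finite)

text \<open>Pythagoras turns the Cauchy criterion for the squares into that for the vectors.\<close>

lemma summable_basis:
  assumes "summable (\<lambda>k. (cmod (c k))\<^sup>2)" shows "summable (\<lambda>k. c k *\<^sub>C e k)"
  unfolding summable_Cauchy
proof (intro allI impI)
  fix r :: real assume "r > 0"
  then obtain N where N: "\<And>m n. m \<ge> N \<Longrightarrow> norm (\<Sum>k\<in>{m..<n}. (cmod (c k))\<^sup>2) < r\<^sup>2"
    using assms unfolding summable_Cauchy by (meson zero_less_power)
  have "norm (\<Sum>k\<in>{m..<n}. c k *\<^sub>C e k) < r" if "m \<ge> N" for m n
  proof -
    have "(norm (\<Sum>k\<in>{m..<n}. c k *\<^sub>C e k))\<^sup>2 < r\<^sup>2"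
      using N[OF that, of n] by (simp add: norm_finite_sum)
    then show ?thesis
      using \<open>r > 0\<close> by (meson less_imp_le power2_less_imp_less)
  qed
  then show "\<exists>N. \<forall>m\<ge>N. \<forall>n. norm (\<Sum>k\<in>{m..<n}. c k *\<^sub>C e k) < r" by blast
qed

lemma cinner_suminf_basis:
  assumes "summable (\<lambda>k. (cmod (c k))\<^sup>2)" shows "cinner (\<Sum>k. c k *\<^sub>C e k) (e j) = c j"
proof -
  have "(\<lambda>k. cinner (c k *\<^sub>C e k) (e j)) sums cinner (\<Sum>k. c k *\<^sub>C e k) (e j)"
    by (intro bounded_linear_sums_cinner summable_sums summable_basis assms)
  moreover have "(\<lambda>k. cinner (c k *\<^sub>C e k) (e j)) sums c j"
    using sums_single[of j c] by (simp add: cinner_cscale_left orthonormal if_distrib[of "\<lambda>t. _ * t"] cong: if_cong)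
  ultimately show ?thesis by (rule sums_unique2)
qed

lemma expansion: "(\<lambda>k. cinner x (e k) *\<^sub>C e k) sums x"
proof -
  have "(\<Sum>k. cinner x (e k) *\<^sub>C e k) = x"
    by (rule eq_by_coeffs) (simp add: cinner_suminf_basis summable_coeffs)
  then show ?thesis
    using summable_sums[OF summable_basis[OF summable_coeffs]] by metis
qed

lemma parseval: "(\<lambda>k. (cmod (cinner x (e k)))\<^sup>2) sums (norm x)\<^sup>2"
proof -
  have "(\<lambda>k. cinner (cinner x (e k) *\<^sub>C e k) x) sums cinner x x"
    by (intro bounded_linear_sums_cinner expansion)
  moreover have "cinner (cinner x (e k) *\<^sub>C e k) x = of_real ((cmod (cinner x (e k)))\<^sup>2)" for k
    by (subst complex_norm_square) (metis cinner_commute cinner_cscale_left)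
  ultimately show ?thesis
    by (simp add: cinner_self sums_of_real_iff del: of_real_power)
qed

lemma parseval_suminf: "(norm x)\<^sup>2 = (\<Sum>k. (cmod (cinner x (e k)))\<^sup>2)"
  by (rule sums_unique[OF parseval])

text \<open>Parseval's identity for both vectors.\<close>

lemma norm_le_by_coeffs:
  assumes "\<And>k. cmod (cinner y (e k)) \<le> c * cmod (cinner x (e k))" "0 \<le> c"
  shows "norm y \<le> c * norm x"
proof -
  have "(norm y)\<^sup>2 \<le> (c * norm x)\<^sup>2"
  proof (rule sums_le)
    show "(\<lambda>k. (cmod (cinner y (e k)))\<^sup>2) sums (norm y)\<^sup>2" by (rule parseval)
    show "(\<lambda>k. c\<^sup>2 * (cmod (cinner x (e k)))\<^sup>2) sums (c * norm x)\<^sup>2"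
      unfolding power_mult_distrib by (intro sums_mult parseval)
    show "(cmod (cinner y (e k)))\<^sup>2 \<le> c\<^sup>2 * (cmod (cinner x (e k)))\<^sup>2" for k
      using power_mono[OF assms(1)[of k], of 2] by (simp add: power_mult_distrib)
  qed
  then show ?thesis
    using assms(2) by (meson mult_nonneg_nonneg norm_ge_zero power2_le_imp_le)
qed

text \<open>The operator that is diagonal in the basis, for a bounded sequence \<open>m\<close>; the inverses of
  \<open>A - z\<close> used below have this form.\<close>

definition multiplier :: "(nat \<Rightarrow> complex) \<Rightarrow> l2 \<Rightarrow> l2" where
  "multiplier m x = (\<Sum>k. (m k * cinner x (e k)) *\<^sub>C e k)"

lemma cinner_multiplier:
  assumes "\<And>k. cmod (m k) \<le> c"
  shows "cinner (multiplier m x) (e k) = m k * cinner x (e k)"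
  unfolding multiplier_def
proof (rule cinner_suminf_basis)
  show "summable (\<lambda>k. (cmod (m k * cinner x (e k)))\<^sup>2)"
  proof (rule summable_comparison_test'[where N = 0])
    show "summable (\<lambda>k. c\<^sup>2 * (cmod (cinner x (e k)))\<^sup>2)"
      by (intro summable_mult summable_coeffs)
    show "norm ((cmod (m k * cinner x (e k)))\<^sup>2) \<le> c\<^sup>2 * (cmod (cinner x (e k)))\<^sup>2" for k
      using power_mono[OF assms[of k] norm_ge_zero, of 2]
      by (simp add: norm_mult power_mult_distrib mult_right_mono)
  qed
qed

lemma norm_multiplier:
  assumes "\<And>k. cmod (m k) \<le> c"
  shows "norm (multiplier m x) \<le> c * norm x"
proof (rule norm_le_by_coeffs)
  show "0 \<le> c" using assms[of 0] norm_ge_zero[of "m 0"] by linarith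
  show "cmod (cinner (multiplier m x) (e k)) \<le> c * cmod (cinner x (e k))" for k
    by (simp add: cinner_multiplier[OF assms] norm_mult assms mult_right_mono)
qed

end

section \<open>The cosine system\<close>

lemma leb01_integrable_subset:
  fixes f :: "real \<Rightarrow> 'a :: euclidean_space"
  assumes "integrable (lebesgue_on {0..1}) f" shows "integrable leb01 f"
proof -
  have "set_integrable lebesgue {0..1} f"
    using assms by (simp add: set_integrable_def integrable_restrict_space)
  then have "set_integrable lebesgue {0<..<1} f"
    by (rule set_integrable_subset) auto
  then show ?thesis
    by (simp add: set_integrable_def integrable_restrict_space)
qed

lemma continuous_integrable01:
  fixes f :: "real \<Rightarrow> 'a :: euclidean_space"
  assumes "continuous_on {0..1} f" shows "integrable leb01 f"
  by (rule leb01_integrable_subset[OF continuous_imp_integrable_real[OF assms]])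

lemma continuous_measurable01:
  fixes f :: "real \<Rightarrow> 'a :: euclidean_space"
  assumes "continuous_on {0..1} f" shows "f \<in> borel_measurable leb01"
  using continuous_integrable01[OF assms] by auto

lemma sq_int_continuous:
  assumes "continuous_on {0..1} f" shows "sq_int f"
  unfolding sq_int_def
  by (auto intro!: continuous_measurable01 continuous_integrable01 continuous_intros assms)

lemma FTC01:
  fixes F :: "real \<Rightarrow> 'a :: euclidean_space"
  assumes "\<And>x. 0 \<le> x \<Longrightarrow> x \<le> 1 \<Longrightarrow> (F has_vector_derivative f x) (at x)"
    and "continuous_on {0..1} f"
  shows "(LINT x|leb01. f x) = F 1 - F 0"
proof -
  have "(LINT x|leb01. f x) = integral {0<..<1} f"
    by (rule lebesgue_integral_eq_integral[OF continuous_integrable01[OF assms(2)]]) auto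
  also have "\<dots> = integral {0..1} f"
    using integral_open_interval[of 0 1 f] by simp
  also have "\<dots> = F 1 - F 0"
    by (intro integral_unique fundamental_theorem_of_calculus)
      (auto intro: has_vector_derivative_at_within assms)
  finally show ?thesis .
qed

text \<open>The factor makes the functions orthonormal, see \<open>cosf_normalised\<close>.\<close>

definition cosf :: "nat \<Rightarrow> real \<Rightarrow> real" where
  "cosf k x = (if k = 0 then 1 else sqrt 2) * cos (pi * k * x)"

definition cosf' :: "nat \<Rightarrow> real \<Rightarrow> real" where
  "cosf' k x = - (if k = 0 then 1 else sqrt 2) * (pi * k) * sin (pi * k * x)"

text \<open>The eigenvalue of the negative second derivative at \<open>cosf k\<close>.\<close>

definition eigval :: "nat \<Rightarrow> real" where
  "eigval k = (pi * k)\<^sup>2"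

lemma cosf_deriv: "(cosf k has_real_derivative cosf' k x) (at x)"
  unfolding cosf_def[abs_def] cosf'_def
  by (rule derivative_eq_intros refl | simp)+

lemma cosf'_deriv: "(cosf' k has_real_derivative - eigval k * cosf k x) (at x)"
  unfolding cosf_def cosf'_def[abs_def] eigval_def
  by (rule derivative_eq_intros refl | simp add: power2_eq_square)+

lemma cosf_vderiv:
  "((\<lambda>x. complex_of_real (cosf k x)) has_vector_derivative complex_of_real (cosf' k x)) (at x)"
  using cosf_deriv has_vector_derivative_of_real by blast

lemma cosf'_vderiv:
  "((\<lambda>x. complex_of_real (cosf' k x)) has_vector_derivative complex_of_real (- eigval k * cosf k x)) (at x)"
  using cosf'_deriv has_vector_derivative_of_real by blast

lemma continuous_cosf [continuous_intros]: "continuous_on S (cosf k)"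
  unfolding cosf_def[abs_def] by (intro continuous_intros)

lemma continuous_cosf' [continuous_intros]: "continuous_on S (cosf' k)"
  unfolding cosf'_def[abs_def] by (intro continuous_intros)

lemma cosf'_ends [simp]: "cosf' k 0 = 0" "cosf' k 1 = 0"
  by (simp_all add: cosf'_def mult.commute)

lemma cosf'_bound: "\<bar>cosf' k x\<bar> \<le> 2 * (pi * k)"
proof -
  have "\<bar>cosf' k x\<bar> \<le> ((if k = 0 then 1 else sqrt 2) * (pi * k)) * 1"
    unfolding cosf'_def abs_mult by (intro mult_mono) auto
  also have "\<dots> \<le> 2 * (pi * k)"
    by (simp add: real_le_lsqrt mult_right_mono)
  finally show ?thesis .
qed

definition cos_vec :: "nat \<Rightarrow> l2" where
  "cos_vec k = l2_class (\<lambda>x. complex_of_real (cosf k x))"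

lemma sq_int_cosf [simp]: "sq_int (\<lambda>x. complex_of_real (cosf k x))"
  by (intro sq_int_continuous continuous_intros)

lemma cinner_l2_class_cos_vec:
  "sq_int f \<Longrightarrow> cinner (l2_class f) (cos_vec k) = (LINT x|leb01. f x * cosf k x)"
  by (simp add: cos_vec_def cinner_l2_class)

text \<open>The Wronskian of two of these functions vanishes at both ends, and its derivative is their
  product times the difference of the eigenvalues.\<close>

lemma cosf_orthogonal:
  assumes "j \<noteq> k" shows "(LINT x|leb01. cosf j x * cosf k x) = 0"
proof -
  have "(LINT x|leb01. (eigval j - eigval k) * (cosf j x * cosf k x))
      = (cosf j 1 * cosf' k 1 - cosf' j 1 * cosf k 1) - (cosf j 0 * cosf' k 0 - cosf' j 0 * cosf k 0)"
  proof (rule FTC01)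
    fix x :: real
    have "((\<lambda>x. cosf j x * cosf' k x - cosf' j x * cosf k x) has_real_derivative
        (eigval j - eigval k) * (cosf j x * cosf k x)) (at x)"
      by (rule derivative_eq_intros cosf_deriv cosf'_deriv refl | simp add: algebra_simps)+
    then show "((\<lambda>x. cosf j x * cosf' k x - cosf' j x * cosf k x) has_vector_derivative
        (eigval j - eigval k) * (cosf j x * cosf k x)) (at x)"
      by (simp add: has_real_derivative_iff_has_vector_derivative)
  qed (intro continuous_intros)
  moreover have "eigval j \<noteq> eigval k"
    using assms by (simp add: eigval_def)
  ultimately show ?thesis by simp
qed

lemma cosf_normalised: "(LINT x|leb01. cosf k x * cosf k x) = 1"
proof (cases "k = 0")
  case True
  then show ?thesis by (simp add: cosf_def measure_restrict_space)
next
  case False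
  have "(LINT x|leb01. cosf k x * cosf k x)
      = (1 + sin (2 * pi * k * 1) / (2 * pi * k)) - (0 + sin (2 * pi * k * 0) / (2 * pi * k))"
  proof (rule FTC01)
    fix x :: real
    have "cosf k x * cosf k x = (sqrt 2 * sqrt 2) * (cos (pi * k * x))\<^sup>2"
      using False by (simp add: cosf_def power2_eq_square del: real_sqrt_mult_self)
    also have "\<dots> = 1 + cos (2 * (pi * k * x))"
      using cos_double_cos[of "pi * k * x"] by simp
    finally have "((\<lambda>x. x + sin (2 * pi * k * x) / (2 * pi * k)) has_real_derivative cosf k x * cosf k x) (at x)"
      using False by (auto intro!: derivative_eq_intros simp: mult_ac)
    then show "((\<lambda>x. x + sin (2 * pi * k * x) / (2 * pi * k)) has_vector_derivative cosf k x * cosf k x) (at x)"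
      by (simp add: has_real_derivative_iff_has_vector_derivative)
  qed (intro continuous_intros)
  also have "sin (2 * pi * k * 1) = 0"
    using sin_npi2[of "2 * k"] by (simp add: mult_ac)
  finally show ?thesis by simp
qed

lemma cos_vec_orthonormal: "cinner (cos_vec j) (cos_vec k) = (if j = k then 1 else 0)"
proof -
  have "cinner (cos_vec j) (cos_vec k) = of_real (LINT x|leb01. cosf j x * cosf k x)"
    unfolding cos_vec_def by (simp add: cinner_l2_class flip: integral_complex_of_real)
  then show ?thesis by (simp add: cosf_orthogonal cosf_normalised)
qed

text \<open>Bounded continuous functions converge almost everywhere to the bounded function
  \<open>cnj g / (1 + |g|)\<close>, so by dominated convergence the integral of \<open>|g|\<^sup>2 / (1 + |g|)\<close> vanishes.\<close>

lemma annihilates_continuous_imp_zero: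
  fixes g :: "real \<Rightarrow> complex"
  assumes g: "integrable leb01 g"
    and ann: "\<And>h. continuous_on UNIV h \<Longrightarrow> (LINT x|leb01. g x * h x) = 0"
  shows "AE x in leb01. g x = 0"
proof -
  have [measurable]: "g \<in> borel_measurable leb01"
    using g by auto
  define f where "f x = cnj (g x) / (1 + of_real (cmod (g x)))" for x
  have "(\<lambda>x. cnj (g x)) \<in> borel_measurable leb01"
    by (rule borel_measurable_continuous_on[where f = cnj]) (simp_all add: continuous_on_cnj)
  then have "f \<in> borel_measurable leb01"
    unfolding f_def[abs_def] by measurable
  then have "f measurable_on {0<..<1}"
    by (subst measurable_on_iff_borel_measurable) auto
  then obtain N h where N: "negligible N" and h: "\<And>n. continuous_on UNIV (h n)"
    and lim: "\<And>x. x \<notin> N \<Longrightarrow> (\<lambda>n. h n x) \<longlonglongrightarrow> (if x \<in> {0<..<1} then f x else 0)"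
    unfolding measurable_on_def by blast
  have fb: "cmod (f x) \<le> 1" for x
  proof -
    have "cmod (1 + complex_of_real (cmod (g x))) = 1 + cmod (g x)"
      by (metis abs_of_nonneg add_nonneg_nonneg norm_ge_zero norm_of_real of_real_1 of_real_add zero_le_one)
    moreover have "0 < 1 + cmod (g x)" by (simp add: add_pos_nonneg)
    ultimately show ?thesis by (simp add: f_def norm_divide divide_le_eq)
  qed
  \<comment> \<open>Dividing by \<open>max 1 |h|\<close> makes the approximants bounded without changing the limit.\<close>
  define b where "b n x = h n x / of_real (max 1 (cmod (h n x)))" for n x
  have bb: "cmod (b n x) \<le> 1" for n x
    by (simp add: b_def norm_divide divide_le_eq)
  have bc: "continuous_on UNIV (b n)" for n
    unfolding b_def[abs_def] by (intro continuous_intros h) auto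
  have lim': "(\<lambda>n. b n x) \<longlonglongrightarrow> f x" if "x \<notin> N" "x \<in> {0<..<1}" for x
  proof -
    have "(\<lambda>n. b n x) \<longlonglongrightarrow> f x / of_real (max 1 (cmod (f x)))"
      unfolding b_def using lim[OF that(1)] that(2) by (intro tendsto_intros) auto
    moreover have "max 1 (cmod (f x)) = 1"
      using fb[of x] by simp
    ultimately show ?thesis by (simp only: of_real_1 div_by_1)
  qed
  have NAE: "AE x in leb01. x \<notin> N"
    using N by (subst AE_restrict_space_iff) (auto simp: negligible_iff_null_sets intro: AE_mp[OF AE_not_in])
  have "(\<lambda>n. LINT x|leb01. g x * b n x) \<longlonglongrightarrow> (LINT x|leb01. g x * f x)"
  proof (rule integral_dominated_convergence[where w = "\<lambda>x. cmod (g x)"])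
    show "(\<lambda>x. g x * f x) \<in> borel_measurable leb01"
      using \<open>f \<in> borel_measurable leb01\<close> by measurable
    have "b n \<in> borel_measurable leb01" for n
      by (rule continuous_measurable01[OF continuous_on_subset[OF bc]]) simp
    then show "(\<lambda>x. g x * b n x) \<in> borel_measurable leb01" for n
      by measurable
    show "integrable leb01 (\<lambda>x. cmod (g x))" using g by simp
    show "AE x in leb01. (\<lambda>n. g x * b n x) \<longlonglongrightarrow> g x * f x"
      using NAE AE_space by eventually_elim (intro tendsto_intros lim', auto)
    show "AE x in leb01. norm (g x * b n x) \<le> cmod (g x)" for n
      using bb by (auto simp: norm_mult mult_left_le)
  qed
  then have "(LINT x|leb01. g x * f x) = 0"
    by (simp add: ann[OF bc] LIMSEQ_const_iff)
  moreover have gf: "g x * f x = of_real ((cmod (g x))\<^sup>2 / (1 + cmod (g x)))" for x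
    by (simp add: f_def complex_norm_square del: of_real_power)
  ultimately have z: "(LINT x|leb01. (cmod (g x))\<^sup>2 / (1 + cmod (g x))) = 0"
    by (simp only: integral_complex_of_real of_real_eq_0_iff)
  have "integrable leb01 (\<lambda>x. (cmod (g x))\<^sup>2 / (1 + cmod (g x)))"
  proof (rule Bochner_Integration.integrable_bound)
    show "integrable leb01 (\<lambda>x. cmod (g x))" using g by simp
    show "(\<lambda>x. (cmod (g x))\<^sup>2 / (1 + cmod (g x))) \<in> borel_measurable leb01" by measurable
    have "(cmod (g x))\<^sup>2 / (1 + cmod (g x)) \<le> cmod (g x)" for x
    proof -
      have "0 < 1 + cmod (g x)" by (simp add: add_pos_nonneg)
      then show ?thesis by (simp add: divide_le_eq power2_eq_square algebra_simps)
    qed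
    then show "AE x in leb01. norm ((cmod (g x))\<^sup>2 / (1 + cmod (g x))) \<le> norm (cmod (g x))"
      by simp
  qed
  then have "AE x in leb01. (cmod (g x))\<^sup>2 / (1 + cmod (g x)) = 0"
    using z by (subst (asm) integral_nonneg_eq_0_iff_AE) auto
  then show ?thesis
  proof eventually_elim
    case (elim x)
    have "0 < 1 + cmod (g x)" by (simp add: add_pos_nonneg)
    then show ?case using elim by simp
  qed
qed

text \<open>Polynomials in \<open>cos (\<pi> x)\<close> are finite cosine sums, and they are uniformly dense in the continuous
  functions because \<open>cos (\<pi> x)\<close> maps the unit interval homeomorphically onto \<open>[-1, 1]\<close>.\<close>

lemma cosine_complete:
  fixes g :: "real \<Rightarrow> complex"
  assumes g: "integrable leb01 g"
    and orth: "\<And>k. (LINT x|leb01. g x * of_real (cos (pi * real k * x))) = 0"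
  shows "AE x in leb01. g x = 0"
proof -
  have [measurable]: "g \<in> borel_measurable leb01"
    using g by auto
  have int: "integrable leb01 (\<lambda>x. g x * of_real (h x))" if hc: "continuous_on {0..1} h" for h :: "real \<Rightarrow> real"
  proof -
    obtain C where C: "\<And>x. x \<in> {0..1} \<Longrightarrow> norm (h x) \<le> C"
      using compact_imp_bounded[OF compact_continuous_image[OF hc compact_Icc]]
      unfolding bounded_iff by (metis imageI)
    have [measurable]: "h \<in> borel_measurable leb01"
      by (rule continuous_measurable01[OF hc])
    show ?thesis
    proof (rule Bochner_Integration.integrable_bound)
      show "integrable leb01 (\<lambda>x. C * cmod (g x))" using g by simp
      show "AE x in leb01. norm (g x * of_real (h x)) \<le> norm (C * cmod (g x))"
        using AE_space
      proof eventually_elim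
        case (elim x)
        then have "\<bar>h x\<bar> \<le> C" using C[of x] by auto
        then show ?case by (simp add: norm_mult abs_mult mult.commute mult_mono)
      qed
    qed measurable
  qed
  \<comment> \<open>The product formula for cosines trades one power for a shift of the frequency.\<close>
  have pw: "(LINT x|leb01. g x * of_real (cos (pi * x) ^ n * cos (pi * real k * x))) = 0" for n k
  proof (induction n arbitrary: k)
    case 0
    then show ?case using orth by simp
  next
    case (Suc n)
    have c: "cos (pi * x) * cos (pi * real k * x)
        = (cos (pi * real (k + 1) * x) + cos (pi * real (if k = 0 then 1 else k - 1) * x)) / 2" for x
    proof (cases k)
      case (Suc j)
      then show ?thesis
        using cos_times_cos[of "pi * real k * x" "pi * x"] by (simp add: algebra_simps)
    qed simp
    have "(LINT x|leb01. g x * of_real (cos (pi * x) ^ Suc n * cos (pi * real k * x)))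
       = (LINT x|leb01. (g x * of_real (cos (pi * x) ^ n * cos (pi * real (k + 1) * x))
          + g x * of_real (cos (pi * x) ^ n * cos (pi * real (if k = 0 then 1 else k - 1) * x))) / 2)"
    proof (rule Bochner_Integration.integral_cong)
      fix x
      have eq: "cos (pi * x) ^ Suc n * cos (pi * real k * x)
        = (cos (pi * x) ^ n * cos (pi * real (k + 1) * x)
          + cos (pi * x) ^ n * cos (pi * real (if k = 0 then 1 else k - 1) * x)) / 2"
        using c[of x] by (simp only: power_Suc2 mult.assoc distrib_left times_divide_eq_right)
      show "g x * of_real (cos (pi * x) ^ Suc n * cos (pi * real k * x))
        = (g x * of_real (cos (pi * x) ^ n * cos (pi * real (k + 1) * x))
          + g x * of_real (cos (pi * x) ^ n * cos (pi * real (if k = 0 then 1 else k - 1) * x))) / 2"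
        unfolding eq
        by (simp only: of_real_divide of_real_add of_real_numeral distrib_left times_divide_eq_right)
    qed simp
    also have "\<dots> = 0"
    proof -
      have i: "integrable leb01 (\<lambda>x. g x * of_real (cos (pi * x) ^ n * cos (pi * real m * x)))" for m
        by (intro int continuous_intros)
      show ?thesis
        unfolding integral_divide_zero Bochner_Integration.integral_add[OF i i] Suc.IH by simp
    qed
    finally show ?case .
  qed
  have real_ann: "(LINT x|leb01. g x * of_real (h x)) = 0" if h: "continuous_on UNIV h" for h :: "real \<Rightarrow> real"
  proof -
    \<comment> \<open>The continuous function with \<open>H (cos (\<pi> x)) = h x\<close> on the unit interval.\<close>
    define H where "H t = h (arccos t / pi)" for t
    have Hc: "continuous_on {-1..1} H"
      unfolding H_def[abs_def]
      by (intro continuous_on_compose2[OF h] continuous_intros) auto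
    let ?K = "LINT x|leb01. cmod (g x)"
    have K0: "0 \<le> ?K" by simp
    have "cmod (LINT x|leb01. g x * of_real (h x)) \<le> e * ?K" if "e > 0" for e
    proof -
      obtain q where q: "real_polynomial_function q" and qe: "\<And>t. t \<in> {-1..1} \<Longrightarrow> \<bar>H t - q t\<bar> < e"
        using Stone_Weierstrass_real_polynomial_function[OF compact_Icc Hc \<open>e > 0\<close>] by metis
      obtain a n where a: "q = (\<lambda>t. \<Sum>i\<le>n. a i * t ^ i)"
        using q unfolding real_polynomial_function_iff_sum by blast
      have i0: "integrable leb01 (\<lambda>x. g x * of_real (cos (pi * x) ^ i))" for i
        by (intro int continuous_intros)
      have z: "(LINT x|leb01. g x * of_real (cos (pi * x) ^ i)) = 0" for i
        using pw[of i 0] by simp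
      have "(LINT x|leb01. g x * of_real (q (cos (pi * x))))
          = (LINT x|leb01. (\<Sum>i\<le>n. of_real (a i) * (g x * of_real (cos (pi * x) ^ i))))"
        by (simp add: a sum_distrib_left mult_ac)
      also have "\<dots> = (\<Sum>i\<le>n. (LINT x|leb01. of_real (a i) * (g x * of_real (cos (pi * x) ^ i))))"
        by (rule Bochner_Integration.integral_sum) (intro integrable_mult_right i0)
      also have "\<dots> = 0"
        by (simp only: integral_mult_right_zero z) simp
      finally have q0: "(LINT x|leb01. g x * of_real (q (cos (pi * x)))) = 0" .
      have iq: "integrable leb01 (\<lambda>x. g x * of_real (q (cos (pi * x))))"
        by (intro int) (auto simp: a intro!: continuous_intros)
      have ih: "integrable leb01 (\<lambda>x. g x * of_real (h x))"
        by (intro int continuous_on_subset[OF h]) simp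
      have "(LINT x|leb01. g x * of_real (h x))
          = (LINT x|leb01. g x * of_real (h x) - g x * of_real (q (cos (pi * x))))"
        using iq ih q0 by simp
      also have "cmod \<dots> \<le> (LINT x|leb01. norm (g x * of_real (h x) - g x * of_real (q (cos (pi * x)))))"
        by (rule integral_norm_bound)
      also have "\<dots> \<le> (LINT x|leb01. e * cmod (g x))"
      proof (rule integral_mono)
        show "integrable leb01 (\<lambda>x. norm (g x * of_real (h x) - g x * of_real (q (cos (pi * x)))))"
          using iq ih by simp
        show "integrable leb01 (\<lambda>x. e * cmod (g x))" using g by simp
        fix x assume "x \<in> space leb01"
        then have x: "0 < x" "x < 1" by auto
        then have "arccos (cos (pi * x)) = pi * x"
          by (intro arccos_cos) auto
        then have "\<bar>h x - q (cos (pi * x))\<bar> \<le> e"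
          using qe[of "cos (pi * x)"] by (simp add: H_def less_imp_le)
        from mult_right_mono[OF this, of "cmod (g x)"]
        have "cmod (g x) * \<bar>h x - q (cos (pi * x))\<bar> \<le> e * cmod (g x)"
          by (simp add: mult.commute)
        then show "norm (g x * of_real (h x) - g x * of_real (q (cos (pi * x)))) \<le> e * cmod (g x)"
          by (simp only: right_diff_distrib[symmetric] of_real_diff[symmetric] norm_mult norm_of_real)
      qed
      finally show ?thesis by simp
    qed
    then have "cmod (LINT x|leb01. g x * of_real (h x)) \<le> e" if "e > 0" for e
      using that K0 divide_pos_pos[OF that, of "?K + 1"]
      by (smt (verit, best) mult_left_le nonzero_eq_divide_eq mult_left_mono)
    then have "cmod (LINT x|leb01. g x * of_real (h x)) \<le> 0"
      by (rule field_le_epsilon[where y = 0, simplified])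
    then show ?thesis by simp
  qed
  show ?thesis
  proof (rule annihilates_continuous_imp_zero[OF g])
    fix h :: "real \<Rightarrow> complex" assume h: "continuous_on UNIV h"
    have R: "continuous_on UNIV (\<lambda>x. Re (h x))" and I: "continuous_on UNIV (\<lambda>x. Im (h x))"
      using h by (auto intro: continuous_intros)
    have iR: "integrable leb01 (\<lambda>x. g x * of_real (Re (h x)))" and iI: "integrable leb01 (\<lambda>x. g x * of_real (Im (h x)))"
      by (intro int continuous_on_subset[OF R] continuous_on_subset[OF I], simp)+
    have "(LINT x|leb01. g x * h x) = (LINT x|leb01. g x * of_real (Re (h x)) + \<i> * (g x * of_real (Im (h x))))"
    proof (rule Bochner_Integration.integral_cong)
      fix x show "g x * h x = g x * of_real (Re (h x)) + \<i> * (g x * of_real (Im (h x)))"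
        by (subst complex_eq[of "h x"]) (simp add: algebra_simps)
    qed simp
    also have "\<dots> = 0"
      using iR iI real_ann[OF R] real_ann[OF I] by simp
    finally show "(LINT x|leb01. g x * h x) = 0" .
  qed
qed

lemma cos_vec_complete:
  assumes "\<And>k. cinner x (cos_vec k) = 0" shows "x = 0"
proof -
  obtain g where g: "sq_int g" and x: "x = l2_class g" by (rule l2_cases)
  have "(LINT x|leb01. g x * of_real (cos (pi * real k * x))) = 0" for k
  proof -
    have "(LINT x|leb01. g x * of_real (cosf k x))
      = of_real (if k = 0 then 1 else sqrt 2) * (LINT x|leb01. g x * of_real (cos (pi * real k * x)))"
      unfolding cosf_def by (simp add: mult_ac flip: integral_mult_right_zero)
    then show ?thesis
      using assms[of k] by (simp add: x cinner_l2_class_cos_vec g split: if_splits)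
  qed
  then have "AE x in leb01. g x = 0"
    by (intro cosine_complete sq_int_integrable g)
  then have "l2_class g = l2_class (\<lambda>_. 0)"
    by (simp add: l2_class_eq_iff g sq_int_zero)
  moreover have "l2_class (\<lambda>_. 0) = 0"
    by transfer (simp add: l2_eq_def sq_int_zero)
  ultimately show ?thesis by (simp add: x)
qed

section \<open>Cut-off functions\<close>

lemma max0_sq_deriv: "((\<lambda>t. (max 0 t)\<^sup>2) has_real_derivative 2 * max 0 t) (at (t::real))"
proof -
  consider "t > 0" | "t < 0" | "t = 0" by linarith
  then show ?thesis
  proof cases
    case 1
    have "((\<lambda>t. t\<^sup>2) has_real_derivative 2 * max 0 t) (at t)"
      using 1 by (auto intro!: derivative_eq_intros)
    then show ?thesis
      by (rule has_field_derivative_transform_within_open[of _ _ _ "{0<..}"]) (use 1 in auto)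
  next
    case 2
    have "((\<lambda>t. 0) has_real_derivative 2 * max 0 t) (at t)"
      using 2 by (auto intro!: derivative_eq_intros)
    then show ?thesis
      by (rule has_field_derivative_transform_within_open[of _ _ _ "{..<0}"]) (use 2 in auto)
  next
    case 3
    have "(max 0 z)\<^sup>2 - (max 0 0)\<^sup>2 = max 0 z * (z - (0::real))" for z
      by (simp add: max_def power2_eq_square)
    moreover have "isCont (max (0::real)) 0"
      by (intro continuous_intros)
    ultimately show ?thesis
      unfolding 3 CARAT_DERIV by (intro exI[of _ "max 0"]) auto
  qed
qed

text \<open>A step from 0 to 1 on the unit interval. Squares of positive parts, unlike positive parts
  themselves, are continuously differentiable.\<close>

definition step :: "real \<Rightarrow> real" where
  "step t = 1 - (max 0 (1 - (max 0 t)\<^sup>2))\<^sup>2"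

definition step' :: "real \<Rightarrow> real" where
  "step' t = 2 * max 0 (1 - (max 0 t)\<^sup>2) * (2 * max 0 t)"

lemma step_deriv: "(step has_real_derivative step' t) (at t)"
proof -
  have "((\<lambda>t. 1 - (max 0 t)\<^sup>2) has_real_derivative - (2 * max 0 t)) (at t)"
    by (rule derivative_eq_intros max0_sq_deriv refl | simp)+
  from DERIV_diff[OF DERIV_const[of 1] DERIV_chain2[OF max0_sq_deriv this]]
  show ?thesis
    unfolding step_def[abs_def] step'_def by simp
qed

lemma continuous_step' [continuous_intros]:
  "continuous_on S f \<Longrightarrow> continuous_on S (\<lambda>x. step' (f x))"
  unfolding step'_def[abs_def] by (intro continuous_intros)

lemma continuous_step [continuous_intros]:
  "continuous_on S f \<Longrightarrow> continuous_on S (\<lambda>x. step (f x))"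
  unfolding step_def[abs_def] by (intro continuous_intros)

lemma step_simps: "t \<le> 0 \<Longrightarrow> step t = 0" "t \<ge> 1 \<Longrightarrow> step t = 1"
  "t \<le> 0 \<Longrightarrow> step' t = 0" "t \<ge> 1 \<Longrightarrow> step' t = 0"
  using one_le_power[of t 2] by (auto simp: step_def step'_def)

lemma step_bound: "\<bar>step t\<bar> \<le> 1"
proof -
  have "0 \<le> max 0 (1 - (max 0 t)\<^sup>2)" "max 0 (1 - (max 0 t)\<^sup>2) \<le> 1" by auto
  then have "(max 0 (1 - (max 0 t)\<^sup>2))\<^sup>2 \<le> 1"
    by (simp add: power_le_one)
  then show ?thesis by (simp add: step_def)
qed

lemma step'_bound: "\<bar>step' t\<bar> \<le> 4"
proof (cases "0 \<le> t \<and> t \<le> 1")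
  case True
  then have "max 0 (1 - (max 0 t)\<^sup>2) \<le> 1" "0 \<le> max 0 (1 - (max 0 t)\<^sup>2)" by auto
  then have "max 0 (1 - (max 0 t)\<^sup>2) * max 0 t \<le> 1 * 1"
    using True by (intro mult_mono) auto
  then show ?thesis by (simp add: step'_def)
qed (use step_simps(3,4)[of t] in auto)

text \<open>For each \<open>n\<close> this is a test function: it vanishes where \<open>n x (1 - x) \<le> 1\<close>, in particular near
  both ends of the unit interval. It is 1 where \<open>n x (1 - x) \<ge> 2\<close>, which covers every interior point
  eventually.\<close>

definition cutoff :: "nat \<Rightarrow> real \<Rightarrow> real" where
  "cutoff n x = step (n * (x * (1 - x)) - 1)"

definition cutoff' :: "nat \<Rightarrow> real \<Rightarrow> real" where
  "cutoff' n x = step' (n * (x * (1 - x)) - 1) * (n * (1 - 2 * x))"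

lemma cutoff_deriv: "(cutoff n has_real_derivative cutoff' n x) (at x)"
  unfolding cutoff_def[abs_def] cutoff'_def
  by (rule DERIV_chain2[OF step_deriv]) (auto intro!: derivative_eq_intros simp: algebra_simps)

lemma continuous_cutoff [continuous_intros]:
  "continuous_on S (cutoff n)" "continuous_on S (cutoff' n)"
  unfolding cutoff_def[abs_def] cutoff'_def[abs_def] by (intro continuous_intros)+

lemma cutoff_measurable [measurable]:
  "cutoff n \<in> borel_measurable leb01" "cutoff' n \<in> borel_measurable leb01"
  by (intro continuous_measurable01 continuous_intros)+

lemma cutoff_bound: "\<bar>cutoff n x\<bar> \<le> 1"
  unfolding cutoff_def by (rule step_bound)

lemma eventually_interior:
  assumes "0 < x" "x < (1::real)"
  shows "\<forall>\<^sub>F n in sequentially. real n * (x * (1 - x)) \<ge> 2"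
proof -
  have p: "0 < x * (1 - x)" using assms by simp
  obtain N :: nat where "2 / (x * (1 - x)) \<le> real N"
    using real_arch_simple by blast
  then have "2 \<le> real n * (x * (1 - x))" if "n \<ge> N" for n
    using that p by (smt (verit, best) divide_le_eq of_nat_mono)
  then show ?thesis by (auto simp: eventually_sequentially)
qed

lemma cutoff_interior:
  assumes "real n * (x * (1 - x)) \<ge> 2" shows "cutoff n x = 1" "cutoff' n x = 0"
  using assms by (auto simp: cutoff_def cutoff'_def step_simps)

text \<open>The second bound holds uniformly in \<open>n\<close> because \<open>x (1 - x) \<le> 2 / n\<close> wherever the derivative does
  not vanish.\<close>

lemma cutoff'_bound:
  assumes "0 < x" "x < 1" shows "\<bar>cutoff' n x\<bar> \<le> 4 * real n" "\<bar>cutoff' n x\<bar> * (x * (1 - x)) \<le> 8"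
proof -
  have "\<bar>cutoff' n x\<bar> \<le> 4 * (real n * 1)"
    unfolding cutoff'_def abs_mult using assms by (intro mult_mono step'_bound) auto
  then show 1: "\<bar>cutoff' n x\<bar> \<le> 4 * real n" by simp
  show "\<bar>cutoff' n x\<bar> * (x * (1 - x)) \<le> 8"
  proof (cases "real n * (x * (1 - x)) \<ge> 2")
    case False
    have "\<bar>cutoff' n x\<bar> * (x * (1 - x)) \<le> 4 * real n * (x * (1 - x))"
      using 1 assms by (intro mult_right_mono) auto
    then show ?thesis using False by simp
  qed (simp add: cutoff_interior)
qed

lemma test_fun_cutoff:
  assumes F: "\<And>x. (F has_vector_derivative F' x) (at x)" and F': "continuous_on UNIV F'"
  shows "test_fun (\<lambda>x. complex_of_real (cutoff n x) * F x)
           (\<lambda>x. complex_of_real (cutoff' n x) * F x + complex_of_real (cutoff n x) * F' x)"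
  unfolding test_fun_def
proof (intro conjI allI)
  fix x
  have "((\<lambda>x. complex_of_real (cutoff n x)) has_vector_derivative complex_of_real (cutoff' n x)) (at x)"
    using cutoff_deriv has_vector_derivative_of_real by blast
  from has_vector_derivative_mult[OF this F]
  show "((\<lambda>x. complex_of_real (cutoff n x) * F x) has_vector_derivative
      complex_of_real (cutoff' n x) * F x + complex_of_real (cutoff n x) * F' x) (at x)"
    by (simp add: add.commute)
next
  have "continuous_on UNIV F"
    using F by (meson continuous_at_imp_continuous_on has_vector_derivative_continuous)
  then show "continuous_on UNIV (\<lambda>x. complex_of_real (cutoff' n x) * F x + complex_of_real (cutoff n x) * F' x)"
    by (intro continuous_intros F')
  let ?K = "{x. 1 \<le> real n * (x * (1 - x))}"
  have K: "?K \<subseteq> {0<..<1}"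
  proof
    fix x assume "x \<in> ?K"
    then have "0 < real n * (x * (1 - x))" by simp
    then have "0 < x * (1 - x)" by (simp add: zero_less_mult_iff)
    then show "x \<in> {0<..<1}" by (auto simp: zero_less_mult_iff)
  qed
  have "closed ?K" by (intro closed_Collect_le continuous_intros)
  then have "compact ?K"
    using K bounded_subset[OF compact_imp_bounded[OF compact_Icc[of 0 1]], of ?K] by (force simp: compact_eq_bounded_closed)
  moreover have "complex_of_real (cutoff n x) * F x = 0" if "x \<notin> ?K" for x
    using that by (simp add: cutoff_def step_simps)
  ultimately show "\<exists>K. compact K \<and> K \<subseteq> {0<..<1} \<and> (\<forall>x. x \<notin> K \<longrightarrow> complex_of_real (cutoff n x) * F x = 0)"
    using K by blast
qed

lemma cutoff_limit:
  fixes g :: "real \<Rightarrow> complex"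
  assumes g: "integrable leb01 g"
  shows "(\<lambda>n. LINT x|leb01. complex_of_real (cutoff n x) * g x) \<longlonglongrightarrow> (LINT x|leb01. g x)"
proof (rule integral_dominated_convergence[where w = "\<lambda>x. cmod (g x)"])
  have [measurable]: "g \<in> borel_measurable leb01" using g by auto
  show "g \<in> borel_measurable leb01" "(\<lambda>x. complex_of_real (cutoff n x) * g x) \<in> borel_measurable leb01" for n
    by measurable
  show "integrable leb01 (\<lambda>x. cmod (g x))" using g by simp
  show "AE x in leb01. (\<lambda>n. complex_of_real (cutoff n x) * g x) \<longlonglongrightarrow> g x"
    using AE_space
  proof eventually_elim
    case (elim x)
    then have "\<forall>\<^sub>F n in sequentially. real n * (x * (1 - x)) \<ge> 2"
      by (intro eventually_interior) auto
    then show ?case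
      by (rule tendsto_eventually[OF eventually_mono]) (simp add: cutoff_interior)
  qed
  show "AE x in leb01. norm (complex_of_real (cutoff n x) * g x) \<le> cmod (g x)" for n
    using cutoff_bound by (intro AE_I2) (simp add: norm_mult mult_left_le_one_le)
qed

text \<open>A boundary term of an integration by parts: \<open>g\<close> vanishes at the ends to first order, relative to
  the integrable function \<open>u\<close>, which cancels the growth of the derivatives of the cut-offs.\<close>

lemma cutoff'_limit_vanishing:
  fixes g :: "real \<Rightarrow> complex"
  assumes g[measurable]: "g \<in> borel_measurable leb01" and u: "integrable leb01 u"
    and gu: "\<And>x. 0 < x \<Longrightarrow> x < 1 \<Longrightarrow> cmod (g x) \<le> x * (1 - x) * u x"
  shows "(\<lambda>n. LINT x|leb01. complex_of_real (cutoff' n x) * g x) \<longlonglongrightarrow> 0"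
proof -
  have "(\<lambda>n. LINT x|leb01. complex_of_real (cutoff' n x) * g x) \<longlonglongrightarrow> (LINT x|leb01. 0)"
  proof (rule integral_dominated_convergence[where w = "\<lambda>x. 8 * u x"])
    show "(\<lambda>x. complex_of_real (cutoff' n x) * g x) \<in> borel_measurable leb01" for n
      by measurable
    show "integrable leb01 (\<lambda>x. 8 * u x)" using u by simp
    show "AE x in leb01. (\<lambda>n. complex_of_real (cutoff' n x) * g x) \<longlonglongrightarrow> 0"
      using AE_space
    proof eventually_elim
      case (elim x)
      then have "\<forall>\<^sub>F n in sequentially. real n * (x * (1 - x)) \<ge> 2"
        by (intro eventually_interior) auto
      then show ?case
        by (rule tendsto_eventually[OF eventually_mono]) (simp add: cutoff_interior)
    qed
    show "AE x in leb01. norm (complex_of_real (cutoff' n x) * g x) \<le> 8 * u x" for n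
      using AE_space
    proof eventually_elim
      case (elim x)
      then have x: "0 < x" "x < 1" by auto
      have "0 \<le> x * (1 - x) * u x"
        using order_trans[OF norm_ge_zero gu[OF x]] .
      then have u0: "0 \<le> u x"
        using mult_pos_neg[of "x * (1 - x)" "u x"] x by (smt (verit) mult_pos_pos)
      have "norm (complex_of_real (cutoff' n x) * g x) \<le> \<bar>cutoff' n x\<bar> * (x * (1 - x) * u x)"
        using gu[OF x] by (simp add: norm_mult mult_left_mono)
      also have "\<dots> \<le> 8 * u x"
        using mult_right_mono[OF cutoff'_bound(2)[OF x] u0, of n] by (simp add: mult_ac)
      finally show ?case .
    qed
  qed simp
  then show ?thesis by simp
qed

text \<open>In the unit interval the derivative is supported on two intervals of length \<open>4 / n\<close>, and it is
  bounded by \<open>4 n\<close>.\<close>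

lemma cutoff'_L1_bound: "(LINT x|leb01. \<bar>cutoff' n x\<bar>) \<le> 32"
proof (cases "n = 0")
  case False
  define A where "A = {0..4 / real n}"
  define B where "B = {1 - 4 / real n..1}"
  have AB: "A \<in> sets lebesgue" "B \<in> sets lebesgue" by (auto simp: A_def B_def)
  have m: "(LINT x|leb01. indicat_real S x) \<le> 4 / real n" if "S = A \<or> S = B" for S
  proof -
    have S: "S \<in> sets lebesgue" using that AB by auto
    have "(LINT x|leb01. indicat_real S x) = measure leb01 (S \<inter> {0<..<1})"
      using S by simp
    also have "\<dots> = measure lebesgue (S \<inter> {0<..<1})"
      using S by (intro measure_restrict_space) auto
    also have "\<dots> \<le> measure lebesgue S"
      using that by (intro measure_mono_fmeasurable) (auto simp: A_def B_def)
    also have "\<dots> = 4 / real n"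
      using that by (auto simp: A_def B_def)
    finally show ?thesis .
  qed
  have i: "integrable leb01 (indicat_real S)" if "S = A \<or> S = B" for S
  proof (rule Bochner_Integration.integrable_bound)
    show "integrable leb01 (\<lambda>x. 1 :: real)" by simp
    show "indicat_real S \<in> borel_measurable leb01"
      using that AB by (intro measurable_restrict_space1 borel_measurable_indicator) auto
  qed (simp add: indicator_def)
  have "(LINT x|leb01. \<bar>cutoff' n x\<bar>) \<le> (LINT x|leb01. 4 * real n * (indicat_real A x + indicat_real B x))"
  proof (rule integral_mono)
    show "integrable leb01 (\<lambda>x. \<bar>cutoff' n x\<bar>)"
      by (intro continuous_integrable01 continuous_intros)
    show "integrable leb01 (\<lambda>x. 4 * real n * (indicat_real A x + indicat_real B x))"
      using i by (intro integrable_mult_right Bochner_Integration.integrable_add) auto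
    fix x assume "x \<in> space leb01"
    then have x: "0 < x" "x < 1" by auto
    show "\<bar>cutoff' n x\<bar> \<le> 4 * real n * (indicat_real A x + indicat_real B x)"
    proof (cases "real n * (x * (1 - x)) \<ge> 2")
      case 2: False
      have "x \<in> A \<or> x \<in> B"
      proof (cases "x \<le> 1/2")
        case True
        then have "(real n * x) * (1/2) \<le> (real n * x) * (1 - x)"
          using x by (intro mult_left_mono) auto
        moreover have "(real n * x) * (1 - x) = real n * (x * (1 - x))"
          by (rule mult.assoc)
        ultimately have "real n * x \<le> 4" using 2 by linarith
        then show ?thesis using x False by (simp add: A_def field_simps)
      next
        case h: False
        then have "(real n * (1 - x)) * (1/2) \<le> (real n * (1 - x)) * x"
          using x by (intro mult_left_mono) auto
        moreover have "(real n * (1 - x)) * x = real n * (x * (1 - x))"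
          by (simp only: mult_ac)
        ultimately have "real n * (1 - x) \<le> 4" using 2 by linarith
        then show ?thesis using x False by (simp add: B_def field_simps)
      qed
      then have "1 \<le> indicat_real A x + indicat_real B x"
        by (auto simp: indicator_def)
      then have "4 * real n * 1 \<le> 4 * real n * (indicat_real A x + indicat_real B x)"
        by (intro mult_left_mono) auto
      then show ?thesis using cutoff'_bound(1)[OF x, of n] by simp
    qed (simp add: cutoff_interior)
  qed
  also have "\<dots> = 4 * real n * ((LINT x|leb01. indicat_real A x) + (LINT x|leb01. indicat_real B x))"
    using i[of A] i[of B] by (subst integral_mult_right_zero, subst Bochner_Integration.integral_add) auto
  also have "\<dots> \<le> 4 * real n * (4 / real n + 4 / real n)"
    using m by (intro mult_left_mono add_mono) auto
  also have "\<dots> = 32" using False by simp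
  finally show ?thesis .
qed (simp add: cutoff'_def)

text \<open>The other boundary term: \<open>q\<close> is continuous and vanishes at the ends, at no particular rate. It is
  at most \<open>e\<close> plus a multiple of \<open>x (1 - x)\<close>; the first part is controlled by \<open>cutoff'_L1_bound\<close>, the
  second by dominated convergence.\<close>

lemma cutoff'_limit_boundary:
  fixes q :: "real \<Rightarrow> complex"
  assumes q: "continuous_on {0..1} q" and q01: "q 0 = 0" "q 1 = 0"
  shows "(\<lambda>n. LINT x|leb01. complex_of_real (cutoff' n x) * q x) \<longlonglongrightarrow> 0"
proof (rule LIMSEQ_I)
  fix r :: real assume "r > 0"
  define e where "e = r / 64"
  have e: "e > 0" using \<open>r > 0\<close> by (simp add: e_def)
  obtain C where C: "\<And>x. x \<in> {0..1} \<Longrightarrow> norm (q x) \<le> C"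
    using compact_imp_bounded[OF compact_continuous_image[OF q compact_Icc]]
    unfolding bounded_iff by (metis imageI)
  have C0: "0 \<le> C" using C[of 0] by (simp add: q01)
  have uc: "uniformly_continuous_on {0..1} q"
    by (rule compact_uniformly_continuous[OF q compact_Icc])
  then obtain d where d: "d > 0" and
    dq: "\<And>x y. x \<in> {0..1} \<Longrightarrow> y \<in> {0..1} \<Longrightarrow> dist y x < d \<Longrightarrow> dist (q y) (q x) < e"
    using e unfolding uniformly_continuous_on_def by metis
  define d' where "d' = min d 1"
  have d': "0 < d'" "d' \<le> d" "d' \<le> 1" using d by (auto simp: d'_def)
  \<comment> \<open>Near the ends \<open>q\<close> is at most \<open>e\<close>; elsewhere \<open>x (1 - x)\<close> is bounded below.\<close>
  define K where "K = 2 * C / d'"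
  have K0: "0 \<le> K" using C0 d' by (simp add: K_def)
  have qb: "cmod (q x) \<le> e + K * (x * (1 - x))" if x: "0 < x" "x < 1" for x
  proof (cases "x < d' \<or> 1 - x < d'")
    case True
    have "cmod (q x) < e"
      using True dq[of 0 x] dq[of 1 x] x d' q01 by (auto simp: dist_norm)
    then show ?thesis using K0 x by (smt (verit) mult_nonneg_nonneg)
  next
    case False
    have "d' / 2 \<le> x * (1 - x)"
    proof (cases "x \<le> 1/2")
      case True
      then have "d' * (1/2) \<le> x * (1 - x)" using False x d' by (intro mult_mono) auto
      then show ?thesis by simp
    next
      case h: False
      then have "(1/2) * d' \<le> x * (1 - x)" using False x d' by (intro mult_mono) auto
      then show ?thesis by simp
    qed
    then have "K * (d' / 2) \<le> K * (x * (1 - x))" using K0 by (intro mult_left_mono)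
    moreover have "K * (d' / 2) = C" using d' by (simp add: K_def)
    ultimately show ?thesis using C[of x] x e by auto
  qed
  have "(\<lambda>n. LINT x|leb01. \<bar>cutoff' n x\<bar> * (K * (x * (1 - x)))) \<longlonglongrightarrow> (LINT x|leb01. 0)"
  proof (rule integral_dominated_convergence[where w = "\<lambda>x. 8 * K"])
    show "(\<lambda>x. \<bar>cutoff' n x\<bar> * (K * (x * (1 - x)))) \<in> borel_measurable leb01" for n
      by (intro continuous_measurable01 continuous_intros)
    show "AE x in leb01. (\<lambda>n. \<bar>cutoff' n x\<bar> * (K * (x * (1 - x)))) \<longlonglongrightarrow> 0"
      using AE_space
    proof eventually_elim
      case (elim x)
      then have "\<forall>\<^sub>F n in sequentially. real n * (x * (1 - x)) \<ge> 2"
        by (intro eventually_interior) auto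
      then show ?case
        by (rule tendsto_eventually[OF eventually_mono]) (simp add: cutoff_interior)
    qed
    show "AE x in leb01. norm (\<bar>cutoff' n x\<bar> * (K * (x * (1 - x)))) \<le> 8 * K" for n
      using AE_space
    proof eventually_elim
      case (elim x)
      then have x: "0 < x" "x < 1" by auto
      then show ?case
        using mult_right_mono[OF cutoff'_bound(2)[OF x] K0, of n] K0 by (simp add: abs_mult mult_ac)
    qed
  qed simp_all
  then have "(\<lambda>n. LINT x|leb01. \<bar>cutoff' n x\<bar> * (K * (x * (1 - x)))) \<longlonglongrightarrow> 0" by simp
  then have "\<exists>n0. \<forall>n\<ge>n0. norm ((LINT x|leb01. \<bar>cutoff' n x\<bar> * (K * (x * (1 - x)))) - 0) < r / 2"
    by (rule LIMSEQ_D) (simp add: \<open>r > 0\<close>)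
  then obtain n0 where n0: "\<And>n. n \<ge> n0 \<Longrightarrow> \<bar>LINT x|leb01. \<bar>cutoff' n x\<bar> * (K * (x * (1 - x)))\<bar> < r / 2"
    by auto
  have "norm ((LINT x|leb01. complex_of_real (cutoff' n x) * q x) - 0) < r" if n: "n \<ge> n0" for n
  proof -
    have i: "integrable leb01 (\<lambda>x. \<bar>cutoff' n x\<bar> * e)" "integrable leb01 (\<lambda>x. \<bar>cutoff' n x\<bar> * (K * (x * (1 - x))))"
      by (intro continuous_integrable01 continuous_intros)+
    have "norm (LINT x|leb01. complex_of_real (cutoff' n x) * q x)
        \<le> (LINT x|leb01. norm (complex_of_real (cutoff' n x) * q x))"
      by (rule integral_norm_bound)
    also have "\<dots> \<le> (LINT x|leb01. \<bar>cutoff' n x\<bar> * e + \<bar>cutoff' n x\<bar> * (K * (x * (1 - x))))"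
    proof (rule integral_mono)
      show "integrable leb01 (\<lambda>x. norm (complex_of_real (cutoff' n x) * q x))"
        by (intro continuous_integrable01 continuous_intros q)
      show "integrable leb01 (\<lambda>x. \<bar>cutoff' n x\<bar> * e + \<bar>cutoff' n x\<bar> * (K * (x * (1 - x))))"
        by (intro continuous_integrable01 continuous_intros)
      fix x assume "x \<in> space leb01"
      then have "\<bar>cutoff' n x\<bar> * cmod (q x) \<le> \<bar>cutoff' n x\<bar> * (e + K * (x * (1 - x)))"
        using qb[of x] by (intro mult_left_mono) auto
      then show "norm (complex_of_real (cutoff' n x) * q x)
          \<le> \<bar>cutoff' n x\<bar> * e + \<bar>cutoff' n x\<bar> * (K * (x * (1 - x)))"
        by (simp add: norm_mult distrib_left)
    qed
    also have "\<dots> = (LINT x|leb01. \<bar>cutoff' n x\<bar>) * e + (LINT x|leb01. \<bar>cutoff' n x\<bar> * (K * (x * (1 - x))))"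
      using i by (subst Bochner_Integration.integral_add) auto
    also have "(LINT x|leb01. \<bar>cutoff' n x\<bar>) * e \<le> 32 * e"
      using e by (intro mult_right_mono cutoff'_L1_bound) auto
    finally show ?thesis
      using n0[OF n] by (simp add: e_def)
  qed
  then show "\<exists>n0. \<forall>n\<ge>n0. norm ((LINT x|leb01. complex_of_real (cutoff' n x) * q x) - 0) < r" by blast
qed

section \<open>The Neumann operator in the cosine basis\<close>

global_interpretation cosine: orthonormal_basis cos_vec
  by unfold_locales (auto simp: cos_vec_orthonormal intro: cos_vec_complete)

lemma test_fun_continuous:
  assumes "test_fun \<phi> \<phi>'" shows "continuous_on S \<phi>" "continuous_on S \<phi>'"
proof -
  show "continuous_on S \<phi>"
    using assms unfolding test_fun_def
    by (meson continuous_at_imp_continuous_on has_vector_derivative_continuous)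
  show "continuous_on S \<phi>'"
    using assms unfolding test_fun_def by (meson continuous_on_subset subset_UNIV)
qed

lemma test_fun_by_parts:
  assumes t: "test_fun \<phi> \<phi>'" and E: "\<And>x. (E has_vector_derivative E' x) (at x)"
    and E': "continuous_on {0..1} E'"
  shows "(LINT x|leb01. E x * \<phi>' x) = - (LINT x|leb01. E' x * \<phi> x)"
proof -
  have Ec: "continuous_on {0..1} E"
    using E by (meson continuous_at_imp_continuous_on has_vector_derivative_continuous)
  have "\<phi> 0 = 0" "\<phi> 1 = 0"
    using t unfolding test_fun_def by (metis greaterThanLessThan_iff less_irrefl subsetD)+
  moreover have "(LINT x|leb01. E x * \<phi>' x + E' x * \<phi> x) = E 1 * \<phi> 1 - E 0 * \<phi> 0"
    by (rule FTC01)
      (use t in \<open>auto simp: test_fun_def intro!: has_vector_derivative_mult E continuous_intros Ec E' test_fun_continuous[OF t]\<close>)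
  moreover have "(LINT x|leb01. E x * \<phi>' x + E' x * \<phi> x)
      = (LINT x|leb01. E x * \<phi>' x) + (LINT x|leb01. E' x * \<phi> x)"
    by (intro Bochner_Integration.integral_add continuous_integrable01 continuous_intros Ec E'
        test_fun_continuous[OF t])
  ultimately show ?thesis
    by (simp add: eq_neg_iff_add_eq_0)
qed

lemma sq_int_times_continuous:
  assumes f: "sq_int f" and h: "continuous_on {0..1} h"
  shows "integrable leb01 (\<lambda>x. f x * h x)"
  using sq_int_mult_integrable[OF f sq_int_continuous[of "\<lambda>x. cnj (h x)"]] h
  by (simp add: continuous_on_cnj)

text \<open>Testing with the cosines, cut off near the ends, determines all Fourier coefficients of a weak
  derivative.\<close>

lemma weak_deriv_unique:
  assumes "has_weak_deriv f g" "has_weak_deriv f h" shows "g = h"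
proof (rule cosine.eq_by_coeffs)
  fix k
  obtain f' g' h' where f': "sq_int f'" "f = l2_class f'" and g': "sq_int g'" "g = l2_class g'"
    and h': "sq_int h'" "h = l2_class h'"
    by (metis l2_cases)
  let ?c = "\<lambda>x. complex_of_real (cosf k x)"
  have lim: "(\<lambda>n. LINT x|leb01. u x * (complex_of_real (cutoff n x) * ?c x)) \<longlonglongrightarrow> (LINT x|leb01. u x * ?c x)"
    if "sq_int u" for u
    using cutoff_limit[OF sq_int_times_continuous[OF that, of ?c]]
    by (simp add: mult.left_commute continuous_intros)
  have "(LINT x|leb01. g' x * (complex_of_real (cutoff n x) * ?c x))
      = (LINT x|leb01. h' x * (complex_of_real (cutoff n x) * ?c x))" for n
  proof -
    have t: "test_fun (\<lambda>x. complex_of_real (cutoff n x) * ?c x)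
        (\<lambda>x. complex_of_real (cutoff' n x) * ?c x + complex_of_real (cutoff n x) * complex_of_real (cosf' k x))"
      by (rule test_fun_cutoff[OF cosf_vderiv]) (intro continuous_intros)
    have "- (LINT x|leb01. g' x * (complex_of_real (cutoff n x) * ?c x))
        = - (LINT x|leb01. h' x * (complex_of_real (cutoff n x) * ?c x))"
      using assms[unfolded f' g' h' has_weak_deriv_l2_class[OF f'(1) g'(1)] has_weak_deriv_l2_class[OF f'(1) h'(1)],
          THEN spec, THEN spec, THEN mp, OF t] by (rule trans[OF sym])
    then show ?thesis by (simp only: neg_equal_iff_equal)
  qed
  then have "(LINT x|leb01. g' x * ?c x) = (LINT x|leb01. h' x * ?c x)"
    using lim[OF g'(1)] lim[OF h'(1)] LIMSEQ_unique by simp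
  then show "cinner g (cos_vec k) = cinner h (cos_vec k)"
    by (simp add: g' h' cinner_l2_class_cos_vec)
qed

lemma weak_deriv_eq: "has_weak_deriv f g \<Longrightarrow> weak_deriv f = g"
  unfolding weak_deriv_def using weak_deriv_unique by blast

text \<open>This rate makes \<open>cutoff'_limit_vanishing\<close> applicable: \<open>|sin (\<pi> k x)|\<close> is at most \<open>\<pi> k\<close> times the
  distance of \<open>x\<close> from either end.\<close>

lemma cosf'_vanishes_at_ends:
  assumes "0 < x" "x < 1"
  shows "\<bar>cosf' k x\<bar> \<le> x * (1 - x) * (4 * (pi * k)\<^sup>2)"
proof -
  let ?a = "pi * real k"
  have "\<bar>sin (?a * x)\<bar> \<le> ?a * x"
    using abs_sin_x_le_abs_x[of "?a * x"] assms by simp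
  moreover have "\<bar>sin (?a * x)\<bar> \<le> ?a * (1 - x)"
  proof -
    have "sin (?a * (1 - x)) = - cos ?a * sin (?a * x)"
      unfolding right_diff_distrib[of ?a] mult_1_right sin_diff by simp
    moreover have "\<bar>cos ?a\<bar> = 1"
      by (simp add: mult.commute)
    ultimately have "\<bar>sin (?a * (1 - x))\<bar> = \<bar>sin (?a * x)\<bar>"
      by (simp add: abs_mult)
    then show ?thesis
      using abs_sin_x_le_abs_x[of "?a * (1 - x)"] assms by simp
  qed
  ultimately have "\<bar>sin (?a * x)\<bar> \<le> ?a * min x (1 - x)"
    by (simp add: min_def)
  also have "min x (1 - x) \<le> 2 * (x * (1 - x))"
  proof (cases "x \<le> 1/2")
    case True
    then have "x * 1 \<le> x * (2 * (1 - x))" using assms by (intro mult_left_mono) auto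
    then show ?thesis by (simp add: min_def algebra_simps)
  next
    case False
    then have "(1 - x) * 1 \<le> (1 - x) * (2 * x)" using assms by (intro mult_left_mono) auto
    then show ?thesis by (simp add: min_def algebra_simps)
  qed
  finally have s: "\<bar>sin (?a * x)\<bar> \<le> ?a * (2 * (x * (1 - x)))"
    by (simp add: mult_left_mono)
  have "\<bar>cosf' k x\<bar> = (if k = 0 then 1 else sqrt 2) * ?a * \<bar>sin (?a * x)\<bar>"
    by (simp add: cosf'_def abs_mult)
  also have "\<dots> \<le> 2 * ?a * (?a * (2 * (x * (1 - x))))"
    using assms by (intro mult_mono s) (auto simp: real_le_lsqrt)
  finally show ?thesis by (simp add: power2_eq_square mult_ac)
qed

text \<open>Two integrations by parts against a cosine. One boundary term vanishes because the derivative of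
  \<open>y\<close> is 0 at the ends, the other because the derivative of the cosine is.\<close>

lemma op_A_coeffs:
  assumes y: "y \<in> dom_A" shows "cinner (op_A y) (cos_vec k) = of_real (eigval k) * cinner y (cos_vec k)"
proof -
  obtain y1 y2 where w1: "has_weak_deriv y y1" and w2: "has_weak_deriv y1 y2"
    using y by (auto simp: dom_A_def sobolev2_def)
  note e1 = weak_deriv_eq[OF w1] and e2 = weak_deriv_eq[OF w2]
  obtain p where p: "continuous_on {0..1} p" "has_version y1 p" "p 0 = 0" "p 1 = 0"
    using y e1 by (auto simp: dom_A_def)
  have sp: "sq_int p" by (rule sq_int_continuous[OF p(1)])
  obtain f where f: "sq_int f" "y = l2_class f" by (rule l2_cases)
  obtain f1 where f1: "sq_int f1" "y1 = l2_class f1" by (rule l2_cases)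
  obtain f2 where f2: "sq_int f2" "y2 = l2_class f2" by (rule l2_cases)
  have y1: "y1 = l2_class p"
    using p(2) by (simp add: f1 has_version_l2_class l2_class_eq_iff sp)
  have wd1: "(LINT x|leb01. f x * \<phi>' x) = - (LINT x|leb01. p x * \<phi> x)"
    and wd2: "(LINT x|leb01. p x * \<phi>' x) = - (LINT x|leb01. f2 x * \<phi> x)"
    if "test_fun \<phi> \<phi>'" for \<phi> \<phi>'
    using w1 w2 that unfolding y1 f f2
    by (auto simp: has_weak_deriv_l2_class f(1) f2(1) sp)
  let ?c = "\<lambda>x. complex_of_real (cosf k x)"
  let ?s = "\<lambda>x. complex_of_real (cosf' k x)"
  let ?c2 = "\<lambda>x. complex_of_real (- eigval k * cosf k x)"
  have cs: "continuous_on S ?c" "continuous_on S ?s" "continuous_on S ?c2" for S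
    by (intro continuous_intros)+
  have lim: "(\<lambda>n. LINT x|leb01. u x * (complex_of_real (cutoff n x) * h x)) \<longlonglongrightarrow> (LINT x|leb01. u x * h x)"
    if "sq_int u" "continuous_on {0..1} h" for u h
    using cutoff_limit[OF sq_int_times_continuous[OF that]] by (simp add: mult.left_commute)
  \<comment> \<open>The product rule splits the integral against the derivative of a cut-off function.\<close>
  have split: "(LINT x|leb01. u x * (complex_of_real (cutoff' n x) * h x + complex_of_real (cutoff n x) * h' x))
      = (LINT x|leb01. complex_of_real (cutoff' n x) * (u x * h x))
        + (LINT x|leb01. u x * (complex_of_real (cutoff n x) * h' x))"
    if u: "sq_int u" and h: "continuous_on {0..1} h" "continuous_on {0..1} h'" for u h h' n
  proof -
    have "integrable leb01 (\<lambda>x. u x * (complex_of_real (cutoff' n x) * h x))"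
      "integrable leb01 (\<lambda>x. u x * (complex_of_real (cutoff n x) * h' x))"
      by (intro sq_int_times_continuous u continuous_intros h)+
    from Bochner_Integration.integral_add[OF this] show ?thesis
      by (simp add: distrib_left mult.left_commute)
  qed
  have "(LINT x|leb01. p x * ?s x) = - (LINT x|leb01. f2 x * ?c x)"
  proof (rule LIMSEQ_unique)
    have "(\<lambda>n. LINT x|leb01. complex_of_real (cutoff' n x) * (p x * ?c x)) \<longlonglongrightarrow> 0"
      by (rule cutoff'_limit_boundary) (use p in \<open>auto intro!: continuous_intros\<close>)
    from tendsto_add[OF this lim[OF sp cs(2)]]
    show "(\<lambda>n. - (LINT x|leb01. f2 x * (complex_of_real (cutoff n x) * ?c x))) \<longlonglongrightarrow> (LINT x|leb01. p x * ?s x)"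
      using wd2[OF test_fun_cutoff[OF cosf_vderiv cs(2)]] by (simp add: split[OF sp cs(1) cs(2)])
    show "(\<lambda>n. - (LINT x|leb01. f2 x * (complex_of_real (cutoff n x) * ?c x))) \<longlonglongrightarrow> - (LINT x|leb01. f2 x * ?c x)"
      by (intro tendsto_minus lim f2 cs)
  qed
  moreover have "(LINT x|leb01. f x * ?c2 x) = - (LINT x|leb01. p x * ?s x)"
  proof (rule LIMSEQ_unique)
    have "(\<lambda>n. LINT x|leb01. complex_of_real (cutoff' n x) * (f x * ?s x)) \<longlonglongrightarrow> 0"
    proof (rule cutoff'_limit_vanishing)
      have [measurable]: "f \<in> borel_measurable leb01" "?s \<in> borel_measurable leb01"
        using f by (auto simp: sq_int_def intro!: continuous_measurable01 cs)
      show "(\<lambda>x. f x * ?s x) \<in> borel_measurable leb01" by measurable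
      show "integrable leb01 (\<lambda>x. (4 * (pi * k)\<^sup>2) * cmod (f x))"
        by (intro integrable_mult_right integrable_norm sq_int_integrable f)
      fix x :: real assume x: "0 < x" "x < 1"
      show "cmod (f x * ?s x) \<le> x * (1 - x) * ((4 * (pi * k)\<^sup>2) * cmod (f x))"
        using mult_right_mono[OF cosf'_vanishes_at_ends[OF x, of k] norm_ge_zero[of "f x"]]
        by (simp add: norm_mult mult_ac)
    qed
    from tendsto_add[OF this lim[OF f(1) cs(3)]]
    show "(\<lambda>n. - (LINT x|leb01. p x * (complex_of_real (cutoff n x) * ?s x))) \<longlonglongrightarrow> (LINT x|leb01. f x * ?c2 x)"
      using wd1[OF test_fun_cutoff[OF cosf'_vderiv cs(3)]] by (simp only: split[OF f(1) cs(2) cs(3)] add_0_left)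
    show "(\<lambda>n. - (LINT x|leb01. p x * (complex_of_real (cutoff n x) * ?s x))) \<longlonglongrightarrow> - (LINT x|leb01. p x * ?s x)"
      by (intro tendsto_minus lim sp cs)
  qed
  moreover have "(LINT x|leb01. f x * ?c2 x) = - of_real (eigval k) * (LINT x|leb01. f x * ?c x)"
    by (simp add: mult_ac flip: integral_mult_right_zero)
  moreover have "cinner (op_A y) (cos_vec k) = - (LINT x|leb01. f2 x * ?c x)"
    by (simp only: op_A_def e1 e2 cinner_minus_left f2(2) cinner_l2_class_cos_vec[OF f2(1)])
  ultimately show ?thesis
    by (simp add: f(2) cinner_l2_class_cos_vec[OF f(1)])
qed

text \<open>The converse of \<open>op_A_coeffs\<close>. The derivative of \<open>w\<close> is the sine series obtained by differentiating
  the cosine series of \<open>w\<close> term by term. Its terms are at most \<open>2 |h\<^sub>k| / (\<pi> k)\<close> with square summable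
  \<open>h\<^sub>k\<close>, so it converges uniformly and inherits the boundary values of the sines.\<close>

lemma dom_A_by_coeffs:
  assumes hw: "\<And>k. cinner h (cos_vec k) = of_real (eigval k) * cinner w (cos_vec k)"
  shows "w \<in> dom_A" "op_A w = h"
proof -
  define c where "c k = cinner w (cos_vec k)" for k
  define M where "M k = (cmod (cinner h (cos_vec k)))\<^sup>2 + (1 / real k)\<^sup>2" for k
  have M: "summable M"
    unfolding M_def inverse_eq_divide[symmetric] power_inverse
    by (intro summable_add cosine.summable_coeffs inverse_power_summable) simp
  have cM: "cmod (c k * complex_of_real (cosf' k x)) \<le> M k" for k x
  proof (cases "k = 0")
    case False
    have "(pi * k) * (2 * (pi * k) * cmod (c k)) = 2 * cmod (cinner h (cos_vec k))"
      by (simp add: hw c_def norm_mult eigval_def power2_eq_square)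
    then have "2 * (pi * k) * cmod (c k) = 2 * cmod (cinner h (cos_vec k)) / (pi * k)"
      using False by (simp add: field_simps)
    also have "\<dots> \<le> 2 * cmod (cinner h (cos_vec k)) / real k"
      using False pi_gt3 by (intro divide_left_mono) auto
    also have "\<dots> = 2 * (cmod (cinner h (cos_vec k)) * (1 / real k))" by simp
    also have "\<dots> \<le> M k"
      unfolding M_def using sum_squares_bound[of "cmod (cinner h (cos_vec k))" "1 / real k"] by simp
    finally show ?thesis
      using mult_right_mono[OF cosf'_bound[of k x] norm_ge_zero[of "c k"]]
      by (simp add: norm_mult mult_ac)
  qed (simp add: cosf'_def M_def)
  define p where "p x = (\<Sum>k. c k * complex_of_real (cosf' k x))" for x
  have "uniform_limit {0..1} (\<lambda>n x. \<Sum>k<n. c k * complex_of_real (cosf' k x)) p sequentially"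
    unfolding p_def[abs_def] by (rule Weierstrass_m_test[OF cM M])
  then have pc: "continuous_on {0..1} p"
    by (rule uniform_limit_theorem[rotated]) (auto intro!: always_eventually continuous_intros)
  have sp: "sq_int p" by (rule sq_int_continuous[OF pc])
  have p01: "p 0 = 0" "p 1 = 0" by (simp_all add: p_def)
  have term_by_term: "(\<lambda>k. c k * (LINT x|leb01. complex_of_real (cosf' k x) * \<psi> x)) sums (LINT x|leb01. p x * \<psi> x)"
    if \<psi>: "continuous_on {0..1} \<psi>" for \<psi>
  proof -
    obtain C where C: "\<And>x. x \<in> {0..1} \<Longrightarrow> norm (\<psi> x) \<le> C"
      using compact_imp_bounded[OF compact_continuous_image[OF \<psi> compact_Icc]]
      unfolding bounded_iff by (metis imageI)
    let ?g = "\<lambda>k x. c k * complex_of_real (cosf' k x) * \<psi> x"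
    have gi: "integrable leb01 (?g k)" for k
      by (intro continuous_integrable01 continuous_intros \<psi>)
    have gM: "cmod (?g k x) \<le> M k * C" if "x \<in> {0..1}" for k x
      unfolding norm_mult[of _ "\<psi> x"] using C[OF that] order_trans[OF norm_ge_zero cM[of k x]]
      by (intro mult_mono cM) auto
    have MC: "summable (\<lambda>k. M k * C)" by (intro summable_mult2 M)
    have "(\<lambda>k. integral\<^sup>L leb01 (?g k)) sums (LINT x|leb01. (\<Sum>k. ?g k x))"
    proof (rule sums_integral[OF gi])
      show "AE x in leb01. summable (\<lambda>k. norm (?g k x))"
        using AE_space
      proof eventually_elim
        case (elim x)
        then have "x \<in> {0..1}" by auto
        then show ?case
          using gM by (intro summable_comparison_test'[OF MC, of 0]) auto
      qed
      show "summable (\<lambda>k. LINT x|leb01. norm (?g k x))"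
      proof (rule summable_comparison_test'[OF MC, of 0])
        fix k
        have "(LINT x|leb01. norm (?g k x)) \<le> (LINT x|leb01. M k * C)"
          by (rule integral_mono) (use gi gM in auto)
        also have "\<dots> = M k * C" by (simp add: measure_restrict_space)
        finally show "norm (LINT x|leb01. norm (?g k x)) \<le> M k * C" by simp
      qed
    qed
    moreover have "(\<Sum>k. ?g k x) = p x * \<psi> x" for x
      unfolding p_def
      by (rule suminf_mult2[symmetric]) (rule summable_norm_cancel, rule summable_comparison_test'[OF M, of 0], simp add: cM del: norm_mult)
    ultimately show ?thesis
      by (simp only: mult.assoc integral_mult_right_zero)
  qed
  obtain f where f: "sq_int f" "w = l2_class f" by (rule l2_cases)
  obtain g where g: "sq_int g" "h = l2_class g" by (rule l2_cases)
  have expand: "(\<lambda>k. cinner (l2_class u) (cos_vec k) * (LINT x|leb01. complex_of_real (cosf k x) * \<psi> x)) sums (LINT x|leb01. u x * \<psi> x)"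
    if u: "sq_int u" and \<psi>: "continuous_on {0..1} \<psi>" for u \<psi>
  proof -
    have s: "sq_int (\<lambda>x. cnj (\<psi> x))" by (intro sq_int_continuous continuous_intros \<psi>)
    from bounded_linear_sums_cinner[OF cosine.expansion[of "l2_class u"], of "l2_class (\<lambda>x. cnj (\<psi> x))"]
    show ?thesis
      unfolding cinner_cscale_left cinner_l2_class[OF u s] cos_vec_def by (simp add: cinner_l2_class s)
  qed
  have wd1: "has_weak_deriv w (l2_class p)"
    unfolding f has_weak_deriv_l2_class[OF f(1) sp]
  proof (intro allI impI)
    fix \<phi> \<phi>' assume t: "test_fun \<phi> \<phi>'"
    note tc = test_fun_continuous[OF t]
    have "(LINT x|leb01. complex_of_real (cosf k x) * \<phi>' x) = - (LINT x|leb01. complex_of_real (cosf' k x) * \<phi> x)" for k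
      by (intro test_fun_by_parts[OF t] cosf_vderiv continuous_intros)
    then have "(\<lambda>k. - (c k * (LINT x|leb01. complex_of_real (cosf' k x) * \<phi> x))) sums (LINT x|leb01. f x * \<phi>' x)"
      using expand[OF f(1) tc(2)] by (simp add: c_def f)
    then show "(LINT x|leb01. f x * \<phi>' x) = - (LINT x|leb01. p x * \<phi> x)"
      using sums_minus[OF term_by_term[OF tc(1)]] sums_unique2 by blast
  qed
  have "has_weak_deriv (l2_class p) (l2_class (\<lambda>x. - g x))"
    unfolding has_weak_deriv_l2_class[OF sp sq_int_uminus[OF g(1)]]
  proof (intro allI impI)
    fix \<phi> \<phi>' assume t: "test_fun \<phi> \<phi>'"
    note tc = test_fun_continuous[OF t]
    have "(LINT x|leb01. complex_of_real (cosf' k x) * \<phi>' x)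
        = - (LINT x|leb01. complex_of_real (- eigval k * cosf k x) * \<phi> x)" for k
      by (intro test_fun_by_parts[OF t] cosf'_vderiv continuous_intros)
    moreover have "(LINT x|leb01. complex_of_real (- eigval k * cosf k x) * \<phi> x)
        = - of_real (eigval k) * (LINT x|leb01. complex_of_real (cosf k x) * \<phi> x)" for k
      by (simp add: mult.assoc flip: integral_mult_right_zero)
    ultimately have "(\<lambda>k. cinner (l2_class g) (cos_vec k) * (LINT x|leb01. complex_of_real (cosf k x) * \<phi> x))
        sums (LINT x|leb01. p x * \<phi>' x)"
      using term_by_term[OF tc(2)] hw by (simp add: c_def g mult_ac)
    then have "(LINT x|leb01. g x * \<phi> x) = (LINT x|leb01. p x * \<phi>' x)"
      using expand[OF g(1) tc(1)] sums_unique2 by blast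
    then show "(LINT x|leb01. p x * \<phi>' x) = - (LINT x|leb01. - g x * \<phi> x)"
      by simp
  qed
  then have wd2: "has_weak_deriv (l2_class p) (- h)"
    by (simp add: g l2_class_uminus)
  have "has_version (l2_class p) p"
    by (simp add: has_version_l2_class sp)
  then show "w \<in> dom_A"
    unfolding dom_A_def sobolev2_def using wd1 wd2 pc p01 weak_deriv_eq[OF wd1] by auto
  show "op_A w = h"
    by (simp add: op_A_def weak_deriv_eq[OF wd1] weak_deriv_eq[OF wd2])
qed

lemma op_A_iff:
  "w \<in> dom_A \<and> op_A w = h \<longleftrightarrow> (\<forall>k. cinner h (cos_vec k) = of_real (eigval k) * cinner w (cos_vec k))"
  using op_A_coeffs dom_A_by_coeffs by blast

section \<open>Multiplications and shifts\<close>

lemma linf_cnj: "V \<in> linf \<Longrightarrow> (\<lambda>x. cnj (V x)) \<in> linf"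
proof -
  assume "V \<in> linf"
  then have "V \<in> borel_measurable leb01" "\<exists>C. AE x in leb01. cmod (V x) \<le> C"
    by (auto simp: linf_def)
  then show ?thesis
    unfolding linf_def
    by (auto intro!: borel_measurable_continuous_on[where f = cnj] simp: continuous_on_cnj)
qed

lemma sq_int_mult: "V \<in> linf \<Longrightarrow> sq_int f \<Longrightarrow> sq_int (\<lambda>x. V x * f x)"
proof -
  assume V: "V \<in> linf" and f: "sq_int f"
  have [measurable]: "V \<in> borel_measurable leb01" "f \<in> borel_measurable leb01"
    using f V by (auto simp: sq_int_def linf_def)
  obtain C where C: "AE x in leb01. cmod (V x) \<le> C"
    using V by (auto simp: linf_def)
  have "integrable leb01 (\<lambda>x. (cmod (V x * f x))\<^sup>2)"
  proof (rule Bochner_Integration.integrable_bound)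
    show "integrable leb01 (\<lambda>x. C\<^sup>2 * (cmod (f x))\<^sup>2)"
      using f by (simp add: sq_int_def)
    show "AE x in leb01. norm ((cmod (V x * f x))\<^sup>2) \<le> norm (C\<^sup>2 * (cmod (f x))\<^sup>2)"
      using C by eventually_elim
        (simp add: norm_mult power_mult_distrib mult_right_mono power_mono)
  qed measurable
  then show ?thesis by (simp add: sq_int_def)
qed

lemma mult_op_l2_class:
  assumes "V \<in> linf" "sq_int f" shows "mult_op V (l2_class f) = l2_class (\<lambda>x. V x * f x)"
  using assms sq_int_mult[OF assms] by transfer (simp add: l2_eq_def)

lemma shift_op_l2_class:
  assumes "sq_int f" shows "shift_op a (l2_class f) = l2_class (translate a (zero_ext f))"
  using assms sq_int_translate[OF assms] by transfer (simp add: l2_eq_def)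

lemma mult_op_add: "V \<in> linf \<Longrightarrow> mult_op V (f + g) = mult_op V f + mult_op V g"
  by (rule l2_cases[of f], rule l2_cases[of g])
    (simp add: l2_class_add mult_op_l2_class sq_int_add sq_int_mult distrib_left)

lemma mult_op_cscale: "V \<in> linf \<Longrightarrow> mult_op V (c *\<^sub>C f) = c *\<^sub>C mult_op V f"
  by (rule l2_cases[of f])
    (simp add: l2_class_cscale mult_op_l2_class sq_int_cmult sq_int_mult mult.left_commute)

lemma shift_op_add: "shift_op a (f + g) = shift_op a f + shift_op a g"
proof (rule l2_cases[of f], rule l2_cases[of g])
  fix u v assume "sq_int u" "f = l2_class u" "sq_int v" "g = l2_class v"
  moreover have "translate a (zero_ext (\<lambda>x. u x + v x)) = (\<lambda>x. translate a (zero_ext u) x + translate a (zero_ext v) x)"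
    by (auto simp: translate_def zero_ext_def)
  ultimately show ?thesis
    by (simp add: l2_class_add shift_op_l2_class sq_int_add sq_int_translate)
qed

lemma shift_op_cscale: "shift_op a (c *\<^sub>C f) = c *\<^sub>C shift_op a f"
proof (rule l2_cases[of f])
  fix u assume "sq_int u" "f = l2_class u"
  moreover have "translate a (zero_ext (\<lambda>x. c * u x)) = (\<lambda>x. c * translate a (zero_ext u) x)"
    by (auto simp: translate_def zero_ext_def)
  ultimately show ?thesis
    by (simp add: l2_class_cscale shift_op_l2_class sq_int_cmult sq_int_translate)
qed

lemma mult_op_adjoint:
  assumes "V \<in> linf" shows "cinner (mult_op V f) g = cinner f (mult_op (\<lambda>x. cnj (V x)) g)"
proof (rule l2_cases[of f], rule l2_cases[of g])
  fix u v assume u: "sq_int u" "f = l2_class u" and v: "sq_int v" "g = l2_class v"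
  note uV = sq_int_mult[OF assms u(1)] and vV = sq_int_mult[OF linf_cnj[OF assms] v(1)]
  show ?thesis
    unfolding u(2) v(2) mult_op_l2_class[OF assms u(1)] mult_op_l2_class[OF linf_cnj[OF assms] v(1)]
      cinner_l2_class[OF uV v(1)] cinner_l2_class[OF u(1) vV]
    by (simp add: mult_ac)
qed

lemma mult_op_bounded:
  assumes V: "V \<in> linf" shows "\<exists>C\<ge>0. \<forall>f. norm (mult_op V f) \<le> C * norm f"
proof -
  obtain C where C: "AE x in leb01. cmod (V x) \<le> C"
    using V by (auto simp: linf_def)
  have "norm (mult_op V f) \<le> \<bar>C\<bar> * norm f" for f
  proof (rule l2_cases[of f])
    fix u assume u: "sq_int u" "f = l2_class u"
    note uV = sq_int_mult[OF V u(1)]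
    have "(norm (mult_op V f))\<^sup>2 = (LINT x|leb01. (cmod (V x * u x))\<^sup>2)"
      by (simp add: u mult_op_l2_class V norm_l2_class uV del: norm_mult)
    also have "\<dots> \<le> (LINT x|leb01. C\<^sup>2 * (cmod (u x))\<^sup>2)"
    proof (rule integral_mono_AE)
      show "AE x in leb01. (cmod (V x * u x))\<^sup>2 \<le> C\<^sup>2 * (cmod (u x))\<^sup>2"
        using C by eventually_elim
          (simp add: norm_mult power_mult_distrib mult_right_mono power_mono)
    qed (use u uV in \<open>auto simp: sq_int_def\<close>)
    also have "\<dots> = (\<bar>C\<bar> * norm f)\<^sup>2"
      by (simp add: u norm_l2_class power_mult_distrib)
    finally show ?thesis
      by (meson abs_ge_zero mult_nonneg_nonneg norm_ge_zero power2_le_imp_le)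
  qed
  then show ?thesis by (intro exI[of _ "\<bar>C\<bar>"]) auto
qed

lemma leb01_integral_zero_ext:
  fixes f :: "real \<Rightarrow> 'a :: euclidean_space"
  shows "(LINT x|leb01. f x) = (LINT x|lebesgue. (if x \<in> {0<..<1} then f x else 0))"
  by (subst integral_restrict_space)
    (auto intro!: Bochner_Integration.integral_cong simp: indicator_def)

text \<open>Both sides are integrals over the whole line of functions continued by zero, and a translation
  carries one into the other.\<close>

lemma shift_op_adjoint: "cinner (shift_op a f) g = cinner f (shift_op (- a) g)"
proof (rule l2_cases[of f], rule l2_cases[of g])
  fix u v assume u: "sq_int u" "f = l2_class u" and v: "sq_int v" "g = l2_class v"
  let ?F = "\<lambda>x. zero_ext u (x + a) * cnj (zero_ext v x)"
  have "cinner (shift_op a f) g = (LINT x|lebesgue. ?F x)"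
    unfolding u(2) v(2) shift_op_l2_class[OF u(1)] cinner_l2_class[OF sq_int_translate[OF u(1)] v(1)]
      leb01_integral_zero_ext
    by (intro Bochner_Integration.integral_cong) (auto simp: translate_def zero_ext_def)
  also have "\<dots> = (LINT x|lebesgue. ?F (- a + 1 * x))"
    using lebesgue_integral_real_affine[of 1 ?F "- a"] by simp
  also have "\<dots> = cinner f (shift_op (- a) g)"
    unfolding u(2) v(2) shift_op_l2_class[OF v(1)] cinner_l2_class[OF u(1) sq_int_translate[OF v(1)]]
      leb01_integral_zero_ext
    by (intro Bochner_Integration.integral_cong) (auto simp: translate_def zero_ext_def)
  finally show ?thesis .
qed

lemma norm_shift_op: "norm (shift_op a f) \<le> norm f"
proof (rule l2_cases[of f])
  fix u assume u: "sq_int u" "f = l2_class u"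
  let ?F = "\<lambda>x. (cmod (zero_ext u x))\<^sup>2"
  have F: "integrable lebesgue ?F"
  proof -
    have eq: "?F = (\<lambda>x. indicator {0<..<1} x *\<^sub>R (cmod (u x))\<^sup>2)"
      by (auto simp: fun_eq_iff zero_ext_def)
    show ?thesis
      unfolding eq using u(1) by (subst integrable_restrict_space[symmetric]) (auto simp: sq_int_def)
  qed
  have "(norm (shift_op a f))\<^sup>2 = (LINT x|lebesgue. (if x \<in> {0<..<1} then ?F (x + a) else 0))"
    unfolding u(2) shift_op_l2_class[OF u(1)] norm_l2_class[OF sq_int_translate[OF u(1)]] leb01_integral_zero_ext
      translate_def ..
  also have "\<dots> \<le> (LINT x|lebesgue. ?F (a + 1 * x))"
  proof (rule integral_mono')
    show "integrable lebesgue (\<lambda>x. ?F (a + 1 * x))"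
      by (rule lebesgue_integrable_real_affine[OF F]) simp
  qed (auto simp: add.commute)
  also have "\<dots> = (LINT x|lebesgue. ?F x)"
    using lebesgue_integral_real_affine[of 1 ?F a] by simp
  also have "\<dots> = (norm f)\<^sup>2"
    unfolding u(2) norm_l2_class[OF u(1)] leb01_integral_zero_ext
    by (intro Bochner_Integration.integral_cong) (auto simp: zero_ext_def)
  finally show ?thesis
    by (meson norm_ge_zero power2_le_imp_le)
qed

section \<open>Bounded perturbations of a diagonal operator\<close>

text \<open>The equivalence \<open>A_iff\<close> says at once that \<open>A\<close> acts diagonally and that its domain is the maximal
  one.\<close>

locale diagonal_operator = orthonormal_basis e for e :: "nat \<Rightarrow> l2" +
  fixes a d :: "nat \<Rightarrow> real" and D :: "l2 set" and A :: "l2 \<Rightarrow> l2"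
  assumes A_iff: "w \<in> D \<and> A w = h \<longleftrightarrow> (\<forall>k. cinner h (e k) = of_real (a k) * cinner w (e k))"
    and gap: "j \<noteq> k \<Longrightarrow> d k \<le> \<bar>a j - a k\<bar>"
    and d_pos: "0 < d k"
    and d_summable: "summable (\<lambda>k. (1 / d k)\<^sup>2)"
begin

lemma A_coeff: "w \<in> D \<Longrightarrow> cinner (A w) (e k) = of_real (a k) * cinner w (e k)"
  using A_iff by blast

lemma A_intro:
  "(\<And>k. cinner h (e k) = of_real (a k) * cinner w (e k)) \<Longrightarrow> w \<in> D"
  "(\<And>k. cinner h (e k) = of_real (a k) * cinner w (e k)) \<Longrightarrow> A w = h"
  using A_iff by blast+

lemma A_add: "x \<in> D \<Longrightarrow> y \<in> D \<Longrightarrow> x + y \<in> D" "x \<in> D \<Longrightarrow> y \<in> D \<Longrightarrow> A (x + y) = A x + A y"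
  using A_intro[of "A x + A y" "x + y"] by (simp_all add: cinner_simps A_coeff distrib_left)

lemma A_cscale: "x \<in> D \<Longrightarrow> c *\<^sub>C x \<in> D" "x \<in> D \<Longrightarrow> A (c *\<^sub>C x) = c *\<^sub>C A x"
  using A_intro[of "c *\<^sub>C A x" "c *\<^sub>C x"] by (simp_all add: cinner_simps A_coeff)

lemma zero_in_D: "0 \<in> D"
  using A_intro[of 0 0] by simp

lemma subspace_D: "cvec.subspace D"
  by (simp add: cvec.subspace_def zero_in_D A_add A_cscale)

lemma A_symmetric:
  assumes "x \<in> D" "y \<in> D" shows "cinner (A x) y = cinner x (A y)"
proof (rule sums_unique2)
  show "(\<lambda>k. cinner (cinner (A x) (e k) *\<^sub>C e k) y) sums cinner (A x) y"
    by (intro bounded_linear_sums_cinner expansion)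
  have c: "cinner (e k) (A y) = of_real (a k) * cinner (e k) y" for k
    using A_coeff[OF assms(2), of k] cinner_commute[of "e k"]
    by (metis complex_cnj_complex_of_real complex_cnj_mult)
  have "(\<lambda>k. cinner (cinner x (e k) *\<^sub>C e k) (A y)) sums cinner x (A y)"
    by (intro bounded_linear_sums_cinner expansion)
  then show "(\<lambda>k. cinner (cinner (A x) (e k) *\<^sub>C e k) y) sums cinner x (A y)"
    by (simp add: cinner_simps A_coeff assms c mult_ac)
qed

text \<open>The inverse of \<open>A - a\<^sub>k\<close> on the orthogonal complement of \<open>e\<^sub>k\<close>, extended by 0.\<close>

definition reduced_resolvent :: "nat \<Rightarrow> l2 \<Rightarrow> l2" where
  "reduced_resolvent k = multiplier (\<lambda>j. if j = k then 0 else 1 / of_real (a j - a k))"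

lemma reduced_bound: "cmod (if j = k then 0 else 1 / of_real (a j - a k)) \<le> 1 / d k"
proof (cases "j = k")
  case False
  have "cmod (1 / of_real (a j - a k)) = 1 / \<bar>a j - a k\<bar>"
    by (simp add: norm_divide flip: of_real_diff)
  also have "\<dots> \<le> 1 / d k"
    using gap[OF False] d_pos[of k] by (intro divide_left_mono) (auto intro!: mult_pos_pos)
  finally show ?thesis using False by simp
qed (use d_pos[of k] in simp)

lemma reduced_coeff:
  "cinner (reduced_resolvent k h) (e j) = (if j = k then 0 else cinner h (e j) / of_real (a j - a k))"
  unfolding reduced_resolvent_def by (subst cinner_multiplier[OF reduced_bound]) simp

lemma norm_reduced: "norm (reduced_resolvent k h) \<le> norm h / d k"
  unfolding reduced_resolvent_def
  using norm_multiplier[OF reduced_bound[of _ k], where x = h] by simp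

lemma a_neq: "j \<noteq> k \<Longrightarrow> a j \<noteq> a k"
  using gap[of j k] d_pos[of k] by auto

lemma reduced_diff: "reduced_resolvent k x - reduced_resolvent k y = reduced_resolvent k (x - y)"
  by (rule eq_by_coeffs) (simp add: cinner_simps reduced_coeff diff_divide_distrib)

text \<open>So \<open>x\<close> is close to a multiple of \<open>e\<^sub>k\<close> whenever \<open>(A - a\<^sub>k) x\<close> is small compared with \<open>d\<^sub>k\<close>.\<close>

lemma reduced_A:
  assumes "x \<in> D"
  shows "reduced_resolvent k (A x - of_real (a k) *\<^sub>C x) = x - cinner x (e k) *\<^sub>C e k"
proof (rule eq_by_coeffs)
  fix j show "cinner (reduced_resolvent k (A x - of_real (a k) *\<^sub>C x)) (e j)
      = cinner (x - cinner x (e k) *\<^sub>C e k) (e j)"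
    using a_neq[of j k]
    by (auto simp: reduced_coeff cinner_simps A_coeff assms orthonormal field_simps)
qed

end

locale bounded_perturbation = diagonal_operator e a d D A
  for e a d D A +
  fixes B :: "l2 \<Rightarrow> l2" and C :: real
  assumes B_add: "B (x + y) = B x + B y"
    and B_cscale: "B (c *\<^sub>C x) = c *\<^sub>C B x"
    and B_bound: "norm (B x) \<le> C * norm x"
    and C_pos: "0 < C"
begin

lemma B_diff: "B (x - y) = B x - B y"
  by (metis B_add add_diff_cancel diff_add_cancel)

definition H :: "l2 \<Rightarrow> l2" where "H y = A y + B y"

lemma H_add: "x \<in> D \<Longrightarrow> y \<in> D \<Longrightarrow> H (x + y) = H x + H y"
  by (simp add: H_def A_add B_add)

lemma H_cscale: "x \<in> D \<Longrightarrow> H (c *\<^sub>C x) = c *\<^sub>C H x"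
  by (simp add: H_def A_cscale B_cscale cvec.scale_right_distrib)

text \<open>The point \<open>3 C \<i>\<close> lies in the resolvent set: there \<open>A - z\<close> has an inverse of norm at most
  \<open>1 / (3 C)\<close>, so the resolvent equation becomes a fixed point equation for a contraction.\<close>

definition z0 :: complex where "z0 = \<i> * of_real (3 * C)"

lemma z0_far: "3 * C \<le> cmod (of_real r - z0)"
  using abs_Im_le_cmod[of "of_real r - z0"] C_pos by (simp add: z0_def)

lemma resolvent_ex1: "\<exists>!y. y \<in> D \<and> H y - z0 *\<^sub>C y = h"
proof -
  define G where "G = multiplier (\<lambda>k. 1 / (of_real (a k) - z0))"
  have m: "cmod (1 / (of_real (a k) - z0)) \<le> 1 / (3 * C)" for k
    using frac_le[of 1 1 "3 * C" "cmod (of_real (a k) - z0)"] z0_far[of "a k"] C_pos by (simp add: norm_divide)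
  have nz: "of_real (a k) \<noteq> z0" for k
    using z0_far[of "a k"] C_pos by auto
  have Gc: "cinner (G h) (e k) = cinner h (e k) / (of_real (a k) - z0)" for h k
    unfolding G_def by (subst cinner_multiplier[OF m]) simp
  have Gn: "norm (G h) \<le> norm h / (3 * C)" for h
    using norm_multiplier[OF m, where x = h] by (simp add: G_def)
  have Gd: "G x - G y = G (x - y)" for x y
    by (rule eq_by_coeffs) (simp add: cinner_simps Gc diff_divide_distrib)
  have "y \<in> D \<and> H y - z0 *\<^sub>C y = h \<longleftrightarrow> G (h - B y) = y" for y
  proof -
    have "y \<in> D \<and> H y - z0 *\<^sub>C y = h \<longleftrightarrow> y \<in> D \<and> A y = h - B y + z0 *\<^sub>C y"
      by (auto simp: H_def algebra_simps)
    also have "\<dots> \<longleftrightarrow> (\<forall>k. cinner (G (h - B y)) (e k) = cinner y (e k))"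
      unfolding A_iff using nz by (simp add: Gc cinner_simps field_simps)
    also have "\<dots> \<longleftrightarrow> G (h - B y) = y"
      using eq_by_coeffs by auto
    finally show ?thesis .
  qed
  moreover have "\<exists>!y. G (h - B y) = y"
  proof (rule banach_fix_type)
    show "\<forall>x y. dist (G (h - B x)) (G (h - B y)) \<le> (1/3) * dist x y"
    proof (intro allI)
      fix x y
      have "dist (G (h - B x)) (G (h - B y)) = norm (G (B (y - x)))"
        unfolding dist_norm Gd by (simp add: B_diff)
      also have "\<dots> \<le> norm (B (y - x)) / (3 * C)" by (rule Gn)
      also have "\<dots> \<le> C * norm (y - x) / (3 * C)"
        using C_pos by (intro divide_right_mono B_bound) auto
      finally show "dist (G (h - B x)) (G (h - B y)) \<le> (1/3) * dist x y"
        using C_pos by (simp add: dist_norm norm_minus_commute)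
    qed
  qed auto
  ultimately show ?thesis by simp
qed

text \<open>Lyapunov--Schmidt reduction: with \<open>f = e\<^sub>k + u\<close>, \<open>u\<close> orthogonal to \<open>e\<^sub>k\<close>, the component of
  the eigenvalue equation along \<open>e\<^sub>k\<close> determines the shift \<open>\<mu> = \<langle>B f, e\<^sub>k\<rangle>\<close> of the eigenvalue,
  and the rest is a fixed point equation for \<open>u\<close>, contracting when the gap is large.\<close>

lemma eigenvector_near_basis:
  assumes dk: "8 * C \<le> d k"
  obtains u \<mu> where "cinner u (e k) = 0" "e k + u \<in> D"
    "H (e k + u) = (of_real (a k) + \<mu>) *\<^sub>C (e k + u)" "cmod \<mu> \<le> 2 * C" "norm u \<le> 4 * C / d k"
proof -
  \<comment> \<open>A ball of this radius is mapped into itself, since there \<open>|e\<^sub>k + u| \<le> 2\<close> and \<open>|\<mu>| \<le> 2 C\<close>.\<close>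
  define r where "r = 4 * C / d k"
  have r: "0 < r" "r \<le> 1/2" using C_pos d_pos[of k] dk by (auto simp: r_def divide_le_eq)
  define m where "m u = cinner (B (e k + u)) (e k)" for u
  define w where "w u = m u *\<^sub>C u - B (e k + u)" for u
  define F where "F u = reduced_resolvent k (w u)" for u
  have nf: "norm (B (e k + u)) \<le> 2 * C" if "norm u \<le> r" for u
  proof -
    have "norm (B (e k + u)) \<le> C * norm (e k + u)" by (rule B_bound)
    also have "\<dots> \<le> C * 2"
      using norm_triangle_ineq[of "e k" u] that r C_pos by (intro mult_left_mono) auto
    finally show ?thesis by simp
  qed
  have mb: "cmod (m u) \<le> 2 * C" if "norm u \<le> r" for u
    using order_trans[OF cinner_bound, of "B (e k + u)" "e k"] nf[OF that] by (simp add: m_def)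
  have md: "cmod (m u - m v) \<le> C * norm (u - v)" for u v
  proof -
    have "m u - m v = cinner (B (u - v)) (e k)"
      by (simp add: m_def B_add B_diff cinner_simps)
    then show ?thesis
      using order_trans[OF cinner_bound, of "B (u - v)" "e k"] B_bound[of "u - v"] by simp
  qed
  have "\<exists>!u. u \<in> cball 0 r \<and> F u = u"
  proof (rule Banach_fix[where c = "1/2"])
    show "complete (cball (0::l2) r)" by (simp add: complete_eq_closed)
    show "cball (0::l2) r \<noteq> {}" using r by auto
    show "F ` cball 0 r \<subseteq> cball 0 r"
    proof clarsimp
      fix u :: l2 assume u: "norm u \<le> r"
      have "norm (w u) \<le> cmod (m u) * norm u + norm (B (e k + u))"
        unfolding w_def using norm_triangle_ineq4 by (metis norm_cscale)
      also have "\<dots> \<le> (2 * C) * 1 + 2 * C"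
        using mb[OF u] nf[OF u] u r C_pos by (intro add_mono mult_mono) auto
      finally have "norm (w u) / d k \<le> 4 * C / d k"
        using d_pos[of k] by (intro divide_right_mono) auto
      then show "norm (F u) \<le> r"
        unfolding F_def r_def using norm_reduced order_trans by blast
    qed
    show "dist (F u) (F v) \<le> (1/2) * dist u v" if uv: "u \<in> cball 0 r" "v \<in> cball 0 r" for u v
    proof -
      have "w u - w v = m u *\<^sub>C (u - v) + ((m u - m v) *\<^sub>C v - B (u - v))"
        by (simp add: w_def B_add B_diff cvec.scale_right_diff_distrib cvec.scale_left_diff_distrib)
      then have "norm (w u - w v) \<le> norm (m u *\<^sub>C (u - v)) + (norm ((m u - m v) *\<^sub>C v) + norm (B (u - v)))"
        by (metis add_left_mono norm_triangle_ineq norm_triangle_ineq4 order_trans)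
      also have "\<dots> \<le> (2 * C) * norm (u - v) + ((C * norm (u - v)) * 1 + C * norm (u - v))"
        unfolding norm_cscale using uv r mb[of u] md[of u v] C_pos
        by (intro add_mono mult_mono mult_right_mono B_bound) auto
      finally have "norm (w u - w v) / d k \<le> 4 * C * norm (u - v) / d k"
        using d_pos[of k] by (intro divide_right_mono) auto
      also have "\<dots> = r * norm (u - v)" by (simp add: r_def)
      also have "\<dots> \<le> (1/2) * norm (u - v)" using r by (intro mult_right_mono) auto
      finally show ?thesis
        unfolding dist_norm F_def reduced_diff using norm_reduced order_trans by blast
    qed
  qed auto
  then obtain u where u: "norm u \<le> r" "F u = u" by auto
  have uk: "cinner u (e k) = 0"
    by (subst u(2)[symmetric]) (simp add: F_def reduced_coeff)
  have coeff: "cinner ((of_real (a k) + m u) *\<^sub>C (e k + u) - B (e k + u)) (e j)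
      = of_real (a j) * cinner (e k + u) (e j)" for j
  proof (cases "j = k")
    case True
    then show ?thesis by (simp add: cinner_simps orthonormal uk m_def[symmetric])
  next
    case False
    have "cinner u (e j) = cinner (w u) (e j) / complex_of_real (a j - a k)"
      by (subst u(2)[symmetric]) (simp add: F_def reduced_coeff False)
    moreover have "complex_of_real (a j - a k) \<noteq> 0"
      using a_neq[OF False] by simp
    ultimately have "cinner u (e j) * complex_of_real (a j - a k) = cinner (w u) (e j)"
      by (rule nonzero_eq_divide_eq[THEN iffD1, rotated])
    then have "cinner u (e j) * of_real (a j - a k) = m u * cinner u (e j) - cinner (B (e k + u)) (e j)"
      by (simp only: w_def cinner_simps)
    then show ?thesis
      using False by (simp add: cinner_simps orthonormal algebra_simps)
  qed
  have "e k + u \<in> D" "A (e k + u) = (of_real (a k) + m u) *\<^sub>C (e k + u) - B (e k + u)"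
    using A_intro[OF coeff] by auto
  then show thesis
    using that[of u "m u"] uk mb[OF u(1)] u(1) by (simp add: H_def r_def)
qed

end

locale perturbation_with_adjoint =
  bounded_perturbation e a d D A B C + adj: bounded_perturbation e a d D A B' C
  for e a d D A B B' C +
  assumes adjoint: "cinner (B x) y = cinner x (B' y)"
begin

lemma H_adjoint: "x \<in> D \<Longrightarrow> y \<in> D \<Longrightarrow> cinner (H x) y = cinner x (adj.H y)"
  by (simp add: H_def adj.H_def cinner_simps A_symmetric adjoint)

text \<open>The eigenvector of the adjoint is rescaled to inner product 1 with \<open>f\<close>. This is possible, and costs
  at most a factor 2 in the distance from \<open>e\<^sub>k\<close>, because both eigenvectors differ from \<open>e\<^sub>k\<close> by small
  vectors orthogonal to it. Nonzero inner product also forces the two eigenvalues to be conjugate.\<close>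

lemma eigenpair_near_basis:
  assumes dk: "16 * C \<le> d k"
  obtains f g l where "f \<in> D" "g \<in> D" "H f = l *\<^sub>C f" "adj.H g = cnj l *\<^sub>C g"
    "cmod (l - of_real (a k)) \<le> 2 * C" "cinner f g = 1"
    "norm (f - e k) \<le> 8 * C / d k" "norm (g - e k) \<le> 8 * C / d k"
proof -
  have dk8: "8 * C \<le> d k" using dk C_pos by simp
  obtain u \<mu> where u: "cinner u (e k) = 0" "e k + u \<in> D"
    "H (e k + u) = (of_real (a k) + \<mu>) *\<^sub>C (e k + u)" "cmod \<mu> \<le> 2 * C" "norm u \<le> 4 * C / d k"
    using eigenvector_near_basis[OF dk8] .
  obtain v \<nu> where v: "cinner v (e k) = 0" "e k + v \<in> D"
    "adj.H (e k + v) = (of_real (a k) + \<nu>) *\<^sub>C (e k + v)" "norm v \<le> 4 * C / d k"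
    using adj.eigenvector_near_basis[OF dk8] by metis
  define r where "r = 4 * C / d k"
  have r: "0 < r" "r \<le> 1/4" using C_pos d_pos[of k] dk by (auto simp: r_def divide_le_eq)
  define s where "s = cinner (e k + u) (e k + v)"
  have ev: "cinner (e k) v = 0" using v(1) cinner_commute[of "e k" v] by simp
  have s: "s = 1 + cinner u v"
    by (simp add: s_def cinner_simps orthonormal u(1) ev)
  have uv: "cmod (cinner u v) \<le> r * (1/4)"
    using order_trans[OF cinner_bound mult_mono[of "norm u" r "norm v" "1/4"]] u(5) v(4) r
    by (simp add: r_def)
  have sn: "3/4 \<le> cmod s"
    using norm_triangle_ineq2[of 1 "- cinner u v"] uv r by (simp add: s)
  then have s0: "s \<noteq> 0" by auto
  let ?f = "e k + u" and ?g = "(1 / cnj s) *\<^sub>C (e k + v)" and ?l = "of_real (a k) + \<mu>"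
  have "?l * s = cnj (of_real (a k) + \<nu>) * s"
    using H_adjoint[OF u(2) v(2)] by (simp only: u(3) v(3) cinner_cscale_left cinner_cscale_right s_def)
  then have l: "of_real (a k) + \<nu> = cnj ?l"
    using s0 by (metis complex_cnj_cnj mult_right_cancel)
  show thesis
  proof (rule that[of ?f ?g ?l])
    show "?f \<in> D" "H ?f = ?l *\<^sub>C ?f" by (rule u)+
    show "?g \<in> D" using v by (intro A_cscale)
    show "adj.H ?g = cnj ?l *\<^sub>C ?g"
      by (simp only: adj.H_cscale[OF v(2)] v(3) l cvec.scale_scale mult.commute)
    show "cmod (?l - of_real (a k)) \<le> 2 * C" using u by simp
    show "cinner ?f ?g = 1"
      using s0 by (simp add: cinner_cscale_right s_def)
    show "norm (?f - e k) \<le> 8 * C / d k"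
      using u(5) C_pos d_pos[of k] by (simp add: order_trans[OF u(5)] divide_right_mono)
    have "?g - e k = (1 / cnj s) *\<^sub>C v + (1 / cnj s - 1) *\<^sub>C e k"
      by (simp add: cvec.scale_right_distrib cvec.scale_left_diff_distrib)
    then have "norm (?g - e k) \<le> norm v / cmod s + cmod (1 / cnj s - 1)"
      using norm_triangle_ineq[of "(1 / cnj s) *\<^sub>C v" "(1 / cnj s - 1) *\<^sub>C e k"]
      by (simp add: norm_cscale norm_divide)
    also have "1 / cnj s - 1 = - cnj (cinner u v) / cnj s"
      using s0 by (simp add: field_simps) (simp add: s algebra_simps)
    also have "cmod \<dots> = cmod (cinner u v) / cmod s"
      by (simp add: norm_divide)
    also have "norm v / cmod s + cmod (cinner u v) / cmod s \<le> r / (3/4) + (r * (1/4)) / (3/4)"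
      using sn uv v(4) r by (intro add_mono frac_le) (auto simp: r_def)
    also have "\<dots> \<le> 8 * C / d k"
      using r by (simp add: r_def field_simps)
    finally show "norm (?g - e k) \<le> 8 * C / d k" by simp
  qed
qed

end

section \<open>Root vectors in finite-dimensional invariant subspaces\<close>

lemma cvec_independent_image:
  assumes add: "\<And>x y. f (x + y) = f x + f y" and scale: "\<And>c x. f (c *\<^sub>C x) = c *\<^sub>C f x"
    and "cvec.independent S" "inj_on f (cvec.span S)"
  shows "cvec.independent (f ` S)"
proof -
  interpret module_hom cscale cscale f
    by unfold_locales (auto simp: add scale)
  show ?thesis by (rule independent_injective_image[OF assms(3,4)])
qed

text \<open>An injective linear map into a finite-dimensional space maps independent sets to independent sets, so
  its source is finite-dimensional.\<close>

lemma finite_dim_subspace: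
  assumes M: "cvec.subspace M" and F: "finite F"
    and add: "\<And>x y. f (x + y) = f x + f y" and scale: "\<And>c x. f (c *\<^sub>C x) = c *\<^sub>C f x"
    and fM: "\<And>x. x \<in> M \<Longrightarrow> f x \<in> cvec.span F" and inj: "\<And>x. x \<in> M \<Longrightarrow> f x = 0 \<Longrightarrow> x = 0"
  obtains T where "finite T" "cvec.independent T" "cvec.span T = M"
proof -
  obtain T where T: "T \<subseteq> M" "cvec.independent T" "M \<subseteq> cvec.span T"
    by (rule cvec.maximal_independent_subset)
  have sp: "cvec.span T = M"
    using T cvec.span_minimal[OF T(1) M] by blast
  have injM: "inj_on f M"
  proof (rule inj_onI)
    fix x y assume xy: "x \<in> M" "y \<in> M" "f x = f y"
    have "f (x - y) = f x + f ((-1) *\<^sub>C y)"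
      using add[of x "(-1) *\<^sub>C y"] by simp
    also have "\<dots> = 0" by (simp only: scale xy(3)) simp
    finally have "x - y = 0"
      using inj[of "x - y"] cvec.subspace_diff[OF M xy(1,2)] by simp
    then show "x = y" by simp
  qed
  have "cvec.independent (f ` T)"
    using cvec_independent_image[OF add scale T(2)] injM sp by simp
  then have "finite (f ` T)"
    using cvec.independent_span_bound[OF F, of "f ` T"] fM T(1) by blast
  then have "finite T"
    using finite_imageD inj_on_subset[OF injM T(1)] by blast
  then show thesis using that T(2) sp by blast
qed

text \<open>A vector outside the span of the image would extend the image of a basis to an independent set
  with too many elements.\<close>

lemma finite_dim_injective_surj:
  assumes T: "finite T" "cvec.independent T"
    and add: "\<And>x y. f (x + y) = f x + f y" and scale: "\<And>c x. f (c *\<^sub>C x) = c *\<^sub>C f x"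
    and inj: "inj_on f (cvec.span T)" and into: "f ` T \<subseteq> cvec.span T"
  shows "cvec.span T \<subseteq> cvec.span (f ` T)"
proof
  fix x assume x: "x \<in> cvec.span T"
  have ind: "cvec.independent (f ` T)"
    by (rule cvec_independent_image[OF add scale T(2) inj])
  show "x \<in> cvec.span (f ` T)"
  proof (rule ccontr)
    assume nx: "x \<notin> cvec.span (f ` T)"
    then have "x \<notin> f ` T" using cvec.span_base by blast
    have "cvec.independent (insert x (f ` T))"
      using ind nx by (simp add: cvec.independent_insert)
    then have "card (insert x (f ` T)) \<le> card T"
      using cvec.independent_span_bound[OF T(1), of "insert x (f ` T)"] x into by auto
    moreover have "card (f ` T) = card T"
      using inj_on_subset[OF inj cvec.span_superset] by (rule card_image)
    ultimately show False
      using \<open>x \<notin> f ` T\<close> T(1) by simp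
  qed
qed

lemma ker_pow_mono: "M \<subseteq> D \<Longrightarrow> ker_pow M H z n \<subseteq> ker_pow D H z n"
  by (induction n) auto

text \<open>Linearity is required on \<open>M\<close> only, as an unbounded operator is linear only on its domain.\<close>

locale invariant_subspace =
  fixes M :: "l2 set" and H :: "l2 \<Rightarrow> l2"
  assumes subspace_M: "cvec.subspace M"
    and invariant: "x \<in> M \<Longrightarrow> H x \<in> M"
    and H_add_M: "x \<in> M \<Longrightarrow> y \<in> M \<Longrightarrow> H (x + y) = H x + H y"
    and H_cscale_M: "x \<in> M \<Longrightarrow> H (c *\<^sub>C x) = c *\<^sub>C H x"
begin

lemma M_closed: "0 \<in> M" "x \<in> M \<Longrightarrow> y \<in> M \<Longrightarrow> x + y \<in> M" "x \<in> M \<Longrightarrow> c *\<^sub>C x \<in> M"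
  "x \<in> M \<Longrightarrow> y \<in> M \<Longrightarrow> x - y \<in> M"
  using subspace_M cvec.subspace_diff by (auto simp: cvec.subspace_def)

lemma H_zero_M: "H 0 = 0"
  using H_cscale_M[OF M_closed(1), of 0] by simp

lemma H_diff_M: "x \<in> M \<Longrightarrow> y \<in> M \<Longrightarrow> H (x - y) = H x - H y"
  by (metis H_add_M M_closed(4) add_diff_cancel_right' diff_add_cancel)

definition L :: "complex \<Rightarrow> l2 \<Rightarrow> l2" where "L z x = H x - z *\<^sub>C x"

lemma L_M: "x \<in> M \<Longrightarrow> L z x \<in> M"
  by (simp add: L_def M_closed invariant)

lemma L_add: "x \<in> M \<Longrightarrow> y \<in> M \<Longrightarrow> L z (x + y) = L z x + L z y"
  by (simp add: L_def H_add_M cvec.scale_right_distrib)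

lemma L_diff: "x \<in> M \<Longrightarrow> y \<in> M \<Longrightarrow> L z (x - y) = L z x - L z y"
  by (simp add: L_def H_diff_M cvec.scale_right_diff_distrib)

lemma L_cscale: "x \<in> M \<Longrightarrow> L z (c *\<^sub>C x) = c *\<^sub>C L z x"
  by (simp add: L_def H_cscale_M cvec.scale_right_diff_distrib mult.commute)

lemma L_zero: "L z 0 = 0"
  by (simp add: L_def H_zero_M)

abbreviation K :: "complex \<Rightarrow> nat \<Rightarrow> l2 set" where "K z n \<equiv> ker_pow M H z n"

lemma K_Suc: "y \<in> K z (Suc n) \<longleftrightarrow> y \<in> M \<and> L z y \<in> K z n"
  by (simp add: L_def)

lemma K_subset: "K z n \<subseteq> M"
  by (cases n) (auto simp: M_closed)

lemma zero_in_K: "0 \<in> K z n"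
  by (induction n) (auto simp: M_closed H_zero_M)

lemma K_add: "x \<in> K z n \<Longrightarrow> y \<in> K z n \<Longrightarrow> x + y \<in> K z n"
  by (induction n arbitrary: x y) (simp, simp only: K_Suc L_add M_closed simp_thms)

lemma K_cscale: "x \<in> K z n \<Longrightarrow> c *\<^sub>C x \<in> K z n"
  by (induction n arbitrary: x) (simp, simp only: K_Suc L_cscale M_closed simp_thms)

lemma K_mono: assumes "n \<le> m" shows "K z n \<subseteq> K z m"
  using assms
proof (induction n arbitrary: m)
  case 0
  then show ?case using zero_in_K by auto
next
  case (Suc n)
  then obtain m' where m: "m = Suc m'" "n \<le> m'" by (cases m) auto
  then show ?case using Suc.IH[OF m(2)] unfolding m(1) K_Suc subset_iff by blast
qed

text \<open>On the generalized eigenspace of \<open>w\<close>, \<open>H - z\<close> is the nonzero scalar \<open>w - z\<close> plus a nilpotent.\<close>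

lemma L_onto_K:
  assumes "w \<noteq> z" "y \<in> K w n" shows "\<exists>x\<in>K w n. L z x = y"
  using assms(2)
proof (induction n arbitrary: y)
  case 0
  then show ?case by (simp add: L_zero)
next
  case (Suc n)
  then have y: "y \<in> M" "L w y \<in> K w n" unfolding K_Suc by auto
  then obtain x' where x': "x' \<in> K w n" "L z x' = L w y" using Suc.IH by blast
  define x where "x = (1 / (w - z)) *\<^sub>C (y - x')"
  have x'M: "x' \<in> M" using x' K_subset by blast
  have x'S: "x' \<in> K w (Suc n)" using x'(1) K_mono[of n "Suc n" w] by auto
  have "y - x' \<in> K w (Suc n)"
    using K_add[OF Suc.prems K_cscale[OF x'S, of "-1"]]
    by (simp only: cvec.scale_minus_left cvec.scale_one add_uminus_conv_diff)
  then have "x \<in> K w (Suc n)"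
    unfolding x_def by (rule K_cscale)
  moreover have "L z x = y"
  proof -
    have "L z x = (1 / (w - z)) *\<^sub>C (L z y - L w y)"
      unfolding x_def using y(1) x'M x'(2) by (simp add: L_cscale L_diff M_closed)
    also have "L z y - L w y = (w - z) *\<^sub>C y"
      by (simp add: L_def cvec.scale_left_diff_distrib)
    finally show ?thesis using assms(1) by simp
  qed
  ultimately show ?case by blast
qed

abbreviation roots :: "l2 set" where "roots \<equiv> (\<Union>z n. K z n)"

lemma span_roots_subset: "cvec.span roots \<subseteq> M"
  using K_subset by (intro cvec.span_minimal subspace_M) blast

text \<open>Split \<open>(H - z) x\<close> into root vectors. The components with eigenvalues other than \<open>z\<close> have preimages
  of the same kind under \<open>H - z\<close>. Once these are subtracted from \<open>x\<close>, what remains is mapped to a root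
  vector for \<open>z\<close> by \<open>H - z\<close>, and so is one itself.\<close>

lemma span_roots_L:
  assumes x: "x \<in> M" and Lx: "L z x \<in> cvec.span roots" shows "x \<in> cvec.span roots"
proof -
  have "\<exists>v\<in>cvec.span roots. \<exists>n. \<exists>k\<in>K z n. L z v = y - k" if "y \<in> cvec.span roots" for y
    using that
  proof (induction rule: cvec.span_induct_alt)
    case base
    show ?case
      by (intro bexI[of _ 0] exI[of _ 0]) (auto simp: L_zero cvec.span_zero)
  next
    case (step c b y)
    then obtain v n k where v: "v \<in> cvec.span roots" "k \<in> K z n" "L z v = y - k" by blast
    have vM: "v \<in> M" using v(1) span_roots_subset by blast
    obtain w m where b: "b \<in> K w m" using step by blast
    show ?case
    proof (cases "w = z")
      case True
      have "c *\<^sub>C b + k \<in> K z (max n m)"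
        using b v(2) K_mono[of m "max n m" z] K_mono[of n "max n m" z] True
        by (intro K_add K_cscale) auto
      moreover have "L z v = c *\<^sub>C b + y - (c *\<^sub>C b + k)" using v(3) by simp
      ultimately show ?thesis using v(1) by blast
    next
      case False
      then obtain b' where b': "b' \<in> K w m" "L z b' = b" using L_onto_K b by blast
      then have b'M: "b' \<in> M" using K_subset by blast
      have "b' \<in> roots" using b'(1) by blast
      then have "c *\<^sub>C b' + v \<in> cvec.span roots"
        by (rule cvec.span_add[OF cvec.span_scale[OF cvec.span_base] v(1)])
      moreover have "L z (c *\<^sub>C b' + v) = c *\<^sub>C b + y - k"
        using v(3) b'(2) vM b'M by (simp add: L_add L_cscale M_closed)
      ultimately show ?thesis using v(2) by blast
    qed
  qed
  then obtain v n k where v: "v \<in> cvec.span roots" "k \<in> K z n" "L z v = L z x - k"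
    using Lx by blast
  have vM: "v \<in> M" using v(1) span_roots_subset by blast
  have "x - v \<in> K z (Suc n)"
    unfolding K_Suc using x vM v by (simp add: L_diff M_closed)
  then have "x - v \<in> roots" by blast
  then have "x - v + v \<in> cvec.span roots"
    by (rule cvec.span_add[OF cvec.span_base v(1)])
  then show ?thesis by simp
qed

definition poly_op :: "complex poly \<Rightarrow> l2 \<Rightarrow> l2" where
  "poly_op p x = (\<Sum>i\<le>degree p. coeff p i *\<^sub>C (H ^^ i) x)"

lemma poly_op_eq:
  assumes "degree p \<le> n" shows "poly_op p x = (\<Sum>i\<le>n. coeff p i *\<^sub>C (H ^^ i) x)"
  unfolding poly_op_def using assms
  by (intro sum.mono_neutral_left) (auto simp: coeff_eq_0)

lemma poly_op_add: "poly_op (p + q) x = poly_op p x + poly_op q x"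
  using poly_op_eq[of p "max (degree p) (degree q)" x] poly_op_eq[of q "max (degree p) (degree q)" x]
    poly_op_eq[OF degree_add_le_max, of p q x]
  by (simp add: cvec.scale_left_distrib sum.distrib)

lemma poly_op_smult: "poly_op (smult c p) x = c *\<^sub>C poly_op p x"
  using poly_op_eq[OF degree_smult_le, of c p x]
  by (simp add: poly_op_def[of p] cvec.scale_sum_right)

lemma poly_op_pCons: "poly_op (pCons c p) x = c *\<^sub>C x + poly_op p (H x)"
proof -
  have "poly_op (pCons c p) x = (\<Sum>i\<le>Suc (degree p). coeff (pCons c p) i *\<^sub>C (H ^^ i) x)"
    by (rule poly_op_eq) (rule degree_pCons_le)
  also have "\<dots> = coeff (pCons c p) 0 *\<^sub>C (H ^^ 0) x
      + (\<Sum>i\<le>degree p. coeff (pCons c p) (Suc i) *\<^sub>C (H ^^ Suc i) x)"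
    by (rule sum.atMost_Suc_shift)
  also have "\<dots> = c *\<^sub>C x + poly_op p (H x)"
    by (simp only: coeff_pCons_0 coeff_pCons_Suc funpow_Suc_right o_apply funpow_0 poly_op_def)
  finally show ?thesis .
qed

lemma funpow_H:
  assumes "x \<in> M" "y \<in> M"
  shows "(H ^^ i) x \<in> M" "(H ^^ i) (x - c *\<^sub>C y) = (H ^^ i) x - c *\<^sub>C (H ^^ i) y"
proof -
  have *: "(H ^^ i) x \<in> M" if "x \<in> M" for x i
    using that by (induction i) (auto simp: invariant)
  then show "(H ^^ i) x \<in> M" using assms by blast
  show "(H ^^ i) (x - c *\<^sub>C y) = (H ^^ i) x - c *\<^sub>C (H ^^ i) y"
    by (induction i) (simp_all add: assms * M_closed H_diff_M H_cscale_M)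
qed

lemma poly_op_L:
  assumes "x \<in> M" shows "poly_op ([:-z, 1:] * q) x = poly_op q (L z x)"
proof -
  have "[:-z, 1:] * q = smult (-z) q + pCons 0 q" by simp
  then have "poly_op ([:-z, 1:] * q) x = (-z) *\<^sub>C poly_op q x + poly_op q (H x)"
    by (simp only: poly_op_add poly_op_smult poly_op_pCons) simp
  also have "\<dots> = poly_op q (L z x)"
    by (simp add: poly_op_def L_def funpow_H(2)[OF invariant[OF assms] assms]
        cvec.scale_right_diff_distrib sum_subtractf sum_negf cvec.scale_sum_right mult.commute)
  finally show ?thesis .
qed

text \<open>Split off one linear factor \<open>X - z\<close> of the polynomial at a time; \<open>span_roots_L\<close> undoes each step.\<close>

lemma annihilated_in_span_roots:
  assumes "p \<noteq> 0" "x \<in> M" "poly_op p x = 0" shows "x \<in> cvec.span roots"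
  using assms
proof (induction "degree p" arbitrary: p x)
  case 0
  then obtain c where p: "p = [:c:]" by (metis degree_eq_zeroE)
  then have "c *\<^sub>C x = 0" "c \<noteq> 0" using 0 by (auto simp: poly_op_def)
  then have "x = 0" by simp
  then show ?case by (simp add: cvec.span_zero)
next
  case (Suc n)
  have "\<not> constant (poly p)"
    using Suc(2) by (simp add: constant_degree)
  then obtain z where "poly p z = 0" using fundamental_theorem_of_algebra by blast
  then obtain q where q: "p = [:-z, 1:] * q" by (auto simp: poly_eq_0_iff_dvd)
  then have q0: "q \<noteq> 0" using Suc.prems by auto
  have "degree p = degree [:-z, 1:] + degree q"
    unfolding q by (rule degree_mult_eq) (use q0 in auto)
  then have "n = degree q" using Suc(2) by simp
  moreover have "poly_op q (L z x) = 0"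
    using Suc.prems poly_op_L q by simp
  ultimately have "L z x \<in> cvec.span roots"
    using Suc(1) q0 L_M Suc.prems by blast
  then show ?case using span_roots_L Suc.prems by blast
qed

text \<open>In finite dimension the iterates of a vector are dependent, so a polynomial in \<open>H\<close>
  annihilates it.\<close>

lemma annihilating_poly:
  assumes F: "finite F" "M \<subseteq> cvec.span F" and x: "x \<in> M"
  shows "\<exists>p. p \<noteq> 0 \<and> poly_op p x = 0"
proof -
  define n where "n = card F"
  have "\<exists>c. (\<exists>i\<le>n. c i \<noteq> 0) \<and> (\<Sum>i\<le>n. c i *\<^sub>C (H ^^ i) x) = 0"
  proof (cases "inj_on (\<lambda>i. (H ^^ i) x) {..n}")
    case True
    let ?S = "(\<lambda>i. (H ^^ i) x) ` {..n}"
    have "card ?S = Suc n" using card_image[OF True] by simp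
    moreover have "?S \<subseteq> cvec.span F" using F(2) funpow_H(1)[OF x x] by auto
    ultimately have "cvec.dependent ?S"
      using cvec.independent_span_bound[OF F(1), of ?S] by (auto simp: n_def)
    then obtain u where u: "\<exists>v\<in>?S. u v \<noteq> 0" "(\<Sum>v\<in>?S. u v *\<^sub>C v) = 0"
      using cvec.dependent_finite[of ?S] by auto
    show ?thesis
      using u sum.reindex[OF True, of "\<lambda>v. u v *\<^sub>C v"]
      by (intro exI[of _ "\<lambda>i. u ((H ^^ i) x)"]) auto
  next
    case False
    then obtain i j where ij: "i \<le> n" "j \<le> n" "i \<noteq> j" "(H ^^ i) x = (H ^^ j) x"
      by (auto simp: inj_on_def)
    define c :: "nat \<Rightarrow> complex" where "c k = (if k = i then 1 else 0) - (if k = j then 1 else 0)" for k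
    have "(\<Sum>k\<le>n. c k *\<^sub>C (H ^^ k) x)
        = (\<Sum>k\<le>n. (if k = i then (H ^^ k) x else 0) - (if k = j then (H ^^ k) x else 0))"
      by (intro sum.cong) (auto simp: c_def)
    also have "\<dots> = 0"
      using ij by (simp add: sum_subtractf)
    finally show ?thesis
      using ij by (intro exI[of _ c]) (auto simp: c_def intro!: exI[of _ i])
  qed
  then obtain c where c: "\<exists>i\<le>n. c i \<noteq> 0" "(\<Sum>i\<le>n. c i *\<^sub>C (H ^^ i) x) = 0" by blast
  define p where "p = (\<Sum>i\<le>n. monom (c i) i)"
  have co: "coeff p i = (if i \<le> n then c i else 0)" for i
    by (simp add: p_def coeff_sum)
  have "degree p \<le> n" by (rule degree_le) (simp add: co)
  from poly_op_eq[OF this, of x] have "poly_op p x = (\<Sum>i\<le>n. c i *\<^sub>C (H ^^ i) x)"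
    by (simp add: co)
  then have "poly_op p x = 0"
    using c(2) by simp
  moreover have "p \<noteq> 0"
  proof
    assume "p = 0"
    then have "(if i \<le> n then c i else 0) = 0" for i using co[of i] by simp
    then show False using c(1) by metis
  qed
  ultimately show ?thesis by blast
qed

lemma span_roots:
  assumes "finite F" "M \<subseteq> cvec.span F" shows "cvec.span roots = M"
proof (intro equalityI span_roots_subset subsetI)
  fix x assume x: "x \<in> M"
  then obtain p where "p \<noteq> 0" "poly_op p x = 0"
    using annihilating_poly[OF assms] by blast
  then show "x \<in> cvec.span roots"
    using x by (intro annihilated_in_span_roots)
qed

end

section \<open>Systems of projections\<close>

text \<open>The partial sums show completeness. For minimality, \<open>P k\<close> is continuous and vanishes on the other
  ranges, hence on their closed span, while it is the identity on its own range.\<close>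

lemma complete_minimal_system:
  fixes P :: "nat \<Rightarrow> l2 \<Rightarrow>\<^sub>L l2"
  assumes proj: "\<And>k. projection (P k)" and disj: "\<And>k m. k \<noteq> m \<Longrightarrow> P k o\<^sub>L P m = 0"
    and nz: "\<And>k. P k \<noteq> 0" and sums: "\<And>x. (\<lambda>k. P k x) sums x"
  shows "complete_system P" "minimal_system P"
proof -
  show "complete_system P"
    unfolding complete_system_def
  proof (intro equalityI subset_UNIV subsetI)
    fix x
    have "(\<Sum>k<n. P k x) \<in> cvec.span (\<Union>k. range (P k))" for n
      by (intro cvec.span_sum cvec.span_base) auto
    moreover have "(\<lambda>n. \<Sum>k<n. P k x) \<longlonglongrightarrow> x"
      using sums[of x] by (simp add: sums_def)
    ultimately show "x \<in> closure (cvec.span (\<Union>k. range (P k)))"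
      unfolding closure_sequential by (intro exI[of _ "\<lambda>n. \<Sum>k<n. P k x"]) simp
  qed
  show "minimal_system P"
    unfolding minimal_system_def
  proof (intro allI conjI nz)
    fix k
    let ?S = "cvec.span (\<Union>m\<in>-{k}. range (P m))"
    have sub: "cvec.subspace {x. P k x = 0}"
      using proj[of k] by (auto simp: cvec.subspace_def projection_def blinfun.add_right)
    have "P k (P m x) = 0" if "m \<noteq> k" for m x
      using disj[of k m] that by (metis blinfun_apply_blinfun_compose zero_blinfun.rep_eq)
    then have "?S \<subseteq> {x. P k x = 0}"
      by (intro cvec.span_minimal sub) auto
    moreover have "closed {x. P k x = 0}"
      by (intro closed_Collect_eq continuous_intros)
    ultimately have *: "closure ?S \<subseteq> {x. P k x = 0}"
      by (rule closure_minimal)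
    show "range (P k) \<inter> closure ?S = {0}"
    proof (intro equalityI subsetI)
      fix x assume x: "x \<in> range (P k) \<inter> closure ?S"
      then obtain y where "x = P k y" by auto
      then have "P k x = x"
        using proj[of k] by (metis blinfun_apply_blinfun_compose projection_def)
      then show "x \<in> {0}" using x * by auto
    next
      fix x :: l2 assume "x \<in> {0}"
      moreover have "0 \<in> ?S" by (rule cvec.span_zero)
      moreover have "0 \<in> range (P k)" by (metis blinfun.zero_right rangeI)
      ultimately show "x \<in> range (P k) \<inter> closure ?S"
        using closure_subset[of ?S] by auto
    qed
  qed
qed

definition rank_one :: "l2 \<Rightarrow> l2 \<Rightarrow> l2 \<Rightarrow>\<^sub>L l2" where
  "rank_one f g = Blinfun (\<lambda>x. cinner x g *\<^sub>C f)"

lemma rank_one_apply: "rank_one f g x = cinner x g *\<^sub>C f"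
proof -
  have "bounded_linear (\<lambda>x. cinner x g *\<^sub>C f)"
  proof (rule bounded_linear_intro[where K = "norm g * norm f"])
    show "norm (cinner x g *\<^sub>C f) \<le> norm x * (norm g * norm f)" for x
      using mult_right_mono[OF cinner_bound norm_ge_zero[of f], of x g]
      by (simp add: norm_cscale mult.assoc)
  qed (simp_all add: cinner_simps scaleR_cscale cvec.scale_left_distrib)
  then show ?thesis by (simp add: rank_one_def bounded_linear_Blinfun_apply)
qed

lemma projection_rank_one: "cinner f g = 1 \<Longrightarrow> projection (rank_one f g)"
  by (auto simp: projection_def rank_one_apply cinner_simps intro!: blinfun_eqI)

lemma range_rank_one:
  assumes "cinner f g = 1" shows "range (rank_one f g) = cvec.span {f}"
proof -
  have "c *\<^sub>C f \<in> range (rank_one f g)" for c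
    using assms by (intro range_eqI[of _ _ "c *\<^sub>C f"]) (simp add: rank_one_apply cinner_simps)
  then show ?thesis
    by (auto simp: cvec.span_singleton rank_one_apply)
qed

text \<open>This estimate turns closeness of eigenvectors into closeness of projections.\<close>

lemma norm_rank_one_diff:
  assumes "norm e = 1"
  shows "norm (rank_one f g - rank_one e e) \<le> norm (g - e) * norm f + norm (f - e)"
proof (rule norm_blinfun_bound)
  fix x
  have "blinfun_apply (rank_one f g - rank_one e e) x = cinner x (g - e) *\<^sub>C f + cinner x e *\<^sub>C (f - e)"
    by (simp add: blinfun.diff_left rank_one_apply cinner_simps cvec.scale_left_diff_distrib
        cvec.scale_right_diff_distrib)
  also have "norm \<dots> \<le> cmod (cinner x (g - e)) * norm f + cmod (cinner x e) * norm (f - e)"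
    using norm_triangle_ineq by (metis norm_cscale)
  also have "\<dots> \<le> (norm x * norm (g - e)) * norm f + (norm x * 1) * norm (f - e)"
    using cinner_bound[of x e] assms by (intro add_mono mult_right_mono cinner_bound) auto
  finally show "norm (blinfun_apply (rank_one f g - rank_one e e) x)
      \<le> (norm (g - e) * norm f + norm (f - e)) * norm x"
    by (simp add: algebra_simps)
qed simp

section \<open>Series with square summable coefficients\<close>

lemma series_cauchy_schwarz:
  fixes a b :: "nat \<Rightarrow> real"
  assumes a: "summable (\<lambda>k. (a k)\<^sup>2)" and b: "summable (\<lambda>k. (b k)\<^sup>2)"
    and a0: "\<And>k. 0 \<le> a k" and b0: "\<And>k. 0 \<le> b k"
  shows "summable (\<lambda>k. a k * b k)"
    "(\<Sum>k. a k * b k) \<le> sqrt ((\<Sum>k. (a k)\<^sup>2) * (\<Sum>k. (b k)\<^sup>2))"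
proof -
  have fin: "(\<Sum>k\<in>F. a k * b k) \<le> sqrt ((\<Sum>k. (a k)\<^sup>2) * (\<Sum>k. (b k)\<^sup>2))" if "finite F" for F
  proof (rule real_le_rsqrt)
    have "(\<Sum>k\<in>F. a k * b k)\<^sup>2 \<le> (\<Sum>k\<in>F. (a k)\<^sup>2) * (\<Sum>k\<in>F. (b k)\<^sup>2)"
      by (rule Cauchy_Schwarz_ineq_sum)
    also have "\<dots> \<le> (\<Sum>k. (a k)\<^sup>2) * (\<Sum>k. (b k)\<^sup>2)"
      using that by (intro mult_mono sum_le_suminf a b suminf_nonneg) (auto intro: sum_nonneg)
    finally show "(\<Sum>k\<in>F. a k * b k)\<^sup>2 \<le> (\<Sum>k. (a k)\<^sup>2) * (\<Sum>k. (b k)\<^sup>2)" .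
  qed
  show s: "summable (\<lambda>k. a k * b k)"
    by (rule summableI_nonneg_bounded[OF _ fin]) (auto simp: a0 b0)
  show "(\<Sum>k. a k * b k) \<le> sqrt ((\<Sum>k. (a k)\<^sup>2) * (\<Sum>k. (b k)\<^sup>2))"
    by (rule suminf_le_const[OF s]) (simp add: fin)
qed

lemma weighted_series:
  assumes c: "summable (\<lambda>k. (cmod (c k))\<^sup>2)" and w: "\<And>k. norm (w k :: l2) \<le> \<rho> k"
    and \<rho>: "summable (\<lambda>k. (\<rho> k)\<^sup>2)"
  shows "summable (\<lambda>k. c k *\<^sub>C w k)"
    "(norm (\<Sum>k. c k *\<^sub>C w k))\<^sup>2 \<le> (\<Sum>k. (cmod (c k))\<^sup>2) * (\<Sum>k. (\<rho> k)\<^sup>2)"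
proof -
  have \<rho>0: "0 \<le> \<rho> k" for k using order_trans[OF norm_ge_zero w] .
  note cs = series_cauchy_schwarz[OF c \<rho> norm_ge_zero \<rho>0]
  have le: "norm (c k *\<^sub>C w k) \<le> cmod (c k) * \<rho> k" for k
    by (simp add: norm_cscale mult_left_mono w)
  have sn: "summable (\<lambda>k. norm (c k *\<^sub>C w k))"
    by (rule summable_comparison_test'[OF cs(1), of 0]) (simp add: le)
  then show "summable (\<lambda>k. c k *\<^sub>C w k)" by (rule summable_norm_cancel)
  have "norm (\<Sum>k. c k *\<^sub>C w k) \<le> (\<Sum>k. norm (c k *\<^sub>C w k))"
    by (rule summable_norm[OF sn])
  also have "\<dots> \<le> (\<Sum>k. cmod (c k) * \<rho> k)"
    by (rule suminf_le[OF le sn cs(1)])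
  also note cs(2)
  finally show "(norm (\<Sum>k. c k *\<^sub>C w k))\<^sup>2 \<le> (\<Sum>k. (cmod (c k))\<^sup>2) * (\<Sum>k. (\<rho> k)\<^sup>2)"
    by (metis norm_ge_zero real_sqrt_le_iff real_sqrt_abs abs_of_nonneg)
qed

lemma (in orthonormal_basis) norm_suminf_basis:
  assumes "summable (\<lambda>k. (cmod (c k))\<^sup>2)"
  shows "(norm (\<Sum>k. c k *\<^sub>C e k))\<^sup>2 = (\<Sum>k. (cmod (c k))\<^sup>2)"
  by (simp add: parseval_suminf cinner_suminf_basis assms)

section \<open>Separating the large eigenvalues\<close>

text \<open>The eigenpairs of \<open>eigenpair_near_basis\<close> are chosen for all indices from \<open>N\<close> on. By \<open>small\<close>, the
  squared distances from the basis sum to less than 1 in each of the two families.\<close>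

locale separated_system = perturbation_with_adjoint e a d D A B B' C
  for e a d D A B B' C +
  fixes N :: nat and f g :: "nat \<Rightarrow> l2" and l :: "nat \<Rightarrow> complex"
  assumes N_pos: "0 < N"
    and large: "N \<le> k \<Longrightarrow> 16 * C \<le> d k"
    and f_D: "N \<le> k \<Longrightarrow> f k \<in> D" and g_D: "N \<le> k \<Longrightarrow> g k \<in> D"
    and H_f: "N \<le> k \<Longrightarrow> H (f k) = l k *\<^sub>C f k"
    and H_g: "N \<le> k \<Longrightarrow> adj.H (g k) = cnj (l k) *\<^sub>C g k"
    and l_near: "N \<le> k \<Longrightarrow> cmod (l k - of_real (a k)) \<le> 2 * C"
    and fg_one: "N \<le> k \<Longrightarrow> cinner (f k) (g k) = 1"
    and f_near: "N \<le> k \<Longrightarrow> norm (f k - e k) \<le> 8 * C / d k"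
    and g_near: "N \<le> k \<Longrightarrow> norm (g k - e k) \<le> 8 * C / d k"
    and small: "(\<Sum>k. (if k < N then 0 else 8 * C / d k)\<^sup>2) < 1"
begin

definition \<rho> :: "nat \<Rightarrow> real" where "\<rho> k = (if k < N then 0 else 8 * C / d k)"

lemma \<rho>_summable: "summable (\<lambda>k. (\<rho> k)\<^sup>2)"
proof (rule summable_comparison_test'[where N = 0])
  show "summable (\<lambda>k. (8 * C)\<^sup>2 * (1 / d k)\<^sup>2)"
    by (intro summable_mult d_summable)
  show "norm ((\<rho> k)\<^sup>2) \<le> (8 * C)\<^sup>2 * (1 / d k)\<^sup>2" for k
    by (simp add: \<rho>_def power_divide power_mult_distrib)
qed

lemma \<rho>_small: "(\<Sum>k. (\<rho> k)\<^sup>2) < 1"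
  using small by (simp add: \<rho>_def)

lemma \<rho>_half: "\<rho> k \<le> 1/2"
  using large[of k] d_pos[of k] C_pos by (auto simp: \<rho>_def divide_le_eq)

lemma f_near': "N \<le> k \<Longrightarrow> norm (f k - e k) \<le> \<rho> k" and g_near': "N \<le> k \<Longrightarrow> norm (g k - e k) \<le> \<rho> k"
  using f_near g_near by (simp_all add: \<rho>_def)

text \<open>The eigenvalues lie in disjoint discs, of radius \<open>2 C\<close> around points at distance at least \<open>16 C\<close>.\<close>

lemma l_distinct: "N \<le> j \<Longrightarrow> N \<le> k \<Longrightarrow> j \<noteq> k \<Longrightarrow> l j \<noteq> l k"
proof
  assume jk: "N \<le> j" "N \<le> k" "j \<noteq> k" "l j = l k"
  have "\<bar>a j - a k\<bar> = cmod ((l k - of_real (a k)) - (l j - of_real (a j)))"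
    by (simp add: jk(4) flip: of_real_diff)
  also have "\<dots> \<le> 2 * C + 2 * C"
    using norm_triangle_ineq4 l_near[OF jk(1)] l_near[OF jk(2)] by (meson add_mono order_trans)
  finally show False
    using gap[OF jk(3)] large[OF jk(2)] C_pos by simp
qed

lemma cinner_H_g: "x \<in> D \<Longrightarrow> N \<le> k \<Longrightarrow> cinner (H x) (g k) = l k * cinner x (g k)"
  by (simp add: H_adjoint g_D H_g cinner_simps)

lemma biorthogonal: "N \<le> j \<Longrightarrow> N \<le> k \<Longrightarrow> cinner (f j) (g k) = (if j = k then 1 else 0)"
  using cinner_H_g[of "f j" k] l_distinct[of j k] by (auto simp: f_D H_f cinner_simps fg_one)

text \<open>The spectral subspace for the low eigenvalues, described without reference to them.\<close>

definition M :: "l2 set" where "M = {x. \<forall>k\<ge>N. cinner x (g k) = 0}"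

lemma subspace_M: "cvec.subspace M"
  by (auto simp: cvec.subspace_def M_def cinner_simps)

text \<open>An element of \<open>M\<close> without low Fourier coefficients satisfies
  \<open>\<langle>x, e\<^sub>k\<rangle> = \<langle>x, e\<^sub>k - g\<^sub>k\<rangle>\<close> for all high \<open>k\<close>, which is too small by Parseval's identity.\<close>

lemma M_finite_dim:
  obtains T where "finite T" "cvec.independent T" "cvec.span T = M"
proof (rule finite_dim_subspace[OF subspace_M, of "e ` {..<N}" "\<lambda>x. \<Sum>k<N. cinner x (e k) *\<^sub>C e k"])
  show "finite (e ` {..<N})" by simp
  show "(\<Sum>k<N. cinner (x + y) (e k) *\<^sub>C e k) = (\<Sum>k<N. cinner x (e k) *\<^sub>C e k) + (\<Sum>k<N. cinner y (e k) *\<^sub>C e k)" for x y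
    by (simp add: cinner_simps cvec.scale_left_distrib sum.distrib)
  show "(\<Sum>k<N. cinner (c *\<^sub>C x) (e k) *\<^sub>C e k) = c *\<^sub>C (\<Sum>k<N. cinner x (e k) *\<^sub>C e k)" for c x
    by (simp add: cinner_simps cvec.scale_sum_right)
  show "(\<Sum>k<N. cinner x (e k) *\<^sub>C e k) \<in> cvec.span (e ` {..<N})" for x
    by (intro cvec.span_sum cvec.span_scale cvec.span_base) auto
next
  fix x assume x: "x \<in> M" and z: "(\<Sum>k<N. cinner x (e k) *\<^sub>C e k) = 0"
  have co: "cmod (cinner x (e k)) \<le> norm x * \<rho> k" for k
  proof (cases "k < N")
    case True
    have "cinner x (e k) = cinner (\<Sum>k<N. cinner x (e k) *\<^sub>C e k) (e k)"
      using True by (simp add: cinner_finite_sum)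
    then show ?thesis by (simp add: z \<rho>_def True)
  next
    case False
    then have "cinner x (e k) = - cinner x (g k - e k)"
      using x by (simp add: M_def cinner_simps)
    then have "cmod (cinner x (e k)) \<le> norm x * norm (g k - e k)"
      using cinner_bound[of x "g k - e k"] by simp
    also have "\<dots> \<le> norm x * \<rho> k"
      using False by (intro mult_left_mono g_near') auto
    finally show ?thesis .
  qed
  have "(norm x)\<^sup>2 \<le> (norm x)\<^sup>2 * (\<Sum>k. (\<rho> k)\<^sup>2)"
  proof (rule sums_le[OF _ parseval])
    show "(\<lambda>k. (norm x)\<^sup>2 * (\<rho> k)\<^sup>2) sums ((norm x)\<^sup>2 * (\<Sum>k. (\<rho> k)\<^sup>2))"
      by (intro sums_mult summable_sums \<rho>_summable)
    show "(cmod (cinner x (e k)))\<^sup>2 \<le> (norm x)\<^sup>2 * (\<rho> k)\<^sup>2" for k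
      using power_mono[OF co norm_ge_zero, of k 2] by (simp add: power_mult_distrib)
  qed
  then show "x = 0"
    using \<rho>_small mult_strict_left_mono[OF \<rho>_small, of "(norm x)\<^sup>2"] by (cases "x = 0") auto
qed (rule that)

text \<open>The resolvent at \<open>z0\<close> is injective and maps \<open>M\<close> into itself, hence onto itself as \<open>M\<close> is
  finite-dimensional; so \<open>M\<close> lies in its range, the domain.\<close>

lemma M_subset_D: "M \<subseteq> D"
proof -
  define R where "R h = (THE y. y \<in> D \<and> H y - z0 *\<^sub>C y = h)" for h
  have R: "R h \<in> D" "H (R h) - z0 *\<^sub>C R h = h" for h
    using theI'[OF resolvent_ex1[of h]] by (auto simp: R_def)
  have Ru: "R h = y" if "y \<in> D" "H y - z0 *\<^sub>C y = h" for h y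
    using resolvent_ex1[of h] that R by blast
  have add: "R (x + y) = R x + R y" for x y
    by (rule Ru) (use R[of x] R[of y] in \<open>auto simp: A_add H_add cvec.scale_right_distrib algebra_simps\<close>)
  have scale: "R (c *\<^sub>C x) = c *\<^sub>C R x" for c x
  proof (rule Ru)
    show "c *\<^sub>C R x \<in> D" by (intro A_cscale R)
    have "H (c *\<^sub>C R x) - z0 *\<^sub>C c *\<^sub>C R x = c *\<^sub>C (H (R x) - z0 *\<^sub>C R x)"
      by (simp add: H_cscale R(1) cvec.scale_right_diff_distrib mult.commute)
    then show "H (c *\<^sub>C R x) - z0 *\<^sub>C c *\<^sub>C R x = c *\<^sub>C x" by (simp only: R(2))
  qed
  have inj: "inj R" by (metis R(2) injI)
  have RM: "R x \<in> M" if "x \<in> M" for x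
    unfolding M_def
  proof safe
    fix k assume k: "N \<le> k"
    have "cinner (H (R x) - z0 *\<^sub>C R x) (g k) = (l k - z0) * cinner (R x) (g k)"
      by (simp add: cinner_simps cinner_H_g R(1) k left_diff_distrib)
    then have "cinner x (g k) = (l k - z0) * cinner (R x) (g k)"
      by (simp only: R(2))
    moreover have "l k \<noteq> z0"
      using z0_far[of "a k"] l_near[OF k] C_pos by (auto simp: norm_minus_commute)
    ultimately show "cinner (R x) (g k) = 0"
      using that k by (simp add: M_def)
  qed
  obtain T where T: "finite T" "cvec.independent T" "cvec.span T = M" by (rule M_finite_dim)
  have "T \<subseteq> M" using T(3) cvec.span_superset by blast
  then have "M \<subseteq> cvec.span (R ` T)"
    using finite_dim_injective_surj[OF T(1,2) add scale] inj RM T(3) by (auto simp: inj_on_def inj_def)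
  also have "\<dots> \<subseteq> D"
    using R(1) by (intro cvec.span_minimal subspace_D) auto
  finally show ?thesis .
qed

sublocale M: invariant_subspace M H
proof
  show "cvec.subspace M" by (rule subspace_M)
  fix x y c assume x: "x \<in> M"
  then have xD: "x \<in> D" using M_subset_D by blast
  show "H x \<in> M" using x by (auto simp: M_def cinner_H_g xD)
  show "H (c *\<^sub>C x) = c *\<^sub>C H x" by (rule H_cscale[OF xD])
  show "H (x + y) = H x + H y" if "y \<in> M"
    using that xD M_subset_D by (intro H_add) auto
qed

text \<open>Eigenvectors for an eigenvalue close to \<open>a\<^sub>k\<close> are close to multiples of \<open>e\<^sub>k\<close>, hence not
  annihilated by \<open>g\<^sub>k\<close>. This makes the eigenvalues of the tail simple.\<close>

lemma eigenvector_detected: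
  assumes k: "N \<le> k" and x: "x \<in> D" "H x = l k *\<^sub>C x" "cinner x (g k) = 0"
  shows "x = 0"
proof -
  have "A x - of_real (a k) *\<^sub>C x = (l k - of_real (a k)) *\<^sub>C x - B x"
    using x(2) by (simp add: H_def cvec.scale_left_diff_distrib algebra_simps)
  then have "norm (A x - of_real (a k) *\<^sub>C x) \<le> cmod (l k - of_real (a k)) * norm x + norm (B x)"
    by (metis norm_cscale norm_triangle_ineq4)
  also have "\<dots> \<le> (2 * C) * norm x + C * norm x"
    using l_near[OF k] by (intro add_mono mult_right_mono B_bound) auto
  finally have 1: "norm (A x - of_real (a k) *\<^sub>C x) \<le> 3 * C * norm x" by simp
  have "norm (x - cinner x (e k) *\<^sub>C e k) \<le> norm (A x - of_real (a k) *\<^sub>C x) / d k"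
    unfolding reduced_A[OF x(1), symmetric] by (rule norm_reduced)
  also have "\<dots> \<le> 3 * C * norm x / d k"
    using 1 d_pos[of k] by (intro divide_right_mono) auto
  finally have 2: "norm (x - cinner x (e k) *\<^sub>C e k) \<le> (C / d k) * 3 * norm x" by (simp add: mult_ac)
  have "cinner x (e k) = - cinner x (g k - e k)"
    using x(3) by (simp add: cinner_simps)
  then have "cmod (cinner x (e k)) \<le> norm x * norm (g k - e k)"
    using cinner_bound[of x "g k - e k"] by simp
  also have "\<dots> \<le> norm x * (8 * C / d k)"
    by (intro mult_left_mono g_near k) auto
  finally have 3: "cmod (cinner x (e k)) \<le> (C / d k) * 8 * norm x" by (simp add: mult_ac)
  have "norm x \<le> norm (x - cinner x (e k) *\<^sub>C e k) + norm (cinner x (e k) *\<^sub>C e k)"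
    using norm_triangle_ineq[of "x - cinner x (e k) *\<^sub>C e k" "cinner x (e k) *\<^sub>C e k"] by simp
  also have "\<dots> \<le> (C / d k) * 3 * norm x + (C / d k) * 8 * norm x"
    using 2 3 by (simp add: norm_cscale)
  also have "\<dots> = 11 * ((C / d k) * norm x)" by simp
  also have "\<dots> \<le> 11 * ((1/16) * norm x)"
    using large[OF k] d_pos[of k] by (intro mult_left_mono mult_right_mono) (auto simp: divide_le_eq)
  finally show "x = 0" by simp
qed

lemma ker_pow_M_tail:
  assumes k: "N \<le> k" shows "x \<in> ker_pow D H (l k) n \<Longrightarrow> x \<in> M \<Longrightarrow> x = 0"
proof (induction n arbitrary: x)
  case (Suc n)
  then have x: "x \<in> D" "H x - l k *\<^sub>C x \<in> ker_pow D H (l k) n" by auto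
  have "H x - l k *\<^sub>C x \<in> M" using M.L_M[OF Suc.prems(2)] by (simp add: M.L_def)
  then have "H x - l k *\<^sub>C x = 0" using Suc.IH x by blast
  then show ?case
    using eigenvector_detected[OF k x(1)] Suc.prems(2) k by (simp add: M_def)
qed simp

section \<open>The projection onto the low spectral subspace\<close>

text \<open>The coefficients of low index are set to 0 so that all series can run over all indices.\<close>

definition tail_coeff :: "l2 \<Rightarrow> nat \<Rightarrow> complex" where "tail_coeff x k = (if k < N then 0 else cinner x (g k))"

lemma tail_coeff_add: "tail_coeff (x + y) k = tail_coeff x k + tail_coeff y k" and tail_coeff_cscale: "tail_coeff (c *\<^sub>C x) k = c * tail_coeff x k"
  by (simp_all add: tail_coeff_def cinner_simps)

lemma tail_coeff_bound: "(cmod (tail_coeff x k))\<^sup>2 \<le> 2 * (cmod (cinner x (e k)))\<^sup>2 + 2 * (norm x)\<^sup>2 * (\<rho> k)\<^sup>2"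
proof (cases "k < N")
  case False
  have "tail_coeff x k = cinner x (e k) + cinner x (g k - e k)"
    using False by (simp add: tail_coeff_def cinner_simps)
  then have "cmod (tail_coeff x k) \<le> cmod (cinner x (e k)) + norm x * norm (g k - e k)"
    using norm_triangle_ineq[of "cinner x (e k)" "cinner x (g k - e k)"] cinner_bound[of x "g k - e k"] by simp
  also have "\<dots> \<le> cmod (cinner x (e k)) + norm x * \<rho> k"
    using False by (intro add_left_mono mult_left_mono g_near') auto
  finally have "(cmod (tail_coeff x k))\<^sup>2 \<le> (cmod (cinner x (e k)) + norm x * \<rho> k)\<^sup>2"
    by (intro power_mono) auto
  also have "\<dots> \<le> 2 * (cmod (cinner x (e k)))\<^sup>2 + 2 * (norm x * \<rho> k)\<^sup>2"
    using sum_squares_bound[of "cmod (cinner x (e k))" "norm x * \<rho> k"] by (simp add: power2_sum)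
  finally show ?thesis by (simp add: power_mult_distrib)
qed (simp add: tail_coeff_def)

lemma tail_coeff_summable: "summable (\<lambda>k. (cmod (tail_coeff x k))\<^sup>2)"
  and tail_coeff_suminf: "(\<Sum>k. (cmod (tail_coeff x k))\<^sup>2) \<le> (2 * norm x)\<^sup>2"
proof -
  have s: "(\<lambda>k. 2 * (cmod (cinner x (e k)))\<^sup>2 + 2 * (norm x)\<^sup>2 * (\<rho> k)\<^sup>2)
      sums (2 * (norm x)\<^sup>2 + 2 * (norm x)\<^sup>2 * (\<Sum>k. (\<rho> k)\<^sup>2))"
    by (intro sums_add sums_mult parseval summable_sums \<rho>_summable)
  show c: "summable (\<lambda>k. (cmod (tail_coeff x k))\<^sup>2)"
    by (rule summable_comparison_test'[OF sums_summable[OF s], of 0]) (simp add: tail_coeff_bound)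
  have "(\<Sum>k. (cmod (tail_coeff x k))\<^sup>2) \<le> 2 * (norm x)\<^sup>2 + 2 * (norm x)\<^sup>2 * (\<Sum>k. (\<rho> k)\<^sup>2)"
    by (rule sums_le[OF tail_coeff_bound summable_sums[OF c] s])
  also have "\<dots> \<le> 2 * (norm x)\<^sup>2 + 2 * (norm x)\<^sup>2 * 1"
    using \<rho>_small by (intro add_left_mono mult_left_mono) auto
  finally show "(\<Sum>k. (cmod (tail_coeff x k))\<^sup>2) \<le> (2 * norm x)\<^sup>2"
    by (simp add: power_mult_distrib)
qed

definition deviation :: "nat \<Rightarrow> l2" where "deviation k = (if k < N then 0 else f k - e k)"

lemma deviation_bound: "norm (deviation k) \<le> \<rho> k"
  using f_near'[of k] by (auto simp: deviation_def) (simp add: \<rho>_def)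

lemmas deviation_series = weighted_series[OF tail_coeff_summable deviation_bound \<rho>_summable]

text \<open>The component of \<open>x\<close> along the \<open>f\<^sub>k\<close> with \<open>k \<ge> N\<close>. The two series converge for different reasons: the
  first is orthogonal, the second absolutely convergent.\<close>

definition tail_part :: "l2 \<Rightarrow> l2" where
  "tail_part x = (\<Sum>k. tail_coeff x k *\<^sub>C e k) + (\<Sum>k. tail_coeff x k *\<^sub>C deviation k)"

lemma tail_part_sums: "(\<lambda>k. tail_coeff x k *\<^sub>C f k) sums tail_part x"
proof -
  have "tail_coeff x k *\<^sub>C f k = tail_coeff x k *\<^sub>C e k + tail_coeff x k *\<^sub>C deviation k" for k
    by (simp add: tail_coeff_def deviation_def cvec.scale_right_diff_distrib)
  then show ?thesis
    unfolding tail_part_def by (simp only:) (intro sums_add summable_sums summable_basis deviation_series tail_coeff_summable)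
qed

lemma bounded_linear_tail_part: "bounded_linear tail_part"
proof (rule bounded_linear_intro[where K = 4])
  fix x y r
  have "(\<lambda>k. tail_coeff (x + y) k *\<^sub>C f k) sums (tail_part x + tail_part y)"
    using sums_add[OF tail_part_sums[of x] tail_part_sums[of y]] by (simp add: tail_coeff_add cvec.scale_left_distrib)
  then show "tail_part (x + y) = tail_part x + tail_part y" using tail_part_sums sums_unique2 by blast
  have "(\<lambda>k. tail_coeff (r *\<^sub>R x) k *\<^sub>C f k) sums (r *\<^sub>R tail_part x)"
    using sums_scaleR_right[OF tail_part_sums[of x], of r]
    by (simp add: scaleR_cscale tail_coeff_cscale)
  then show "tail_part (r *\<^sub>R x) = r *\<^sub>R tail_part x" using tail_part_sums sums_unique2 by blast
  have "(norm (\<Sum>k. tail_coeff x k *\<^sub>C e k))\<^sup>2 \<le> (2 * norm x)\<^sup>2"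
    using norm_suminf_basis[OF tail_coeff_summable, of x] tail_coeff_suminf[of x] by simp
  moreover have "(norm (\<Sum>k. tail_coeff x k *\<^sub>C deviation k))\<^sup>2 \<le> (2 * norm x)\<^sup>2"
  proof -
    have "(\<Sum>k. (cmod (tail_coeff x k))\<^sup>2) * (\<Sum>k. (\<rho> k)\<^sup>2) \<le> (2 * norm x)\<^sup>2 * 1"
      using \<rho>_small tail_coeff_suminf by (intro mult_mono suminf_nonneg \<rho>_summable) auto
    then show ?thesis using deviation_series(2)[of x] by simp
  qed
  ultimately have "norm (\<Sum>k. tail_coeff x k *\<^sub>C e k) \<le> 2 * norm x" "norm (\<Sum>k. tail_coeff x k *\<^sub>C deviation k) \<le> 2 * norm x"
    by (meson mult_nonneg_nonneg norm_ge_zero power2_le_imp_le zero_le_numeral)+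
  then show "norm (tail_part x) \<le> norm x * 4"
    unfolding tail_part_def using norm_triangle_ineq[of "\<Sum>k. tail_coeff x k *\<^sub>C e k" "\<Sum>k. tail_coeff x k *\<^sub>C deviation k"] by simp
qed

lemma tail_part_cscale: "tail_part (c *\<^sub>C x) = c *\<^sub>C tail_part x"
proof (rule sums_unique2[OF tail_part_sums])
  have "(\<lambda>k. c *\<^sub>C tail_coeff x k *\<^sub>C f k) sums (c *\<^sub>C tail_part x)"
    by (rule bounded_linear.sums[OF bounded_linear_cscale tail_part_sums])
  then show "(\<lambda>k. tail_coeff (c *\<^sub>C x) k *\<^sub>C f k) sums (c *\<^sub>C tail_part x)"
    by (simp add: tail_coeff_cscale)
qed

lemma cinner_tail_part_g: assumes "N \<le> k" shows "cinner (tail_part x) (g k) = cinner x (g k)"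
proof (rule sums_unique2[OF bounded_linear_sums_cinner[OF tail_part_sums]])
  have "cinner (tail_coeff x j *\<^sub>C f j) (g k) = (if j = k then cinner x (g k) else 0)" for j
    using assms biorthogonal[of j k] by (auto simp: tail_coeff_def cinner_simps)
  then show "(\<lambda>j. cinner (tail_coeff x j *\<^sub>C f j) (g k)) sums cinner x (g k)"
    using sums_single[of k "\<lambda>_. cinner x (g k)"] by simp
qed

lemma tail_part_M: "x \<in> M \<Longrightarrow> tail_part x = 0"
proof -
  assume "x \<in> M"
  then have "tail_coeff x = (\<lambda>k. 0)" by (auto simp: tail_coeff_def M_def)
  then show ?thesis using tail_part_sums[of x] sums_unique2[OF _ sums_zero] by simp
qed

lemma tail_part_f: assumes "N \<le> k" shows "tail_part (f k) = f k"
proof (rule sums_unique2[OF tail_part_sums])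
  have "tail_coeff (f k) j *\<^sub>C f j = (if j = k then f j else 0)" for j
    using assms biorthogonal[of k j] by (auto simp: tail_coeff_def)
  then show "(\<lambda>j. tail_coeff (f k) j *\<^sub>C f j) sums f k"
    using sums_single[of k f] by simp
qed

definition P :: "nat \<Rightarrow> l2 \<Rightarrow>\<^sub>L l2" where
  "P k = (case k of 0 \<Rightarrow> Blinfun (\<lambda>x. x - tail_part x) | Suc i \<Rightarrow> rank_one (f (i + N)) (g (i + N)))"

text \<open>As in \<open>P\<close>, index 0 stands for the low part, here the span of the first \<open>N\<close> basis vectors, and index
  \<open>i + 1\<close> for the eigenvalue of index \<open>i + N\<close>.\<close>

definition P0 :: "nat \<Rightarrow> l2 \<Rightarrow>\<^sub>L l2" where
  "P0 k = (case k of 0 \<Rightarrow> (\<Sum>j<N. rank_one (e j) (e j)) | Suc i \<Rightarrow> rank_one (e (i + N)) (e (i + N)))"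

lemma P_0: "P 0 x = x - tail_part x"
  by (simp add: P_def bounded_linear_Blinfun_apply bounded_linear_sub bounded_linear_ident bounded_linear_tail_part)

lemma P_Suc: "P (Suc i) x = cinner x (g (i + N)) *\<^sub>C f (i + N)"
  by (simp add: P_def rank_one_apply)

lemma P0_0: "P0 0 x = (\<Sum>j<N. cinner x (e j) *\<^sub>C e j)"
  by (simp add: P0_def blinfun.sum_left rank_one_apply)

lemma P0_Suc: "P0 (Suc i) x = cinner x (e (i + N)) *\<^sub>C e (i + N)"
  by (simp add: P0_def rank_one_apply)

lemma P_0_M: "P 0 x \<in> M"
  by (simp add: P_0 M_def cinner_simps cinner_tail_part_g)

lemma P_0_id: "x \<in> M \<Longrightarrow> P 0 x = x"
  by (simp add: P_0 tail_part_M)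

lemma range_P_0: "range (P 0) = M"
  using P_0_M P_0_id by (metis image_subsetI rangeI subsetI subset_antisym)

lemma P_projection: "projection (P k)"
proof (cases k)
  case 0
  have "P 0 (c *\<^sub>C x) = c *\<^sub>C P 0 x" for c x
    by (simp add: P_0 tail_part_cscale cvec.scale_right_diff_distrib)
  then show ?thesis
    unfolding 0 projection_def by (auto intro!: blinfun_eqI simp: P_0_id P_0_M)
next
  case (Suc i)
  then show ?thesis by (simp add: P_def projection_rank_one fg_one)
qed

lemma P_disjoint: "k \<noteq> m \<Longrightarrow> P k o\<^sub>L P m = 0"
proof (rule blinfun_eqI)
  fix x assume km: "k \<noteq> m"
  have "P k (P m x) = 0"
  proof (cases k; cases m)
    fix j assume kj: "k = 0" "m = Suc j"
    show ?thesis
      unfolding kj P_Suc P_0 tail_part_cscale by (simp add: tail_part_f)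
  next
    fix i assume ki: "k = Suc i" "m = 0"
    show ?thesis
      unfolding ki P_Suc[of i "P 0 x"] using P_0_M[of x] by (simp add: M_def)
  next
    fix i j assume "k = Suc i" "m = Suc j"
    then show ?thesis using km biorthogonal by (simp add: P_Suc cinner_simps)
  qed (use km in auto)
  then show "blinfun_apply (P k o\<^sub>L P m) x = blinfun_apply 0 x" by simp
qed

lemma P_sums: "(\<lambda>k. P k x) sums x"
proof -
  have "(\<lambda>i. tail_coeff x (i + N) *\<^sub>C f (i + N)) sums tail_part x"
    using tail_part_sums[of x] by (subst sums_zero_iff_shift) (auto simp: tail_coeff_def)
  then have "(\<lambda>i. P (Suc i) x) sums tail_part x"
    by (simp add: P_Suc tail_coeff_def)
  from sums_Suc[OF this] show ?thesis by (simp add: P_0)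
qed

text \<open>If \<open>P 0\<close> vanished, \<open>e\<^sub>0\<close> would be a series \<open>\<Sum> c\<^sub>k f\<^sub>k\<close> over high indices. With \<open>v = \<Sum> c\<^sub>k e\<^sub>k\<close>, which
  is orthogonal to \<open>e\<^sub>0\<close>, this gives \<open>|e\<^sub>0 - v|\<^sup>2 = 1 + |v|\<^sup>2\<close>. But \<open>e\<^sub>0 - v = \<Sum> c\<^sub>k (f\<^sub>k - e\<^sub>k)\<close> has norm at
  most that of \<open>v\<close>.\<close>

lemma P_nonzero: "P k \<noteq> 0"
proof (cases k)
  case 0
  show ?thesis
  proof
    assume "P k = 0"
    then have "P 0 (e 0) = 0" using 0 by simp
    then have E0: "e 0 = tail_part (e 0)" by (simp add: P_0)
    define v where "v = (\<Sum>k. tail_coeff (e 0) k *\<^sub>C e k)"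
    define T where "T = (\<Sum>k. (cmod (tail_coeff (e 0) k))\<^sup>2)"
    have vT: "(norm v)\<^sup>2 = T"
      unfolding v_def T_def by (rule norm_suminf_basis[OF tail_coeff_summable])
    have "cinner v (e 0) = 0"
      using N_pos by (simp add: v_def cinner_suminf_basis[OF tail_coeff_summable]) (simp add: tail_coeff_def)
    then have "e 0 \<bullet> (- v) = 0"
      using cinner_commute[of "e 0" v] by (simp add: inner_l2_def cinner_simps)
    then have "(norm (e 0 + - v))\<^sup>2 = (norm (e 0))\<^sup>2 + (norm (- v))\<^sup>2"
      using norm_add_Pythagorean[of "e 0" "- v"] by (simp add: orthogonal_def)
    then have "1 + T = (norm (e 0 - v))\<^sup>2"
      by (simp add: vT)
    also have "e 0 - v = (\<Sum>k. tail_coeff (e 0) k *\<^sub>C deviation k)"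
      by (subst E0) (simp add: tail_part_def v_def)
    also have "(norm \<dots>)\<^sup>2 \<le> T * (\<Sum>k. (\<rho> k)\<^sup>2)"
      unfolding T_def by (rule deviation_series(2))
    also have "\<dots> \<le> T * 1"
      using \<rho>_small vT by (intro mult_left_mono) (auto simp flip: vT)
    finally show False by simp
  qed
next
  case (Suc i)
  have "P k (f (i + N)) = f (i + N)" by (simp add: Suc P_Suc fg_one)
  moreover have "f (i + N) \<noteq> 0" using fg_one[of "i + N"] by auto
  ultimately show ?thesis by auto
qed

lemma P_range:
  "finite_rank (P k)" "range (P k) = cvec.span (root_vectors D H \<inter> range (P k))"
proof -
  have "finite_rank (P k) \<and> range (P k) = cvec.span (root_vectors D H \<inter> range (P k))"
  proof (cases k)
    case 0
    obtain T where T: "finite T" "cvec.independent T" "cvec.span T = M" by (rule M_finite_dim)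
    have roots: "cvec.span M.roots = M"
      using T by (intro M.span_roots[of T]) auto
    have "M.roots \<subseteq> insert 0 (root_vectors D H \<inter> M)"
      using ker_pow_mono[OF M_subset_D] M.K_subset by (fastforce simp: root_vectors_def)
    from cvec.span_mono[OF this] have "M \<subseteq> cvec.span (insert 0 (root_vectors D H \<inter> M))"
      unfolding roots .
    then have "M \<subseteq> cvec.span (root_vectors D H \<inter> M)"
      by (simp add: cvec.span_insert_0)
    moreover have "cvec.span (root_vectors D H \<inter> M) \<subseteq> M"
      by (intro cvec.span_minimal subspace_M) auto
    ultimately show ?thesis
      unfolding 0 range_P_0 finite_rank_def using T by blast
  next
    case (Suc i)
    let ?f = "f (i + N)"
    have r: "range (P k) = cvec.span {?f}"
      unfolding Suc P_def by (simp add: range_rank_one fg_one)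
    have "?f \<noteq> 0" using fg_one[of "i + N"] by auto
    moreover have "?f \<in> ker_pow D H (l (i + N)) (Suc 0)"
      by (simp add: f_D H_f)
    ultimately have "?f \<in> root_vectors D H \<inter> range (P k)"
      unfolding root_vectors_def r using cvec.span_base[of ?f "{?f}"] by blast
    then have "cvec.span {?f} \<subseteq> cvec.span (root_vectors D H \<inter> range (P k))"
      by (intro cvec.span_mono) auto
    moreover have "cvec.span (root_vectors D H \<inter> range (P k)) \<subseteq> cvec.span {?f}"
      unfolding r by (intro cvec.span_minimal cvec.subspace_span) auto
    ultimately show ?thesis
      unfolding finite_rank_def r[symmetric] by (metis finite.emptyI finite.insertI r subset_antisym)
  qed
  then show "finite_rank (P k)" "range (P k) = cvec.span (root_vectors D H \<inter> range (P k))" by auto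
qed

text \<open>A root vector for another eigenvalue is orthogonal to the eigenvectors of the adjoint.\<close>

lemma cinner_ker_pow:
  assumes k: "N \<le> k" and lz: "l k \<noteq> z"
  shows "y \<in> ker_pow D H z n \<Longrightarrow> cinner y (g k) = 0"
proof (induction n arbitrary: y)
  case (Suc n)
  then have y: "y \<in> D" "H y - z *\<^sub>C y \<in> ker_pow D H z n" by auto
  then have "(l k - z) * cinner y (g k) = 0"
    using Suc.IH[OF y(2)] by (simp add: cinner_simps cinner_H_g k left_diff_distrib)
  then show ?case using lz by simp
qed simp

lemma ker_pow_diff_tail:
  assumes k: "N \<le> k" and y: "y \<in> ker_pow D H (l k) (Suc n)"
  shows "y - c *\<^sub>C f k \<in> ker_pow D H (l k) (Suc n)"
proof -
  have "c *\<^sub>C f k \<in> D" by (intro A_cscale f_D k)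
  moreover have "y \<in> D" using y by simp
  ultimately have "y - c *\<^sub>C f k \<in> D" "H (y - c *\<^sub>C f k) = H y - H (c *\<^sub>C f k)"
    using cvec.subspace_diff[OF subspace_D] H_add[of "y - c *\<^sub>C f k" "c *\<^sub>C f k"]
    by auto
  moreover have "H (c *\<^sub>C f k) = l k *\<^sub>C c *\<^sub>C f k"
    by (simp add: H_cscale f_D k H_f mult.commute)
  ultimately show ?thesis
    using y by (simp add: cvec.scale_right_diff_distrib)
qed

text \<open>For the eigenvalue of \<open>f\<^sub>k\<close>, subtracting the component along \<open>f\<^sub>k\<close> leaves a root vector in \<open>M\<close> for the
  same eigenvalue, which is 0 by \<open>ker_pow_M_tail\<close>. Root vectors for all other eigenvalues are in \<open>M\<close>.\<close>

lemma root_vector_in_range: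
  assumes "y \<in> root_vectors D H" shows "y \<in> (\<Union>k. range (P k))"
proof -
  obtain z n where y: "y \<noteq> 0" "y \<in> ker_pow D H z n"
    using assms by (auto simp: root_vectors_def)
  then obtain n' where n: "n = Suc n'" by (cases n) auto
  show ?thesis
  proof (cases "\<exists>k\<ge>N. l k = z")
    case True
    then obtain k where k: "N \<le> k" "l k = z" by blast
    define v where "v = y - cinner y (g k) *\<^sub>C f k"
    have v1: "v \<in> ker_pow D H (l k) (Suc n')"
      unfolding v_def by (rule ker_pow_diff_tail) (use y n k in auto)
    have "v \<in> M"
      unfolding M_def
    proof safe
      fix j assume j: "N \<le> j"
      show "cinner v (g j) = 0"
      proof (cases "j = k")
        case True
        then show ?thesis using k by (simp add: v_def cinner_simps fg_one)
      next
        case False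
        then show ?thesis using cinner_ker_pow[OF j l_distinct[OF j k(1) False] v1] by simp
      qed
    qed
    then have "v = 0" using ker_pow_M_tail[OF k(1) v1] by blast
    then have "y = P (Suc (k - N)) y" using k by (simp add: v_def P_Suc)
    then show ?thesis by (metis UN_I UNIV_I rangeI)
  next
    case False
    then have "y \<in> M" using cinner_ker_pow y(2) by (auto simp: M_def)
    then show ?thesis using range_P_0 by blast
  qed
qed

lemma P0_projection: "orth_projection (P0 k)"
proof (cases k)
  case 0
  have "P0 0 (P0 0 x) = P0 0 x" for x
    by (simp add: P0_0 cinner_finite_sum)
  moreover have "P0 0 (c *\<^sub>C x) = c *\<^sub>C P0 0 x" for c x
    by (simp add: P0_0 cinner_simps cvec.scale_sum_right)
  moreover have "cinner (P0 0 x) y = cinner x (P0 0 y)" for x y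
    by (simp add: P0_0 cinner_sum_left cinner_sum_right cinner_simps) (metis cinner_commute mult.commute)
  ultimately show ?thesis
    unfolding 0 orth_projection_def projection_def by (auto intro!: blinfun_eqI)
next
  case (Suc i)
  have "cinner (P0 (Suc i) x) y = cinner x (P0 (Suc i) y)" for x y
    unfolding P0_Suc by (simp add: cinner_simps) (metis cinner_commute mult.commute)
  moreover have "projection (P0 (Suc i))"
    by (simp add: P0_def projection_rank_one orthonormal)
  ultimately show ?thesis
    unfolding Suc orth_projection_def by blast
qed

lemma P0_disjoint: "k \<noteq> m \<Longrightarrow> P0 k o\<^sub>L P0 m = 0"
proof (rule blinfun_eqI)
  fix x assume km: "k \<noteq> m"
  have "P0 k (P0 m x) = 0"
    using km by (cases k; cases m) (auto simp: P0_0 P0_Suc cinner_simps orthonormal cinner_finite_sum)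
  then show "blinfun_apply (P0 k o\<^sub>L P0 m) x = blinfun_apply 0 x" by simp
qed

lemma P0_sums: "(\<lambda>k. P0 k x) sums x"
proof -
  have "(\<lambda>i. cinner x (e (i + N)) *\<^sub>C e (i + N)) sums (x - P0 0 x)"
    unfolding P0_0 by (rule sums_split_initial_segment[OF expansion])
  then have "(\<lambda>i. P0 (Suc i) x) sums (x - P0 0 x)"
    by (simp add: P0_Suc)
  from sums_Suc[OF this] show ?thesis by simp
qed

lemma P0_nonzero: "P0 k \<noteq> 0"
proof -
  obtain j where "P0 k (e j) = e j"
  proof (cases k)
    case 0
    have "P0 0 (e 0) = e 0"
      by (rule eq_by_coeffs) (use N_pos in \<open>simp add: P0_0 cinner_finite_sum orthonormal\<close>)
    then show ?thesis using that 0 by blast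
  next
    case (Suc i)
    then show ?thesis using that[of "i + N"] by (simp add: P0_Suc orthonormal)
  qed
  moreover have "e j \<noteq> 0" by (metis norm_e norm_zero zero_neq_one)
  ultimately show ?thesis by auto
qed

lemma P_near_P0: "norm (P (Suc i) - P0 (Suc i)) \<le> 24 * C * (1 / d (i + N))"
proof -
  let ?k = "i + N"
  have r: "\<rho> ?k = 8 * C / d ?k" by (simp add: \<rho>_def)
  have f2: "norm (f ?k) \<le> 2"
    using norm_triangle_ineq[of "e ?k" "f ?k - e ?k"] f_near'[of ?k] \<rho>_half[of ?k] by simp
  have "norm (P (Suc i) - P0 (Suc i)) \<le> norm (g ?k - e ?k) * norm (f ?k) + norm (f ?k - e ?k)"
    unfolding P_def P0_def by (simp add: norm_rank_one_diff)
  also have "\<dots> \<le> \<rho> ?k * 2 + \<rho> ?k"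
    using f2 g_near'[of ?k] f_near'[of ?k] order_trans[OF norm_ge_zero g_near'[of ?k]]
    by (intro add_mono mult_mono) auto
  finally show ?thesis by (simp add: r)
qed

lemma summable_P_P0: "summable (\<lambda>k. (norm (P (k + 1) - P0 (k + 1)))\<^sup>2)"
proof (rule summable_comparison_test'[where N = 0])
  show "summable (\<lambda>k. (24 * C)\<^sup>2 * (1 / d (k + N))\<^sup>2)"
    by (intro summable_mult summable_ignore_initial_segment[OF d_summable])
  show "norm ((norm (P (k + 1) - P0 (k + 1)))\<^sup>2) \<le> (24 * C)\<^sup>2 * (1 / d (k + N))\<^sup>2" for k
    using power_mono[OF P_near_P0[of k] norm_ge_zero, of 2] by (simp add: power_mult_distrib power_divide)
qed

lemma bari_basis_root_vectors: "bari_basis (root_vectors D H)"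
proof -
  have pr0: "projection (P0 k)" for k using P0_projection by (simp add: orth_projection_def)
  note c = complete_minimal_system[OF P_projection P_disjoint P_nonzero P_sums]
  note c0 = complete_minimal_system[OF pr0 P0_disjoint P0_nonzero P0_sums]
  show ?thesis
    unfolding bari_basis_def
    by (intro exI[of _ P] exI[of _ P0] conjI allI impI P_projection P_range P_disjoint c c0
        P0_projection P0_disjoint subsetI root_vector_in_range exI[of _ 1] summable_P_P0)
qed

end

section \<open>The Bari property of perturbed diagonal operators\<close>

theorem (in perturbation_with_adjoint) bari_basis_perturbed: "bari_basis (root_vectors D H)"
proof -
  \<comment> \<open>Beyond \<open>N1\<close> the gaps are large enough for \<open>eigenpair_near_basis\<close>, beyond \<open>N2\<close> the tail is small.\<close>
  define q where "q k = (8 * C / d k)\<^sup>2" for k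
  have q: "summable q"
    using summable_mult[OF d_summable, of "(8 * C)\<^sup>2"]
    by (simp add: q_def[abs_def] power_divide power_mult_distrib)
  have "\<forall>\<^sub>F k in sequentially. q k < (1/2)\<^sup>2"
    using summable_LIMSEQ_zero[OF q] by (rule order_tendstoD) simp
  then obtain N1 where N1: "\<And>k. k \<ge> N1 \<Longrightarrow> q k < (1/2)\<^sup>2"
    by (auto simp: eventually_sequentially)
  have big: "16 * C \<le> d k" if "k \<ge> N1" for k
  proof -
    have "8 * C / d k < 1/2"
      using N1[OF that] unfolding q_def by (rule power_less_imp_less_base) simp
    then show ?thesis using d_pos[of k] by (simp add: divide_less_eq)
  qed
  obtain N2 where N2: "\<And>n. n \<ge> N2 \<Longrightarrow> norm (\<Sum>i. q (i + n)) < 1"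
    using suminf_exist_split[OF _ q, of 1] by auto
  define N where "N = Suc (max N1 N2)"
  have "\<forall>k. \<exists>f g l. 16 * C \<le> d k \<longrightarrow> f \<in> D \<and> g \<in> D \<and> H f = l *\<^sub>C f \<and> adj.H g = cnj l *\<^sub>C g
    \<and> cmod (l - of_real (a k)) \<le> 2 * C \<and> cinner f g = 1
    \<and> norm (f - e k) \<le> 8 * C / d k \<and> norm (g - e k) \<le> 8 * C / d k"
    using eigenpair_near_basis by metis
  then obtain f g l where fgl: "\<And>k. 16 * C \<le> d k \<Longrightarrow> f k \<in> D \<and> g k \<in> D \<and> H (f k) = l k *\<^sub>C f k
    \<and> adj.H (g k) = cnj (l k) *\<^sub>C g k
    \<and> cmod (l k - of_real (a k)) \<le> 2 * C \<and> cinner (f k) (g k) = 1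
    \<and> norm (f k - e k) \<le> 8 * C / d k \<and> norm (g k - e k) \<le> 8 * C / d k"
    by metis
  interpret separated_system e a d D A B B' C N f g l
  proof
    show "0 < N" by (simp add: N_def)
    have "(\<lambda>k. (if k < N then 0 else 8 * C / d k)\<^sup>2) sums (\<Sum>i. q (i + N))"
    proof (subst sums_zero_iff_shift[symmetric, of N])
      show "(\<lambda>i. (if i + N < N then 0 else 8 * C / d (i + N))\<^sup>2) sums (\<Sum>i. q (i + N))"
        using summable_sums[OF summable_ignore_initial_segment[OF q, of N]] by (simp add: q_def)
    qed simp
    then have "(\<Sum>k. (if k < N then 0 else 8 * C / d k)\<^sup>2) = (\<Sum>i. q (i + N))"
      by (rule sums_unique[symmetric])
    then show "(\<Sum>k. (if k < N then 0 else 8 * C / d k)\<^sup>2) < 1"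
      using N2[of N] by (simp add: N_def abs_less_iff)
    fix k assume "N \<le> k"
    then have b: "16 * C \<le> d k" by (intro big) (simp add: N_def)
    then show "16 * C \<le> d k" .
    from fgl[OF b] show "f k \<in> D" "g k \<in> D" "H (f k) = l k *\<^sub>C f k" "adj.H (g k) = cnj (l k) *\<^sub>C g k"
      "cmod (l k - of_real (a k)) \<le> 2 * C" "cinner (f k) (g k) = 1"
      "norm (f k - e k) \<le> 8 * C / d k" "norm (g k - e k) \<le> 8 * C / d k" by auto
  qed
  show ?thesis by (rule bari_basis_root_vectors)
qed

section \<open>Application to the functional-differential operator\<close>

text \<open>The difference is \<open>\<pi>\<^sup>2 (j - k) (j + k)\<close>.\<close>

lemma eigval_gap: assumes "j \<noteq> k" shows "real k + 1 \<le> \<bar>eigval j - eigval k\<bar>"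
proof -
  have f: "eigval j - eigval k = pi\<^sup>2 * ((real j - real k) * (real j + real k))"
    by (simp add: eigval_def power2_eq_square algebra_simps)
  have "1 \<le> \<bar>real j - real k\<bar>" using assms by linarith
  then have "1 * (real j + real k) \<le> \<bar>real j - real k\<bar> * (real j + real k)"
    by (intro mult_right_mono) auto
  moreover have "2 \<le> pi\<^sup>2"
    using pi_gt3 power_mono[of 3 pi 2] by simp
  ultimately have "2 * (real j + real k) \<le> pi\<^sup>2 * (\<bar>real j - real k\<bar> * (real j + real k))"
    by (intro mult_mono) auto
  also have "\<dots> = \<bar>eigval j - eigval k\<bar>"
    unfolding f by (simp add: abs_mult)
  finally have "2 * (real j + real k) \<le> \<bar>eigval j - eigval k\<bar>" .
  moreover have "real k + 1 \<le> 2 * (real j + real k)"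
  proof -
    have "k + 1 \<le> 2 * (j + k)" using assms by presburger
    then have "real (k + 1) \<le> real (2 * (j + k))" by (simp only: of_nat_le_iff)
    then show ?thesis by simp
  qed
  ultimately show ?thesis by (rule order_trans[rotated])
qed

interpretation neumann: diagonal_operator cos_vec eigval "\<lambda>k. real k + 1" dom_A op_A
proof
  show "w \<in> dom_A \<and> op_A w = h \<longleftrightarrow> (\<forall>k. cinner h (cos_vec k) = of_real (eigval k) * cinner w (cos_vec k))" for w h
    by (rule op_A_iff)
  show "j \<noteq> k \<Longrightarrow> real k + 1 \<le> \<bar>eigval j - eigval k\<bar>" for j k by (rule eigval_gap)
  have "summable (\<lambda>k. inverse (real (Suc k) ^ 2))"
    using inverse_power_summable[of 2] by (subst summable_Suc_iff) simp
  then show "summable (\<lambda>k. (1 / (real k + 1))\<^sup>2)"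
    by (simp add: power_divide inverse_eq_divide add.commute)
qed simp

lemma op_B_linear:
  assumes "V \<in> linf" "Q \<in> linf"
  shows "op_B V Q \<alpha> \<beta> (x + y) = op_B V Q \<alpha> \<beta> x + op_B V Q \<alpha> \<beta> y"
    "op_B V Q \<alpha> \<beta> (c *\<^sub>C x) = c *\<^sub>C op_B V Q \<alpha> \<beta> x"
  by (simp_all add: op_B_def assms mult_op_add mult_op_cscale shift_op_add shift_op_cscale
      cvec.scale_right_distrib)

theorem theorem4:
  fixes V Q :: "real \<Rightarrow> complex" and \<alpha> \<beta> :: real
  assumes "V \<in> linf" and "Q \<in> linf"
    and "\<alpha> \<in> {0..1}" and "\<beta> \<in> {0..1}"
  shows "bari_basis (root_vectors dom_A (op_H V Q \<alpha> \<beta>))"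
proof -
  let ?V = "\<lambda>x. cnj (V x)" and ?Q = "\<lambda>x. cnj (Q x)"
  note V = assms(1) linf_cnj[OF assms(1)] and Q = assms(2) linf_cnj[OF assms(2)]
  define B where "B = op_B V Q \<alpha> \<beta>"
  define B' where "B' y = shift_op (- \<alpha>) (mult_op ?V y) + shift_op \<beta> (mult_op ?Q y)" for y
  obtain c1 where c1: "0 \<le> c1" "\<And>f. norm (mult_op V f) \<le> c1 * norm f" using mult_op_bounded[OF V(1)] by blast
  obtain c2 where c2: "0 \<le> c2" "\<And>f. norm (mult_op Q f) \<le> c2 * norm f" using mult_op_bounded[OF Q(1)] by blast
  obtain c3 where c3: "0 \<le> c3" "\<And>f. norm (mult_op ?V f) \<le> c3 * norm f" using mult_op_bounded[OF V(2)] by blast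
  obtain c4 where c4: "0 \<le> c4" "\<And>f. norm (mult_op ?Q f) \<le> c4 * norm f" using mult_op_bounded[OF Q(2)] by blast
  define C where "C = c1 + c2 + c3 + c4 + 1"
  have C: "0 < C" "c1 + c2 \<le> C" "c3 + c4 \<le> C" using c1 c2 c3 c4 by (auto simp: C_def)
  interpret perturbation_with_adjoint cos_vec eigval "\<lambda>k. real k + 1" dom_A op_A B B' C
  proof
    fix x y c
    show "B (x + y) = B x + B y" "B (c *\<^sub>C x) = c *\<^sub>C B x"
      unfolding B_def by (rule op_B_linear[OF assms(1,2)])+
    show "B' (x + y) = B' x + B' y" "B' (c *\<^sub>C x) = c *\<^sub>C B' x"
      by (simp_all add: B'_def V Q mult_op_add mult_op_cscale shift_op_add shift_op_cscale
          cvec.scale_right_distrib)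
    show "0 < C" by (rule C)
    have "norm (B x) \<le> c1 * norm x + c2 * norm x"
      unfolding B_def op_B_def
      using c1 c2 norm_shift_op
      by (intro norm_triangle_le add_mono) (meson mult_left_mono order_trans)+
    also have "\<dots> \<le> C * norm x"
      using mult_right_mono[OF C(2) norm_ge_zero[of x]] by (simp add: distrib_right)
    finally show "norm (B x) \<le> C * norm x" .
    have "norm (B' x) \<le> c3 * norm x + c4 * norm x"
      unfolding B'_def
      using c3 c4 norm_shift_op
      by (intro norm_triangle_le add_mono) (meson order_trans)+
    also have "\<dots> \<le> C * norm x"
      using mult_right_mono[OF C(3) norm_ge_zero[of x]] by (simp add: distrib_right)
    finally show "norm (B' x) \<le> C * norm x" .
    show "cinner (B x) y = cinner x (B' y)"
      by (simp add: B_def B'_def op_B_def cinner_simps mult_op_adjoint V Q shift_op_adjoint)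
  qed
  have "H = op_H V Q \<alpha> \<beta>"
  proof (rule ext)
    fix y show "H y = op_H V Q \<alpha> \<beta> y"
      unfolding H_def unfolding op_H_def B_def ..
  qed
  then show ?thesis using bari_basis_perturbed by simp
qed

end
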